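(* For a rooted pointed quadrangulation $Q$ of the sphere with $N\ge1$ faces, let $d(v)$ be the graph distance of a vertex $v$ to the origin and apply Schaeffer's prescription to the labeling $\ell=-d$. The resulting planar map $\Phi(Q)$ contains the origin, which we take as its distinguished vertex, and is rooted at the corner, at the endpoint $v$ of the root edge of $Q$ with smaller distance $d(v)$, into which the root edge of $Q$ points. Then $\Phi$ is a bijection from the set $\mathcal{Q}$ of rooted pointed quadrangulations of the sphere onto the set $\mathcal{M}$ of rooted pointed planar maps with at least one edge, and: (i) the number of edges of $\Phi(Q)$ equals the number of faces of $Q$; (ii) the number of faces of $\Phi(Q)$ equals the number of local maxima of the distance labeling $d$ on $Q$; (iii) the graph distance in $\Phi(Q)$ from the origin to the root vertex equals the distance in $Q$ from the origin to the closer endpoint of the root edge. Consequently, for all $N,n,t$, the number of rooted pointed planar maps with $N$ edges, $n$ faces and root vertex at distance $t$ from the origin equals the number of rooted pointed quadrangulations with $N$ faces, exactly $n$ local maxima of the distance labeling, and root edge whose closer endpoint is at distance $t$ from the origin.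
   Context: A planar map is a connected multigraph embedded in the oriented 2-sphere without crossings, up to orientation-preserving deformation; a quadrangulation is a planar map with all faces of degree 4. A rooted pointed quadrangulation is a quadrangulation with a distinguished vertex (the origin) and a marked unoriented edge (root edge). A rooted pointed planar map is a planar map with a distinguished vertex (origin) and a marked corner (root corner, whose vertex is the root vertex). A local maximum of the distance labeling is a vertex all of whose neighbours are strictly closer to the origin (equivalently, whose distance is $\ge$ that of all neighbours). Schaeffer's prescription, for vertex labels $\ell$ differing by exactly one along edges: each face has cyclic labels $(t-1,t,t+1,t)$ (simple) or $(t+1,t,t+1,t)$ (confluent); inside each confluent face draw the diagonal joining the two corners labelled $t+1$; inside each simple face draw an edge parallel to the side joining the corner labelled $t+1$ to the next corner in clockwise order; discard the original edges and keep the vertices incident to new edges. *)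

theory Defs
  imports Main
begin

section \<open>Combinatorial maps (rotation systems)\<close>

text \<open>A map is encoded by a finite set of darts (half-edges) with a fixed-point-free
involution (edge_inv, pairing the two darts of an edge) and a permutation (vert_rot)
giving the counterclockwise cyclic order of darts around their common vertex.
Faces are the cycles of faceperm = vert_rot o edge_inv; with this convention a face
cycle d, faceperm d, ... visits the corners of the face in clockwise order.
The corner associated with dart d is the angular sector between the dart preceding
d counterclockwise (inverse vert_rot of d) and d itself; it lies at the origin vertex
of d and in the face containing d.  Maps are considered up to isomorphism
(orientation-preserving relabelling of darts).\<close>

record cmap =
  darts :: "nat set"
  edge_inv :: "nat \<Rightarrow> nat"
  vert_rot :: "nat \<Rightarrow> nat"

definition orb :: "('a \<Rightarrow> 'a) \<Rightarrow> 'a \<Rightarrow> 'a set" where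
  "orb f x = {(f ^^ n) x | n. True}"

definition faceperm :: "'a cmap_scheme \<Rightarrow> nat \<Rightarrow> nat" where
  "faceperm M = vert_rot M \<circ> edge_inv M"

definition vertices :: "'a cmap_scheme \<Rightarrow> nat set set" where
  "vertices M = orb (vert_rot M) ` darts M"

definition edges :: "'a cmap_scheme \<Rightarrow> nat set set" where
  "edges M = orb (edge_inv M) ` darts M"

definition faces :: "'a cmap_scheme \<Rightarrow> nat set set" where
  "faces M = orb (faceperm M) ` darts M"

definition nedges :: "'a cmap_scheme \<Rightarrow> nat" where
  "nedges M = card (edges M)"

definition nfaces :: "'a cmap_scheme \<Rightarrow> nat" where
  "nfaces M = card (faces M)"

text \<open>vertex (as a set of darts) at which a dart starts\<close>
definition vertex_of :: "'a cmap_scheme \<Rightarrow> nat \<Rightarrow> nat set" where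
  "vertex_of M d = orb (vert_rot M) d"

definition is_cmap :: "'a cmap_scheme \<Rightarrow> bool" where
  "is_cmap M \<longleftrightarrow> finite (darts M)
     \<and> bij_betw (edge_inv M) (darts M) (darts M)
     \<and> (\<forall>d\<in>darts M. edge_inv M d \<noteq> d \<and> edge_inv M (edge_inv M d) = d)
     \<and> bij_betw (vert_rot M) (darts M) (darts M)"

definition connected_map :: "'a cmap_scheme \<Rightarrow> bool" where
  "connected_map M \<longleftrightarrow>
     (\<forall>x\<in>darts M. \<forall>y\<in>darts M.
        (x, y) \<in> ({(d, edge_inv M d) | d. d \<in> darts M} \<union> {(d, vert_rot M d) | d. d \<in> darts M})\<^sup>*)"

text \<open>planar (genus 0) connected map, via Euler's formula V - E + F = 2\<close>
definition planar_map :: "'a cmap_scheme \<Rightarrow> bool" where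
  "planar_map M \<longleftrightarrow> is_cmap M \<and> darts M \<noteq> {} \<and> connected_map M
     \<and> int (card (vertices M)) - int (card (edges M)) + int (card (faces M)) = 2"

section \<open>Graph distance\<close>

definition vadj :: "'a cmap_scheme \<Rightarrow> (nat set \<times> nat set) set" where
  "vadj M = {(vertex_of M d, vertex_of M (edge_inv M d)) | d. d \<in> darts M}"

definition vdist :: "'a cmap_scheme \<Rightarrow> nat set \<Rightarrow> nat set \<Rightarrow> nat" where
  "vdist M u w = (LEAST n. (u, w) \<in> (vadj M) ^^ n)"

section \<open>Rooted pointed planar maps and rooted pointed quadrangulations\<close>

text \<open>origin: a vertex (set of darts); root corner: a dart (see corner convention above)\<close>
record rp_map = cmap +
  org :: "nat set"
  rootd :: nat

text \<open>origin: a vertex; root edge: an unoriented edge (set of its two darts)\<close>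
record rp_quad = cmap +
  qorg :: "nat set"
  qroot :: "nat set"

definition MSet :: "rp_map set" where
  "MSet = {M. planar_map M \<and> org M \<in> vertices M \<and> rootd M \<in> darts M}"

definition is_quadrangulation :: "'a cmap_scheme \<Rightarrow> bool" where
  "is_quadrangulation M \<longleftrightarrow> planar_map M \<and> (\<forall>d\<in>darts M. card (orb (faceperm M) d) = 4)"

definition QSet :: "rp_quad set" where
  "QSet = {Q. is_quadrangulation Q \<and> qorg Q \<in> vertices Q \<and> qroot Q \<in> edges Q}"

definition iso_map :: "rp_map \<Rightarrow> rp_map \<Rightarrow> bool" where
  "iso_map M M' \<longleftrightarrow> (\<exists>f. bij_betw f (darts M) (darts M')
     \<and> (\<forall>x\<in>darts M. f (edge_inv M x) = edge_inv M' (f x) \<and> f (vert_rot M x) = vert_rot M' (f x))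
     \<and> f ` org M = org M' \<and> f (rootd M) = rootd M')"

definition iso_quad :: "rp_quad \<Rightarrow> rp_quad \<Rightarrow> bool" where
  "iso_quad Q Q' \<longleftrightarrow> (\<exists>f. bij_betw f (darts Q) (darts Q')
     \<and> (\<forall>x\<in>darts Q. f (edge_inv Q x) = edge_inv Q' (f x) \<and> f (vert_rot Q x) = vert_rot Q' (f x))
     \<and> f ` qorg Q = qorg Q' \<and> f ` qroot Q = qroot Q')"

definition isoM_rel :: "(rp_map \<times> rp_map) set" where
  "isoM_rel = {(M, M'). M \<in> MSet \<and> M' \<in> MSet \<and> iso_map M M'}"

definition isoQ_rel :: "(rp_quad \<times> rp_quad) set" where
  "isoQ_rel = {(Q, Q'). Q \<in> QSet \<and> Q' \<in> QSet \<and> iso_quad Q Q'}"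

section \<open>Statistics\<close>

text \<open>distance of (the origin vertex of) a dart to the origin of Q\<close>
definition qd :: "rp_quad \<Rightarrow> nat \<Rightarrow> nat" where
  "qd Q x = vdist Q (qorg Q) (vertex_of Q x)"

text \<open>local maxima: vertices all of whose neighbours are strictly closer to the origin\<close>
definition nlocmax :: "rp_quad \<Rightarrow> nat" where
  "nlocmax Q = card {v \<in> vertices Q. \<forall>x\<in>darts Q. vertex_of Q x = v \<longrightarrow> qd Q (edge_inv Q x) < qd Q x}"

text \<open>the dart of the root edge starting at its endpoint closer to the origin\<close>
definition qroot_dart :: "rp_quad \<Rightarrow> nat" where
  "qroot_dart Q = (SOME r. r \<in> qroot Q \<and> qd Q r < qd Q (edge_inv Q r))"

definition qroot_dist :: "rp_quad \<Rightarrow> nat" where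
  "qroot_dist Q = qd Q (qroot_dart Q)"

definition mroot_dist :: "rp_map \<Rightarrow> nat" where
  "mroot_dist M = vdist M (org M) (vertex_of M (rootd M))"

section \<open>Schaeffer's prescription with labelling -d\<close>

definition lab :: "rp_quad \<Rightarrow> nat \<Rightarrow> int" where
  "lab Q x = - int (qd Q x)"

text \<open>For the corner of dart x (in the face cycle x, phi x, phi^2 x, phi^3 x, clockwise),
  the corner at the other end of the new edge drawn in that corner, if any.\<close>
definition partner :: "rp_quad \<Rightarrow> nat \<Rightarrow> nat option" where
  "partner Q x = (let \<phi> = faceperm Q; l = lab Q;
       x1 = \<phi> x; x2 = \<phi> (\<phi> x); x3 = \<phi> (\<phi> (\<phi> x)) in
     if l x1 = l x - 1 \<and> l x2 = l x \<and> l x3 = l x - 1 then Some x2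
       \<comment> \<open>confluent face, x one of the corners labelled t+1: diagonal\<close>
     else if l x1 = l x - 1 \<and> l x2 = l x - 2 \<and> l x3 = l x - 1 then Some x1
       \<comment> \<open>simple face, x the corner labelled t+1: edge to next clockwise corner\<close>
     else if l x3 = l x + 1 \<and> l x1 = l x - 1 \<and> l x2 = l x then Some x3
       \<comment> \<open>simple face, x the corner following the corner labelled t+1\<close>
     else None)"

definition marked :: "rp_quad \<Rightarrow> nat set" where
  "marked Q = {x \<in> darts Q. partner Q x \<noteq> None}"

text \<open>first element of K strictly after x in the cyclic order given by s\<close>
definition next_in :: "(nat \<Rightarrow> nat) \<Rightarrow> nat set \<Rightarrow> nat \<Rightarrow> nat" where
  "next_in s K x = (s ^^ (LEAST k. 0 < k \<and> (s ^^ k) x \<in> K)) x"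

definition Phi :: "rp_quad \<Rightarrow> rp_map" where
  "Phi Q = \<lparr> darts = marked Q,
             edge_inv = (\<lambda>x. the (partner Q x)),
             vert_rot = next_in (vert_rot Q) (marked Q),
             org = qorg Q \<inter> marked Q,
             rootd = next_in (vert_rot Q) (marked Q) (qroot_dart Q) \<rparr>"

end

theory Submission
  imports Defs
begin

text \<open>Euler's formula makes the first cohomology over Z/2 vanish, so a planar quadrangulation is
  bipartite and distances change by exactly one along edges. Orient each edge away from the origin.
  Every face then has exactly two corners from which an outward edge leaves clockwise, and
  Schaeffer's prescription joins these two corners; so the darts of the image are the outward darts,
  its vertices are the vertices that are not local maxima, and the shortest paths to the origin
  survive. Climbing along outward darts from a corner of the image, always turning the same way,
  leads to a local maximum that only depends on the face of this corner, which matches faces with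
  local maxima and gives planarity of the image by Euler's formula. The rotation at the vertices can
  be recovered from the image level by level, whence injectivity. Conversely, a pointed map is
  recovered by joining each corner to the next corner of its face contour that is farther from
  the origin, or to a new vertex in the face when there is none.\<close>

section \<open>Orbits and return maps\<close>

text \<open>Shortest paths are handled through certificates: \<open>geodesic\<close> asks only for
  local properties of a labelling, and a labelling with these properties is the distance. So
  distances in the image, in the rebuilt quadrangulation and under an isomorphism are found by
  exhibiting a labelling, and connectedness comes along with it. Planarity is only ever transferred.
  Forming the image removes the local maxima from V, turns 2F edges into F and F faces into as many
  as there are local maxima; V - E + F stays the same in any genus. That is why the middle part
  starts from unit steps of the distance, and why it serves both directions. The delicate point of
  injectivity: after the inward dart \<open>\<alpha> x\<close> comes the next side
  \<open>\<phi> x\<close> of the face of \<open>x\<close>. The image names this dart directly or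
  through the dart preceding \<open>mate x\<close>, except when the new edge descends from
  \<open>x\<close>; then one more turn has to be undone, at a vertex one level lower. Outward darts
  follow by elimination, since the rotation is a bijection.\<close>

lemma funpow_mem: "(\<And>x. x \<in> D \<Longrightarrow> f x \<in> D) \<Longrightarrow> x \<in> D \<Longrightarrow> (f ^^ n) x \<in> D"
  by (induction n) auto

lemma orb_self: "x \<in> orb f x"
  unfolding orb_def by (auto intro: exI[of _ 0])

lemma orb_funpow: "(f ^^ n) x \<in> orb f x"
  unfolding orb_def by auto

lemma orb_apply: "f x \<in> orb f x"
  using orb_funpow[where n = 1 and f = f and x = x] by simp

lemma orb_trans: "y \<in> orb f x \<Longrightarrow> z \<in> orb f y \<Longrightarrow> z \<in> orb f x"
  unfolding orb_def by clarsimp (metis comp_apply funpow_add)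

lemma orb_step: "y \<in> orb f x \<Longrightarrow> f y \<in> orb f x"
  using orb_trans orb_apply by fast

lemma orb_induct [consumes 1, case_names self step]:
  assumes "y \<in> orb f x" "P x" "\<And>y. y \<in> orb f x \<Longrightarrow> P y \<Longrightarrow> P (f y)"
  shows "P y"
proof -
  have "P ((f ^^ n) x)" for n
    by (induction n) (auto intro: assms orb_funpow)
  then show ?thesis using assms(1) unfolding orb_def by auto
qed

text \<open>The components of a map are total functions with arbitrary values off the darts, so
  permutations can only be compared on an invariant domain.\<close>

lemma orb_cong:
  assumes "\<And>y. y \<in> D \<Longrightarrow> f y = g y" "\<And>y. y \<in> D \<Longrightarrow> f y \<in> D" "x \<in> D"
  shows "orb f x = orb g x"
proof -
  have "(f ^^ n) x = (g ^^ n) x \<and> (f ^^ n) x \<in> D" for n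
  proof (induction n)
    case (Suc n)
    then show ?case using assms(1)[of "(f ^^ n) x"] assms(2)[of "(f ^^ n) x"] by auto
  qed (use assms(3) in simp)
  then show ?thesis unfolding orb_def by auto
qed

lemma orb_hom:
  assumes "\<And>y. y \<in> D \<Longrightarrow> h (f y) = g (h y)" "\<And>y. y \<in> D \<Longrightarrow> f y \<in> D" "x \<in> D"
  shows "orb g (h x) = h ` orb f x"
proof -
  have "(g ^^ n) (h x) = h ((f ^^ n) x) \<and> (f ^^ n) x \<in> D" for n
    by (induction n) (auto simp: assms)
  then show ?thesis unfolding orb_def by auto
qed

lemma bij_betw_funpow_inj:
  "bij_betw f D D \<Longrightarrow> x \<in> D \<Longrightarrow> y \<in> D \<Longrightarrow> (f ^^ n) x = (f ^^ n) y \<Longrightarrow> x = y"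
proof (induction n)
  case (Suc n)
  have "(f ^^ n) x \<in> D" "(f ^^ n) y \<in> D"
    using Suc.prems by (auto intro!: funpow_mem dest: bij_betwE)
  then show ?case using Suc by (auto dest!: bij_betw_imp_inj_on dest: inj_onD)
qed simp

lemma bij_betw_funpow_period:
  assumes "bij_betw f D D" "finite D" "x \<in> D"
  obtains n where "n > 0" "(f ^^ n) x = x"
proof -
  have mem: "(f ^^ n) x \<in> D" for n
    using assms by (auto intro!: funpow_mem dest: bij_betwE)
  then have "range (\<lambda>n. (f ^^ n) x) \<subseteq> D" by auto
  then have "\<not> inj (\<lambda>n. (f ^^ n) x)"
    using assms(2) finite_subset finite_imageD infinite_UNIV_nat by blast
  then obtain i j where ij: "i < j" "(f ^^ i) x = (f ^^ j) x"
    unfolding inj_def by (metis nat_neq_iff)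
  then have "(f ^^ i) ((f ^^ (j - i)) x) = (f ^^ i) x"
    by (metis add_diff_cancel_left' comp_apply funpow_add less_imp_add_positive)
  then have "(f ^^ (j - i)) x = x"
    using bij_betw_funpow_inj[OF assms(1)] mem assms(3) by blast
  then show ?thesis using that[of "j - i"] ij by auto
qed

section \<open>Permutations of a finite set\<close>

locale finite_perm =
  fixes D :: "nat set" and f :: "nat \<Rightarrow> nat"
  assumes fin: "finite D" and bij: "bij_betw f D D"
begin

lemma mem: "x \<in> D \<Longrightarrow> f x \<in> D"
  using bij by (auto dest: bij_betwE)

lemma inj: "x \<in> D \<Longrightarrow> y \<in> D \<Longrightarrow> f x = f y \<longleftrightarrow> x = y"
  using bij by (auto dest!: bij_betw_imp_inj_on dest: inj_onD)

lemma surj: "y \<in> D \<Longrightarrow> \<exists>x\<in>D. f x = y"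
  using bij unfolding bij_betw_def by (metis imageE)

lemma pow_mem: "x \<in> D \<Longrightarrow> (f ^^ n) x \<in> D"
  by (rule funpow_mem[OF mem])

lemma orb_sub: "x \<in> D \<Longrightarrow> orb f x \<subseteq> D"
  using pow_mem unfolding orb_def by auto

text \<open>\<open>orb\<close> collects forward iterates only; symmetry comes from finiteness. If
  \<open>x\<close> has period k > 0, then k n - n further steps bring the n-th iterate back to
  \<open>x\<close>.\<close>

lemma orb_sym: assumes "x \<in> D" "y \<in> orb f x" shows "x \<in> orb f y"
proof -
  obtain k where k: "k > 0" "(f ^^ k) x = x"
    using bij_betw_funpow_period[OF bij fin assms(1)] by blast
  obtain n where n: "y = (f ^^ n) x" using assms(2) unfolding orb_def by auto
  have "((f ^^ k) ^^ n) x = x" by (induction n) (auto simp: k)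
  then have "(f ^^ (k * n)) x = x" by (simp add: funpow_mult)
  moreover have "k * n = (k * n - n) + n" using k by (cases k) auto
  ultimately have "(f ^^ (k * n - n)) y = x" unfolding n by (metis comp_apply funpow_add)
  then show ?thesis unfolding orb_def by auto
qed

lemma orb_eq: assumes "x \<in> D" "y \<in> orb f x" shows "orb f y = orb f x"
proof (intro equalityI subsetI)
  show "z \<in> orb f x" if "z \<in> orb f y" for z using orb_trans[OF assms(2) that] .
  show "z \<in> orb f y" if "z \<in> orb f x" for z using orb_trans[OF orb_sym[OF assms] that] .
qed

lemma orb_eq_iff: "x \<in> D \<Longrightarrow> y \<in> D \<Longrightarrow> orb f x = orb f y \<longleftrightarrow> y \<in> orb f x"
  using orb_eq[of x y] orb_self[of y f] by auto

lemma orb_apply_eq: "x \<in> D \<Longrightarrow> orb f (f x) = orb f x"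
  by (rule orb_eq) (auto intro: orb_apply)

lemma orb_inv:
  assumes "x \<in> D" "\<And>y. y \<in> D \<Longrightarrow> h (f y) = h y" "y \<in> orb f x"
  shows "h y = h x"
  using assms(3)
proof (induction rule: orb_induct)
  case (step y)
  then have "y \<in> D" using assms(1) orb_sub by auto
  then show ?case using step assms(2) by simp
qed simp

lemma orbs_disjoint: "A \<in> orb f ` D \<Longrightarrow> B \<in> orb f ` D \<Longrightarrow> A \<noteq> B \<Longrightarrow> A \<inter> B = {}"
  using orb_eq by (metis disjoint_iff imageE)

lemma Union_orbs: "\<Union> (orb f ` D) = D"
  using orb_sub orb_self by fastforce

lemma card_orbs_const:
  assumes "\<And>x. x \<in> D \<Longrightarrow> card (orb f x) = k"
  shows "k * card (orb f ` D) = card D"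
proof -
  have "k * card (orb f ` D) = card (\<Union> (orb f ` D))"
    by (rule card_partition) (use fin assms orbs_disjoint Union_orbs in auto)
  then show ?thesis by (simp add: Union_orbs)
qed

end

text \<open>Each factor maps the orbits of one product onto those of the other, which gives both
  inequalities. It is needed to replace the face permutation of the image by its conjugate
  \<open>contour\<close>.\<close>

lemma card_orbs_comp:
  assumes g: "bij_betw g P P" and f: "bij_betw f P P" and "finite P"
  shows "card (orb (f \<circ> g) ` P) = card (orb (g \<circ> f) ` P)"
proof -
  have *: "card (orb (b \<circ> a) ` P) \<le> card (orb (a \<circ> b) ` P)"
    if "bij_betw a P P" "bij_betw b P P" for a b :: "'a \<Rightarrow> 'a"
  proof -
    have mem: "a x \<in> P" "b x \<in> P" if "x \<in> P" for x
      using \<open>bij_betw a P P\<close> \<open>bij_betw b P P\<close> that by (auto dest: bij_betwE)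
    have "orb (b \<circ> a) (b x) = b ` orb (a \<circ> b) x" if "x \<in> P" for x
      by (rule orb_hom[of P]) (use that mem in auto)
    moreover have "b ` P = P" using that(2) by (simp add: bij_betw_def)
    moreover from calculation(1) have "orb (b \<circ> a) ` b ` P = (`) b ` orb (a \<circ> b) ` P"
      unfolding image_image by (intro image_cong) auto
    ultimately show ?thesis using assms(3) by (simp add: card_image_le)
  qed
  show ?thesis using *[OF f g] *[OF g f] by simp
qed

lemma card_orbs_iso:
  assumes "bij_betw h D D'" "\<And>x. x \<in> D \<Longrightarrow> f x \<in> D" "\<And>x. x \<in> D \<Longrightarrow> h (f x) = g (h x)"
  shows "card (orb g ` D') = card (orb f ` D)"
proof -
  have sub: "orb f x \<subseteq> D" if "x \<in> D" for x
    using that funpow_mem[of D f] assms(2) unfolding orb_def by auto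
  have "orb g (h x) = h ` orb f x" if "x \<in> D" for x
    by (rule orb_hom[of D]) (use that assms in auto)
  then have "orb g ` h ` D = (`) h ` orb f ` D"
    unfolding image_image by (intro image_cong) auto
  moreover have "h ` D = D'" using assms(1) by (simp add: bij_betw_def)
  moreover have "inj_on ((`) h) (orb f ` D)"
  proof (rule inj_onI)
    fix A B assume "A \<in> orb f ` D" "B \<in> orb f ` D" "h ` A = h ` B"
    moreover from this have "A \<subseteq> D" "B \<subseteq> D" using sub by auto
    ultimately show "A = B" using inj_on_image_eq_iff[of h D] assms(1) by (auto simp: bij_betw_def)
  qed
  ultimately show ?thesis by (simp add: card_image)
qed

section \<open>First returns to a subset\<close>

lemma next_in_props:
  assumes "0 < n" "(s ^^ n) x \<in> K"
  obtains k where "0 < k" "k \<le> n" "next_in s K x = (s ^^ k) x" "(s ^^ k) x \<in> K"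
    "\<forall>i. 0 < i \<and> i < k \<longrightarrow> (s ^^ i) x \<notin> K"
proof -
  let ?P = "\<lambda>k. 0 < k \<and> (s ^^ k) x \<in> K"
  have 1: "?P (LEAST k. ?P k)" by (rule LeastI[of ?P n]) (use assms in auto)
  have 2: "(LEAST k. ?P k) \<le> n" by (rule Least_le) (use assms in auto)
  show ?thesis
    by (rule that[of "LEAST k. ?P k"]) (use 1 2 not_less_Least in \<open>auto simp: next_in_def\<close>)
qed

lemma next_in_eqI:
  assumes "0 < k" "(s ^^ k) x \<in> K" "\<And>i. 0 < i \<Longrightarrow> i < k \<Longrightarrow> (s ^^ i) x \<notin> K"
  shows "next_in s K x = (s ^^ k) x"
proof -
  have "(LEAST k. 0 < k \<and> (s ^^ k) x \<in> K) = k"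
    by (rule Least_equality) (use assms in \<open>auto simp: not_less[symmetric]\<close>)
  then show ?thesis by (simp add: next_in_def)
qed

lemma next_in_hit: "s x \<in> K \<Longrightarrow> next_in s K x = s x"
  using next_in_eqI[of 1 s x K] by auto

lemma next_in_hom:
  assumes "\<And>y. y \<in> D \<Longrightarrow> h (s y) = s' (h y)" "\<And>y. y \<in> D \<Longrightarrow> s y \<in> D" "x \<in> D"
    "\<And>y. y \<in> D \<Longrightarrow> h y \<in> K' \<longleftrightarrow> y \<in> K"
  shows "next_in s' K' (h x) = h (next_in s K x)"
proof -
  have "(s' ^^ n) (h x) = h ((s ^^ n) x) \<and> (s ^^ n) x \<in> D" for n
    by (induction n) (auto simp: assms)
  then show ?thesis using assms(4) by (simp add: next_in_def)
qed

context finite_perm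
begin

lemma next_in_props':
  assumes "x \<in> D" "y \<in> orb f x" "y \<in> K"
  obtains k where "0 < k" "next_in f K x = (f ^^ k) x" "(f ^^ k) x \<in> K"
    "\<forall>i. 0 < i \<and> i < k \<longrightarrow> (f ^^ i) x \<notin> K"
proof -
  have "y \<in> orb f (f x)" using assms orb_apply_eq by auto
  then obtain m where "y = (f ^^ m) (f x)" unfolding orb_def by auto
  then have "y = (f ^^ Suc m) x" by (simp add: funpow_swap1)
  then show ?thesis using next_in_props[of "Suc m" f x K] assms that by auto
qed

lemma next_in_mem:
  assumes "x \<in> D" "y \<in> orb f x" "y \<in> K"
  shows "next_in f K x \<in> K" "next_in f K x \<in> orb f x"
proof -
  obtain k where "next_in f K x = (f ^^ k) x" "(f ^^ k) x \<in> K"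
    using next_in_props'[OF assms] by blast
  then show "next_in f K x \<in> K" "next_in f K x \<in> orb f x" by (simp_all add: orb_funpow)
qed

lemma next_in_miss:
  assumes "x \<in> D" "y \<in> orb f x" "y \<in> K" "f x \<notin> K"
  shows "next_in f K x = next_in f K (f x)"
proof -
  obtain k where k: "0 < k" "next_in f K x = (f ^^ k) x" "(f ^^ k) x \<in> K"
    "\<forall>i. 0 < i \<and> i < k \<longrightarrow> (f ^^ i) x \<notin> K"
    using next_in_props'[OF assms(1-3)] by blast
  have "k \<noteq> 1" using assms k by auto
  then obtain j where j: "k = Suc j" "0 < j" using k(1) by (cases k) auto
  have *: "(f ^^ i) (f x) = (f ^^ Suc i) x" for i by (simp add: funpow_swap1)
  have "next_in f K (f x) = (f ^^ j) (f x)"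
    by (rule next_in_eqI) (use j k(3) k(4)[rule_format, of "Suc _"] in \<open>auto simp only: *\<close>)
  then show ?thesis using k j * by simp
qed

text \<open>Induction on the number of steps to the next element of \<open>K\<close>; it serves for
  arguments that turn around a vertex up to the next outward dart.\<close>

lemma next_in_induct [consumes 3, case_names hit miss]:
  assumes "x \<in> D" "y \<in> orb f x" "y \<in> K"
    and hit: "\<And>x. x \<in> D \<Longrightarrow> f x \<in> K \<Longrightarrow> next_in f K x = f x \<Longrightarrow> Q x"
    and miss: "\<And>x. x \<in> D \<Longrightarrow> f x \<notin> K \<Longrightarrow> next_in f K x = next_in f K (f x) \<Longrightarrow> Q (f x) \<Longrightarrow> Q x"
  shows "Q x"
proof -
  have "\<forall>x\<in>D. (f ^^ Suc n) x \<in> K \<longrightarrow> Q x" for n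
  proof (induction n)
    case 0
    then show ?case using hit next_in_hit by fastforce
  next
    case (Suc n)
    show ?case
    proof (intro ballI impI)
      fix x assume x: "x \<in> D" "(f ^^ Suc (Suc n)) x \<in> K"
      show "Q x"
      proof (cases "f x \<in> K")
        case True then show ?thesis using hit next_in_hit x by metis
      next
        case False
        have "(f ^^ Suc n) (f x) \<in> K" using x by (simp add: funpow_swap1)
        then have "Q (f x)" using Suc x mem by blast
        then show ?thesis using miss[OF x(1) False] next_in_miss[OF x(1) _ x(2) False] orb_funpow by metis
      qed
    qed
  qed
  moreover obtain k where "k > 0" "(f ^^ k) x \<in> K"
    using next_in_props'[OF assms(1-3)] by blast
  ultimately show ?thesis using assms(1) by (metis Suc_pred)
qed

text \<open>Suppose \<open>x\<close> returns in k steps and \<open>y\<close> in l \<ge> k steps to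
  the same point. Cancelling k steps shows that \<open>y\<close> meets \<open>x\<close> after l - k
  steps, which is before its first return unless k = l, and then \<open>x = y\<close>.\<close>

lemma next_in_inj:
  assumes "K \<subseteq> D" "x \<in> K" "y \<in> K" "next_in f K x = next_in f K y"
  shows "x = y"
proof -
  have *: "x = y" if xy: "x \<in> K" "y \<in> K" and "k \<le> l" "0 < k" "(f ^^ k) x = (f ^^ l) y"
    "\<And>i. 0 < i \<Longrightarrow> i < l \<Longrightarrow> (f ^^ i) y \<notin> K" for x y k l
  proof -
    have "(f ^^ k) ((f ^^ (l - k)) y) = (f ^^ k) x"
      using that by (metis comp_apply funpow_add le_add_diff_inverse)
    then have "(f ^^ (l - k)) y = x"
      using bij_betw_funpow_inj[OF bij] pow_mem xy assms(1) by blast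
    then show ?thesis using that(6)[of "l - k"] that by (cases "l = k") auto
  qed
  obtain k where "0 < k" "next_in f K x = (f ^^ k) x"
    "\<forall>i. 0 < i \<and> i < k \<longrightarrow> (f ^^ i) x \<notin> K"
    using next_in_props'[of x x K] assms orb_self by (metis subsetD)
  moreover obtain l where "0 < l" "next_in f K y = (f ^^ l) y"
    "\<forall>i. 0 < i \<and> i < l \<longrightarrow> (f ^^ i) y \<notin> K"
    using next_in_props'[of y y K] assms orb_self by (metis subsetD)
  ultimately show ?thesis
    using *[of x y k l] *[of y x l k] assms by (metis nat_le_linear)
qed

lemma next_in_bij: assumes "K \<subseteq> D" shows "bij_betw (next_in f K) K K"
proof -
  have "inj_on (next_in f K) K" using next_in_inj[OF assms] by (auto simp: inj_on_def)
  moreover have "next_in f K x \<in> K" if "x \<in> K" for x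
    using next_in_mem(1)[of x x K] orb_self[of x f] assms that by auto
  then have "next_in f K ` K \<subseteq> K" by auto
  ultimately show ?thesis
    using endo_inj_surj[of K "next_in f K"] finite_subset[OF assms fin] by (auto simp: bij_betw_def)
qed

text \<open>Deleting darts from a rotation does not split a vertex: going from one point of
  \<open>K\<close> to another, each return uses up at least one step, so the remaining number of
  steps decreases.\<close>

lemma orb_next_in:
  assumes "K \<subseteq> D" "x \<in> K"
  shows "orb (next_in f K) x = orb f x \<inter> K"
proof
  show "orb (next_in f K) x \<subseteq> orb f x \<inter> K"
  proof
    fix y assume "y \<in> orb (next_in f K) x"
    then show "y \<in> orb f x \<inter> K"
    proof (induction rule: orb_induct)
      case (step y)
      then show ?case
        using next_in_mem[of y y K] orb_self assms orb_trans by (metis IntD1 IntD2 IntI subsetD)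
    qed (use assms orb_self in auto)
  qed
next
  have "\<forall>x\<in>K. (f ^^ n) x \<in> K \<longrightarrow> (f ^^ n) x \<in> orb (next_in f K) x" for n
  proof (induction n rule: less_induct)
    case (less n)
    show ?case
    proof (intro ballI impI)
      fix x assume x: "x \<in> K" "(f ^^ n) x \<in> K"
      show "(f ^^ n) x \<in> orb (next_in f K) x"
      proof (cases "n = 0")
        case True then show ?thesis by (simp add: orb_self)
      next
        case False
        then obtain k where k: "0 < k" "k \<le> n" "next_in f K x = (f ^^ k) x" "(f ^^ k) x \<in> K"
          using next_in_props[of n f x K] x by auto
        have e: "(f ^^ n) x = (f ^^ (n - k)) ((f ^^ k) x)"
          using k by (metis comp_apply funpow_add le_add_diff_inverse2)
        have "(f ^^ n) x \<in> orb (next_in f K) ((f ^^ k) x)"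
          using less.IH[of "n - k"] k x e by auto
        then show ?thesis using k orb_apply orb_trans by metis
      qed
    qed
  qed
  then show "orb f x \<inter> K \<subseteq> orb (next_in f K) x"
    using assms unfolding orb_def[of f x] by auto
qed

end

section \<open>Distances in combinatorial maps\<close>

lemma orb_involution:
  assumes "g (g x) = x" shows "orb g x = {x, g x}"
proof
  show "orb g x \<subseteq> {x, g x}"
  proof
    fix y assume "y \<in> orb g x"
    then show "y \<in> {x, g x}" by (induction rule: orb_induct) (use assms in auto)
  qed
qed (auto intro: orb_self orb_apply)

section \<open>Basic facts on rotation systems\<close>

locale combinatorial_map =
  fixes M :: "'a cmap_scheme"
  assumes cmap: "is_cmap M"
begin

abbreviation "D \<equiv> darts M"
abbreviation "\<alpha> \<equiv> edge_inv M"
abbreviation "\<sigma> \<equiv> vert_rot M"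
abbreviation "\<phi> \<equiv> faceperm M"

sublocale s: finite_perm D \<sigma>
  using cmap by unfold_locales (auto simp: is_cmap_def)

lemma a_bij: "bij_betw \<alpha> D D"
  using cmap by (auto simp: is_cmap_def)

lemma a_mem [simp]: "x \<in> D \<Longrightarrow> \<alpha> x \<in> D"
  using a_bij by (auto dest: bij_betwE)

lemma a_a [simp]: "x \<in> D \<Longrightarrow> \<alpha> (\<alpha> x) = x"
  using cmap by (auto simp: is_cmap_def)

lemma a_neq [simp]: "x \<in> D \<Longrightarrow> \<alpha> x \<noteq> x"
  using cmap by (auto simp: is_cmap_def)

lemma s_mem [simp]: "x \<in> D \<Longrightarrow> \<sigma> x \<in> D"
  by (rule s.mem)

sublocale a: finite_perm D \<alpha>
  using a_bij s.fin by unfold_locales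

sublocale f: finite_perm D \<phi>
  using s.fin bij_betw_trans[OF a_bij s.bij] by unfold_locales (auto simp: faceperm_def)

lemma f_def: "\<phi> x = \<sigma> (\<alpha> x)"
  by (simp add: faceperm_def)

lemma f_mem [simp]: "x \<in> D \<Longrightarrow> \<phi> x \<in> D"
  by (simp add: f_def)

lemma orb_a: "x \<in> D \<Longrightarrow> orb \<alpha> x = {x, \<alpha> x}"
  by (rule orb_involution) simp

lemma card_edges: "2 * card (edges M) = card D"
  unfolding edges_def by (rule a.card_orbs_const) (simp add: orb_a card_insert_if a_neq[symmetric])

lemma vof_apply [simp]: "x \<in> D \<Longrightarrow> vertex_of M (\<sigma> x) = vertex_of M x"
  by (simp add: vertex_of_def s.orb_apply_eq)

lemma vof_sub: "x \<in> D \<Longrightarrow> vertex_of M x \<subseteq> D"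
  by (simp add: vertex_of_def s.orb_sub)

lemma vof_self [simp]: "x \<in> vertex_of M x"
  by (simp add: vertex_of_def orb_self)

lemma vof_eq: "x \<in> D \<Longrightarrow> y \<in> vertex_of M x \<Longrightarrow> vertex_of M y = vertex_of M x"
  by (simp add: vertex_of_def s.orb_eq)

lemma vertices_alt: "vertices M = vertex_of M ` D"
  by (simp add: vertices_def vertex_of_def)

definition adj :: "(nat \<times> nat) set" where
  "adj = {(d, \<alpha> d) | d. d \<in> D} \<union> {(d, \<sigma> d) | d. d \<in> D}"

lemma connected_iff: "connected_map M \<longleftrightarrow> (\<forall>x\<in>D. \<forall>y\<in>D. (x, y) \<in> adj\<^sup>*)"
  by (simp add: connected_map_def adj_def)

lemma adj_orb: "y \<in> orb \<sigma> x \<Longrightarrow> x \<in> D \<Longrightarrow> (x, y) \<in> adj\<^sup>*"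
proof (induction rule: orb_induct)
  case (step y)
  then have "y \<in> D" using s.orb_sub by auto
  then have "(y, \<sigma> y) \<in> adj" by (auto simp: adj_def)
  then show ?case using step by auto
qed simp

lemma adj_sym: "(x, y) \<in> adj \<Longrightarrow> (y, x) \<in> adj\<^sup>*"
proof -
  assume "(x, y) \<in> adj"
  then consider "x \<in> D" "y = \<alpha> x" | "x \<in> D" "y = \<sigma> x" by (auto simp: adj_def)
  then show ?thesis
  proof cases
    case 1
    then have "(y, \<alpha> y) \<in> adj" using a_mem unfolding adj_def by blast
    then show ?thesis using 1 by auto
  next
    case 2
    then show ?thesis using adj_orb[of x y] s.orb_sym orb_apply by (metis s_mem)
  qed
qed

lemma adj_rtrancl_sym: "(x, y) \<in> adj\<^sup>* \<Longrightarrow> (y, x) \<in> adj\<^sup>*"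
  by (induction rule: rtrancl_induct) (auto intro: adj_sym rtrancl_trans)

lemma connected_inv:
  assumes "connected_map M" "\<And>x. x \<in> D \<Longrightarrow> h (\<alpha> x) = h x" "\<And>x. x \<in> D \<Longrightarrow> h (\<sigma> x) = h x"
    "x \<in> D" "y \<in> D"
  shows "h y = h x"
proof -
  have "(x, y) \<in> adj\<^sup>*" using assms connected_iff by blast
  then show ?thesis by (induction rule: rtrancl_induct) (auto simp: adj_def assms)
qed

end

text \<open>A labelling of the darts with these properties is the distance of their vertex to u:
  the second and third conditions make it a lower bound, the last one an upper bound.\<close>
definition geodesic :: "'a cmap_scheme \<Rightarrow> nat set \<Rightarrow> (nat \<Rightarrow> nat) \<Rightarrow> bool" where
  "geodesic M u d \<longleftrightarrow>
     (\<forall>x\<in>darts M. d (vert_rot M x) = d x) \<and>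
     (\<forall>x\<in>darts M. d (edge_inv M x) \<le> Suc (d x)) \<and>
     (\<forall>x\<in>darts M. d x = 0 \<longleftrightarrow> vertex_of M x = u) \<and>
     (\<forall>x\<in>darts M. 0 < d x \<longrightarrow> (\<exists>y\<in>vertex_of M x. Suc (d (edge_inv M y)) = d x))"

context combinatorial_map
begin

text \<open>Translates the last step of a path, given between vertices, into a dart at the final
  vertex, which is the form used by \<open>geodesic\<close>.\<close>

lemma vadj_vof_iff: "x \<in> D \<Longrightarrow> (w, vertex_of M x) \<in> vadj M \<longleftrightarrow>
   (\<exists>y\<in>vertex_of M x. w = vertex_of M (\<alpha> y))"
proof
  assume x: "x \<in> D" and "(w, vertex_of M x) \<in> vadj M"
  then obtain d where d: "d \<in> D" "w = vertex_of M d" "vertex_of M x = vertex_of M (\<alpha> d)"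
    by (auto simp: vadj_def)
  then have "\<alpha> d \<in> vertex_of M x" by simp
  then show "\<exists>y\<in>vertex_of M x. w = vertex_of M (\<alpha> y)"
    using d(1,2) by (intro bexI[of _ "\<alpha> d"]) auto
next
  assume x: "x \<in> D" and "\<exists>y\<in>vertex_of M x. w = vertex_of M (\<alpha> y)"
  then obtain y where y: "y \<in> vertex_of M x" "w = vertex_of M (\<alpha> y)" by auto
  then have "y \<in> D" "vertex_of M y = vertex_of M x" using vof_sub[OF x] vof_eq[OF x y(1)] y(1) by auto
  then have "w = vertex_of M (\<alpha> y)" "vertex_of M x = vertex_of M (\<alpha> (\<alpha> y))" "\<alpha> y \<in> D"
    using y by auto
  then show "(w, vertex_of M x) \<in> vadj M" unfolding vadj_def by blast
qed

lemma vdist_le: "(u, w) \<in> vadj M ^^ n \<Longrightarrow> vdist M u w \<le> n"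
  unfolding vdist_def by (rule Least_le)

lemma vdist_rel: "(u, w) \<in> vadj M ^^ n \<Longrightarrow> (u, w) \<in> vadj M ^^ vdist M u w"
  unfolding vdist_def by (rule LeastI)

lemma reach:
  assumes "connected_map M" "x \<in> D" "y \<in> D"
  shows "\<exists>n. (vertex_of M x, vertex_of M y) \<in> vadj M ^^ n"
proof -
  have "(x, y) \<in> adj\<^sup>*" using assms connected_iff by blast
  then show ?thesis
  proof (induction rule: rtrancl_induct)
    case base
    show ?case by (rule exI[of _ 0]) simp
  next
    case (step y z)
    then obtain n where n: "(vertex_of M x, vertex_of M y) \<in> vadj M ^^ n" by auto
    from step(2) consider "y \<in> D" "z = \<alpha> y" | "y \<in> D" "z = \<sigma> y" by (auto simp: adj_def)
    then show ?case
    proof cases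
      case 1
      then have "(vertex_of M y, vertex_of M z) \<in> vadj M" by (auto simp: vadj_def)
      then have "(vertex_of M x, vertex_of M z) \<in> vadj M ^^ Suc n" using n by auto
      then show ?thesis by blast
    qed (use n in auto)
  qed
qed

lemma geodesic_vdist:
  assumes conn: "connected_map M" and u: "u \<in> vertices M"
  shows "geodesic M u (\<lambda>x. vdist M u (vertex_of M x))"
proof -
  obtain o' where o: "o' \<in> D" "u = vertex_of M o'" using u by (auto simp: vertices_alt)
  have ex: "(u, vertex_of M x) \<in> vadj M ^^ vdist M u (vertex_of M x)" if "x \<in> D" for x
    using reach[OF conn o(1) that] vdist_rel o(2) by auto
  have 1: "vdist M u (vertex_of M (\<alpha> x)) \<le> Suc (vdist M u (vertex_of M x))" if "x \<in> D" for x
  proof (rule vdist_le)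
    have "(vertex_of M x, vertex_of M (\<alpha> x)) \<in> vadj M" using that by (auto simp: vadj_def)
    then show "(u, vertex_of M (\<alpha> x)) \<in> vadj M ^^ Suc (vdist M u (vertex_of M x))"
      using ex[OF that] by auto
  qed
  have 2: "vdist M u (vertex_of M x) = 0 \<longleftrightarrow> vertex_of M x = u" if "x \<in> D" for x
  proof
    assume "vdist M u (vertex_of M x) = 0"
    then show "vertex_of M x = u" using ex[OF that] by auto
  next
    assume *: "vertex_of M x = u"
    have "(u, u) \<in> vadj M ^^ 0" by simp
    then show "vdist M u (vertex_of M x) = 0" using vdist_le * by fastforce
  qed
  have 3: "\<exists>y\<in>vertex_of M x. Suc (vdist M u (vertex_of M (\<alpha> y))) = vdist M u (vertex_of M x)"
    if x: "x \<in> D" "0 < vdist M u (vertex_of M x)" for x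
  proof -
    obtain n where n: "vdist M u (vertex_of M x) = Suc n" using x by (cases "vdist M u (vertex_of M x)") auto
    then obtain w where w: "(u, w) \<in> vadj M ^^ n" "(w, vertex_of M x) \<in> vadj M"
      using ex[OF x(1)] by auto
    then obtain y where y: "y \<in> vertex_of M x" "w = vertex_of M (\<alpha> y)"
      using vadj_vof_iff x by auto
    have yD: "y \<in> D" using y vof_sub x by auto
    have "vdist M u (vertex_of M (\<alpha> y)) \<le> n" using w y vdist_le by auto
    moreover have "vdist M u (vertex_of M y) \<le> Suc (vdist M u (vertex_of M (\<alpha> y)))"
      using 1[of "\<alpha> y"] yD by simp
    ultimately show ?thesis using y n vof_eq[OF x(1) y(1)] by (intro bexI[of _ y]) auto
  qed
  show ?thesis unfolding geodesic_def using 1 2 3 by simp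
qed

lemma geodesic_vof:
  assumes "geodesic M u d" "x \<in> D" "y \<in> vertex_of M x"
  shows "d y = d x"
  using s.orb_inv[of x d y] assms by (auto simp: geodesic_def vertex_of_def)

lemma geodesic_unique:
  assumes g: "geodesic M u d" and x: "x \<in> D"
  shows "vdist M u (vertex_of M x) = d x"
proof -
  have "(u, vertex_of M x) \<in> vadj M ^^ d x" using x
  proof (induction "d x" arbitrary: x)
    case 0
    then have "vertex_of M x = u" using g by (auto simp: geodesic_def)
    moreover have "d x = 0" using 0 by simp
    ultimately show ?case by simp
  next
    case (Suc n)
    then obtain y where y: "y \<in> vertex_of M x" "Suc (d (\<alpha> y)) = d x"
      using g unfolding geodesic_def by (metis zero_less_Suc)
    have yD: "y \<in> D" using y vof_sub Suc by auto
    have "n = d (\<alpha> y)" using Suc(2) y(2) by simp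
    then have "(u, vertex_of M (\<alpha> y)) \<in> vadj M ^^ n" using Suc(1)[of "\<alpha> y"] yD by simp
    moreover have "(vertex_of M (\<alpha> y), vertex_of M x) \<in> vadj M" using vadj_vof_iff Suc y by auto
    ultimately show ?case using Suc(2)[symmetric] by auto
  qed
  moreover have "d x \<le> n" if "(u, vertex_of M x) \<in> vadj M ^^ n" for n using that x
  proof (induction n arbitrary: x)
    case 0
    then show ?case using g by (auto simp: geodesic_def)
  next
    case (Suc n)
    then obtain w where w: "(u, w) \<in> vadj M ^^ n" "(w, vertex_of M x) \<in> vadj M" by auto
    then obtain y where y: "y \<in> vertex_of M x" "w = vertex_of M (\<alpha> y)"
      using vadj_vof_iff Suc by auto
    have yD: "y \<in> D" using y vof_sub Suc by auto
    have "d (\<alpha> y) \<le> n" using Suc w y yD by auto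
    moreover have "d y = d x" using geodesic_vof[OF g Suc(3) y(1)] .
    moreover have "d (\<alpha> (\<alpha> y)) \<le> Suc (d (\<alpha> y))" using g yD a_mem unfolding geodesic_def by blast
    ultimately show ?case using yD by simp
  qed
  ultimately show ?thesis using vdist_le vdist_rel by (meson le_antisym)
qed

text \<open>Descending darts lead from every dart to label 0, and the darts with label 0 all belong
  to the one vertex \<open>u\<close>.\<close>

lemma geodesic_connected:
  assumes g: "geodesic M u d"
  shows "connected_map M"
proof (cases "\<exists>x\<in>D. d x = 0")
  case True
  then obtain o' where o: "o' \<in> D" "d o' = 0" by auto
  have "(x, o') \<in> adj\<^sup>*" if "x \<in> D" for x using that
  proof (induction "d x" arbitrary: x)
    case 0
    then have "vertex_of M x = vertex_of M o'" using g o by (auto simp: geodesic_def)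
    then have "o' \<in> orb \<sigma> x" using vof_self unfolding vertex_of_def by blast
    then show ?case using adj_orb 0 by auto
  next
    case (Suc n)
    then obtain y where y: "y \<in> vertex_of M x" "Suc (d (\<alpha> y)) = d x"
      using g unfolding geodesic_def by (metis zero_less_Suc)
    have yD: "y \<in> D" using y vof_sub Suc by auto
    have "(x, y) \<in> adj\<^sup>*" using y Suc adj_orb by (auto simp: vertex_of_def)
    moreover have "(y, \<alpha> y) \<in> adj" using yD by (auto simp: adj_def)
    moreover have "(\<alpha> y, o') \<in> adj\<^sup>*" using Suc y yD by auto
    ultimately show ?case by (meson r_into_rtrancl rtrancl_trans)
  qed
  then show ?thesis unfolding connected_iff using adj_rtrancl_sym by (meson rtrancl_trans)
next
  \<comment> \<open>Without a label 0 the descent never ends, so there are no darts at all.\<close>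
  case False
  have False if "x \<in> D" for x using that
  proof (induction "d x" arbitrary: x)
    case 0
    then show ?case using False by auto
  next
    case (Suc n)
    then obtain y where y: "y \<in> vertex_of M x" "Suc (d (\<alpha> y)) = d x"
      using g unfolding geodesic_def by (metis zero_less_Suc)
    then show ?case using Suc vof_sub by (metis Suc_inject a_mem subsetD)
  qed
  then show ?thesis by (auto simp: connected_iff)
qed

end

section \<open>Planar maps with even faces are bipartite\<close>

text \<open>Cochains modulo 2: for the three permutations of a map these are the sets of vertices,
  edges and faces, encoded as unions of orbits so that symmetric difference is addition.\<close>

definition invariant_sets :: "nat set \<Rightarrow> (nat \<Rightarrow> nat) \<Rightarrow> nat set set" where
  "invariant_sets D f = {X. X \<subseteq> D \<and> (\<forall>x\<in>D. f x \<in> X \<longleftrightarrow> x \<in> X)}"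

context finite_perm
begin

lemma invariant_sets_orb: "X \<in> invariant_sets D f \<Longrightarrow> x \<in> X \<Longrightarrow> orb f x \<subseteq> X"
proof
  fix y assume X: "X \<in> invariant_sets D f" "x \<in> X" "y \<in> orb f x"
  show "y \<in> X"
    using orb_inv[of x "\<lambda>y. y \<in> X" y] X by (auto simp: invariant_sets_def)
qed

lemma orb_invariant: "x \<in> D \<Longrightarrow> orb f x \<in> invariant_sets D f"
proof -
  assume x: "x \<in> D"
  have "f y \<in> orb f x \<longleftrightarrow> y \<in> orb f x" if "y \<in> D" for y
    using orb_eq_iff[OF x that] orb_eq_iff[OF x mem[OF that]] orb_apply_eq[OF that] by simp
  then show ?thesis using orb_sub[OF x] by (auto simp: invariant_sets_def)
qed

lemma Union_invariant: "\<A> \<subseteq> invariant_sets D f \<Longrightarrow> \<Union>\<A> \<in> invariant_sets D f"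
  unfolding invariant_sets_def by blast

lemma card_invariant_sets: "card (invariant_sets D f) = 2 ^ card (orb f ` D)"
proof -
  have "bij_betw \<Union> (Pow (orb f ` D)) (invariant_sets D f)"
    unfolding bij_betw_def
  proof
    show "inj_on \<Union> (Pow (orb f ` D))"
    proof (rule inj_onI)
      fix \<A> \<B> assume *: "\<A> \<in> Pow (orb f ` D)" "\<B> \<in> Pow (orb f ` D)" "\<Union>\<A> = \<Union>\<B>"
      have "\<A> \<subseteq> \<B>" if *: "\<A> \<subseteq> orb f ` D" "\<B> \<subseteq> orb f ` D" "\<Union>\<A> = \<Union>\<B>" for \<A> \<B>
      proof
        fix A assume A: "A \<in> \<A>"
        then obtain x where x: "x \<in> D" "A = orb f x" using * by auto
        then have "x \<in> \<Union>\<B>" using A *(3) orb_self[of x f] by auto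
        then obtain B where B: "B \<in> \<B>" "x \<in> B" by auto
        then obtain y where y: "y \<in> D" "B = orb f y" using * by auto
        have "orb f x = orb f y" by (rule orb_eq) (use y B in auto)
        then show "A \<in> \<B>" using x y B by simp
      qed
      from this[of \<A> \<B>] this[of \<B> \<A>] show "\<A> = \<B>" using * by auto
    qed
    show "\<Union> ` Pow (orb f ` D) = invariant_sets D f"
    proof
      show "\<Union> ` Pow (orb f ` D) \<subseteq> invariant_sets D f"
        using Union_invariant orb_invariant by (meson PowD image_subsetI order_trans)
      show "invariant_sets D f \<subseteq> \<Union> ` Pow (orb f ` D)"
      proof
        fix X assume X: "X \<in> invariant_sets D f"
        then have "X \<subseteq> D" by (auto simp: invariant_sets_def)
        moreover have "X = \<Union> (orb f ` X)"
          using invariant_sets_orb[OF X] orb_self by fastforce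
        ultimately show "X \<in> \<Union> ` Pow (orb f ` D)" by (metis PowI image_eqI image_mono)
      qed
    qed
  qed
  then have "card (invariant_sets D f) = card (Pow (orb f ` D))" by (metis bij_betw_same_card)
  then show ?thesis using fin by (simp add: card_Pow)
qed

lemma finite_invariant_sets: "finite (invariant_sets D f)"
  using finite_subset[of "invariant_sets D f" "Pow D"] fin by (auto simp: invariant_sets_def)

end

lemma card_le_fibres:
  assumes "finite A" "finite B" "h ` A \<subseteq> B" "\<And>b. b \<in> B \<Longrightarrow> card {a \<in> A. h a = b} \<le> k"
  shows "card A \<le> k * card B"
proof -
  have "A = (\<Union>b\<in>B. {a \<in> A. h a = b})" using assms(3) by auto
  then have "card A \<le> (\<Sum>b\<in>B. card {a \<in> A. h a = b})"
    using card_UN_le[OF assms(2), of "\<lambda>b. {a \<in> A. h a = b}"] by metis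
  also have "\<dots> \<le> (\<Sum>b\<in>B. k)" by (rule sum_mono) (use assms in auto)
  finally show ?thesis by (simp add: mult.commute)
qed

abbreviation symdiff (infixl "\<triangle>" 65) where "X \<triangle> Y \<equiv> (X - Y) \<union> (Y - X)"

lemma odd_card_symdiff:
  assumes "finite O'"
  shows "odd (card ((X \<triangle> Y) \<inter> O')) \<longleftrightarrow> odd (card (X \<inter> O')) \<noteq> odd (card (Y \<inter> O'))"
proof -
  have 1: "card (X \<inter> O') = card ((X - Y) \<inter> O') + card (X \<inter> Y \<inter> O')"
    by (subst card_Un_disjoint[symmetric]) (use assms in \<open>auto intro: arg_cong[where f = card]\<close>)
  have 2: "card (Y \<inter> O') = card ((Y - X) \<inter> O') + card (X \<inter> Y \<inter> O')"
    by (subst card_Un_disjoint[symmetric]) (use assms in \<open>auto intro: arg_cong[where f = card]\<close>)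
  have 3: "card ((X \<triangle> Y) \<inter> O') = card ((X - Y) \<inter> O') + card ((Y - X) \<inter> O')"
    by (subst card_Un_disjoint[symmetric]) (use assms in \<open>auto intro: arg_cong[where f = card]\<close>)
  show ?thesis unfolding 1 2 3 by auto
qed

section \<open>First cohomology modulo 2\<close>

context combinatorial_map
begin

definition cobdry0 :: "nat set \<Rightarrow> nat set" where
  "cobdry0 X = {x \<in> D. x \<in> X \<longleftrightarrow> \<alpha> x \<notin> X}"

text \<open>Darts are counted, not edges: an edge with the same face on both sides contributes 2,
  that is 0, as the incidence number modulo 2 requires.\<close>

definition cobdry1 :: "nat set \<Rightarrow> nat set" where
  "cobdry1 Y = {x \<in> D. odd (card (Y \<inter> orb \<phi> x))}"

lemma finite_face: "x \<in> D \<Longrightarrow> finite (orb \<phi> x)"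
  using f.orb_sub f.fin finite_subset by metis

lemma cobdry0_inv: "cobdry0 X \<in> invariant_sets D \<alpha>"
  by (auto simp: invariant_sets_def cobdry0_def)

lemma cobdry1_inv: "cobdry1 Y \<in> invariant_sets D \<phi>"
  by (auto simp: invariant_sets_def cobdry1_def f.orb_apply_eq)

lemma cobdry1_symdiff: "cobdry1 (X \<triangle> Y) = cobdry1 X \<triangle> cobdry1 Y"
  using odd_card_symdiff[OF finite_face] by (auto simp: cobdry1_def)

text \<open>Once around a face, membership in \<open>X\<close> changes an even number of times:
  \<open>X\<close> and its shift by the face permutation meet the face in equally many darts, so
  their symmetric difference meets it in an even number.\<close>

lemma cobdry1_cobdry0:
  assumes "X \<in> invariant_sets D \<sigma>"
  shows "cobdry1 (cobdry0 X) = {}"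
proof -
  have "even (card (cobdry0 X \<inter> orb \<phi> x))" if x: "x \<in> D" for x
  proof -
    let ?O = "orb \<phi> x"
    have sub: "?O \<subseteq> D" using f.orb_sub x by auto
    let ?X' = "{y \<in> D. \<phi> y \<in> X}"
    have *: "\<phi> y \<in> X \<longleftrightarrow> \<alpha> y \<in> X" if "y \<in> D" for y
      using assms that a_mem by (auto simp: invariant_sets_def f_def)
    have "cobdry0 X \<inter> ?O = (X \<triangle> ?X') \<inter> ?O"
      using sub * by (auto simp: cobdry0_def)
    moreover have "bij_betw \<phi> (?X' \<inter> ?O) (X \<inter> ?O)"
      unfolding bij_betw_def
    proof
      show "inj_on \<phi> (?X' \<inter> ?O)" using f.inj sub by (auto simp: inj_on_def)
      show "\<phi> ` (?X' \<inter> ?O) = X \<inter> ?O"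
      proof
        show "\<phi> ` (?X' \<inter> ?O) \<subseteq> X \<inter> ?O" using orb_step by fastforce
        show "X \<inter> ?O \<subseteq> \<phi> ` (?X' \<inter> ?O)"
        proof
          fix y assume y: "y \<in> X \<inter> ?O"
          then obtain z where z: "z \<in> D" "\<phi> z = y" using f.surj sub by blast
          then have "z \<in> orb \<phi> y" using f.orb_sym[OF z(1) orb_apply] by simp
          then have "z \<in> ?O" using y orb_trans[of y \<phi> x z] by simp
          then show "y \<in> \<phi> ` (?X' \<inter> ?O)" using y z by auto
        qed
      qed
    qed
    then have "card (?X' \<inter> ?O) = card (X \<inter> ?O)" by (rule bij_betw_same_card)
    ultimately show ?thesis using odd_card_symdiff[OF finite_face[OF x], of X ?X'] by simp
  qed
  then show ?thesis by (auto simp: cobdry1_def)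
qed

text \<open>On a connected map two vertex sets with the same coboundary agree everywhere or nowhere,
  so a fibre has at most two elements.\<close>

lemma card_cobdry0_image:
  assumes "connected_map M" "D \<noteq> {}"
  shows "2 ^ card (vertices M) \<le> 2 * card (cobdry0 ` invariant_sets D \<sigma>)"
proof -
  let ?A = "invariant_sets D \<sigma>"
  have fin: "finite ?A" by (rule s.finite_invariant_sets)
  have "card ?A \<le> 2 * card (cobdry0 ` ?A)"
  proof (rule card_le_fibres[OF fin])
    fix b assume "b \<in> cobdry0 ` ?A"
    then obtain X where X: "X \<in> ?A" "b = cobdry0 X" by auto
    have "X' = X \<or> X' = D - X" if X': "X' \<in> ?A" "cobdry0 X' = b" for X'
    proof -
      obtain o' where o: "o' \<in> D" using assms by auto
      have "(y \<in> X \<longleftrightarrow> y \<in> X') = (o' \<in> X \<longleftrightarrow> o' \<in> X')" if "y \<in> D" for y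
      proof (rule connected_inv[OF assms(1) _ _ o that])
        fix x assume "x \<in> D"
        then have "(x \<in> X \<longleftrightarrow> \<alpha> x \<notin> X) \<longleftrightarrow> (x \<in> X' \<longleftrightarrow> \<alpha> x \<notin> X')"
          using X X' by (auto simp: cobdry0_def)
        then show "(\<alpha> x \<in> X \<longleftrightarrow> \<alpha> x \<in> X') = (x \<in> X \<longleftrightarrow> x \<in> X')" by auto
      next
        fix x assume "x \<in> D"
        then show "(\<sigma> x \<in> X \<longleftrightarrow> \<sigma> x \<in> X') = (x \<in> X \<longleftrightarrow> x \<in> X')"
          using X X' by (auto simp: invariant_sets_def)
      qed
      moreover have "X \<subseteq> D" "X' \<subseteq> D" using X X' by (auto simp: invariant_sets_def)
      ultimately show ?thesis by (cases "o' \<in> X \<longleftrightarrow> o' \<in> X'") blast+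
    qed
    then have "{a \<in> ?A. cobdry0 a = b} \<subseteq> {X, D - X}" by auto
    then have "card {a \<in> ?A. cobdry0 a = b} \<le> card {X, D - X}" by (rule card_mono[rotated]) simp
    also have "\<dots> \<le> 2" by (simp add: card_insert_if)
    finally show "card {a \<in> ?A. cobdry0 a = b} \<le> 2" .
  qed (use fin in auto)
  then show ?thesis by (simp add: s.card_invariant_sets vertices_def)
qed

text \<open>The coboundary of an edge is the sum of the two faces beside it. By connectedness the
  image contains the sum of any two faces, so every face set lies in the image after adding at most
  one fixed face.\<close>

lemma card_cobdry1_image:
  assumes "connected_map M" "D \<noteq> {}"
  shows "2 ^ card (faces M) \<le> 2 * card (cobdry1 ` invariant_sets D \<alpha>)"
proof -
  let ?A = "invariant_sets D \<phi>" and ?I = "cobdry1 ` invariant_sets D \<alpha>"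
  have fin: "finite ?A" by (rule f.finite_invariant_sets)
  have Isub: "?I \<subseteq> ?A" using cobdry1_inv by auto
  have "{} \<in> invariant_sets D \<alpha>" "cobdry1 {} = {}" by (auto simp: invariant_sets_def cobdry1_def)
  then have I0: "{} \<in> ?I" by force
  have I_sym: "X \<triangle> Y \<in> ?I" if XY: "X \<in> ?I" "Y \<in> ?I" for X Y
  proof -
    obtain X' Y' where X': "X' \<in> invariant_sets D \<alpha>" "X = cobdry1 X'"
      and Y': "Y' \<in> invariant_sets D \<alpha>" "Y = cobdry1 Y'" using XY by auto
    have "X' \<triangle> Y' \<in> invariant_sets D \<alpha>" using X'(1) Y'(1) unfolding invariant_sets_def by blast
    moreover have "X \<triangle> Y = cobdry1 (X' \<triangle> Y')" using X' Y' cobdry1_symdiff by simp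
    ultimately show ?thesis by blast
  qed
  obtain o' where o: "o' \<in> D" using assms by auto
  let ?O = "orb \<phi> o'"
  have step: "orb \<phi> x \<triangle> orb \<phi> (\<alpha> x) \<in> ?I" if x: "x \<in> D" for x
  proof (cases "orb \<phi> x = orb \<phi> (\<alpha> x)")
    case True then show ?thesis using I0 by simp
  next
    case False
    have mem: "\<And>y z. y \<in> D \<Longrightarrow> z \<in> D \<Longrightarrow> y \<in> orb \<phi> z \<longleftrightarrow> orb \<phi> y = orb \<phi> z"
      using f.orb_eq_iff by metis
    have "{x, \<alpha> x} \<in> invariant_sets D \<alpha>"
      using x a_mem a_a unfolding invariant_sets_def by (smt (verit) empty_iff insert_iff mem_Collect_eq subset_iff)
    moreover have "cobdry1 {x, \<alpha> x} = orb \<phi> x \<triangle> orb \<phi> (\<alpha> x)"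
    proof -
      have "odd (card ({x, \<alpha> x} \<inter> orb \<phi> y)) \<longleftrightarrow> y \<in> orb \<phi> x \<triangle> orb \<phi> (\<alpha> x)" if y: "y \<in> D" for y
        using x y False mem[of y x] mem[of y "\<alpha> x"] mem[of x y] mem[of "\<alpha> x" y]
        by (auto simp: Int_insert_left)
      moreover have "orb \<phi> x \<subseteq> D" "orb \<phi> (\<alpha> x) \<subseteq> D" using x f.orb_sub by auto
      ultimately show ?thesis unfolding cobdry1_def by blast
    qed
    ultimately show ?thesis by (metis image_eqI)
  qed
  have face: "orb \<phi> x \<triangle> ?O \<in> ?I" if x: "x \<in> D" for x
  proof -
    have "(orb \<phi> x \<triangle> ?O \<in> ?I) = (orb \<phi> o' \<triangle> ?O \<in> ?I)"
    proof (rule connected_inv[OF assms(1) _ _ o x])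
      fix x assume x: "x \<in> D"
      have *: "orb \<phi> (\<alpha> x) \<triangle> ?O = (orb \<phi> x \<triangle> orb \<phi> (\<alpha> x)) \<triangle> (orb \<phi> x \<triangle> ?O)"
        "orb \<phi> x \<triangle> ?O = (orb \<phi> x \<triangle> orb \<phi> (\<alpha> x)) \<triangle> (orb \<phi> (\<alpha> x) \<triangle> ?O)" by blast+
      show a: "(orb \<phi> (\<alpha> x) \<triangle> ?O \<in> ?I) = (orb \<phi> x \<triangle> ?O \<in> ?I)"
        using I_sym[OF step[OF x]] * by metis
    next
      fix x assume x: "x \<in> D"
      have *: "orb \<phi> (\<alpha> x) \<triangle> ?O = (orb \<phi> x \<triangle> orb \<phi> (\<alpha> x)) \<triangle> (orb \<phi> x \<triangle> ?O)"
        "orb \<phi> x \<triangle> ?O = (orb \<phi> x \<triangle> orb \<phi> (\<alpha> x)) \<triangle> (orb \<phi> (\<alpha> x) \<triangle> ?O)" by blast+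
      \<comment> \<open>\<open>\<sigma> x\<close> follows \<open>\<alpha> x\<close> on its face, so
        turning past \<open>x\<close> leads to the same face as crossing the edge of
        \<open>x\<close>.\<close>
      have "orb \<phi> (\<sigma> x) = orb \<phi> (\<alpha> x)"
        using x f.orb_apply_eq[of "\<alpha> x"] by (simp add: f_def)
      then show "(orb \<phi> (\<sigma> x) \<triangle> ?O \<in> ?I) = (orb \<phi> x \<triangle> ?O \<in> ?I)"
        using I_sym[OF step[OF x]] * by metis
    qed
    then show ?thesis using I0 by simp
  qed
  \<comment> \<open>Faces are peeled off one at a time; modulo \<open>?I\<close> each of them equals
    the fixed face \<open>?O\<close>.\<close>
  have gen: "X \<in> ?I \<or> X \<triangle> ?O \<in> ?I" if "X \<in> ?A" for X
    using that
  proof (induction "card X" arbitrary: X rule: less_induct)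
    case less
    show ?case
    proof (cases "X = {}")
      case True then show ?thesis using I0 by simp
    next
      case False
      then obtain x where x: "x \<in> X" by auto
      have XD: "X \<subseteq> D" using less.prems by (auto simp: invariant_sets_def)
      let ?X = "X - orb \<phi> x"
      have sub: "orb \<phi> x \<subseteq> X" using f.invariant_sets_orb less.prems x by auto
      have "?X \<in> ?A" using less.prems f.orb_invariant[of x] x XD
        unfolding invariant_sets_def by blast
      moreover have "card ?X < card X"
        by (rule psubset_card_mono) (use x orb_self[of x \<phi>] finite_subset[OF XD f.fin] in auto)
      ultimately have IH: "?X \<in> ?I \<or> ?X \<triangle> ?O \<in> ?I" using less.hyps by blast
      have f: "orb \<phi> x \<triangle> ?O \<in> ?I" using face x XD by auto
      have "X = (?X \<triangle> ?O) \<triangle> (orb \<phi> x \<triangle> ?O)" "X \<triangle> ?O = ?X \<triangle> (orb \<phi> x \<triangle> ?O)"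
        using sub by blast+
      then show ?thesis using IH I_sym[OF _ f] by metis
    qed
  qed
  have "card ?A \<le> card (?I \<union> (\<lambda>X. X \<triangle> ?O) ` ?I)"
  proof (rule card_mono)
    show "finite (?I \<union> (\<lambda>X. X \<triangle> ?O) ` ?I)" using Isub fin finite_subset by auto
    show "?A \<subseteq> ?I \<union> (\<lambda>X. X \<triangle> ?O) ` ?I"
    proof
      fix X assume X: "X \<in> ?A"
      have *: "X = (X \<triangle> ?O) \<triangle> ?O" by blast
      show "X \<in> ?I \<union> (\<lambda>X. X \<triangle> ?O) ` ?I"
      proof (cases "X \<in> ?I")
        case False
        then have "X \<triangle> ?O \<in> ?I" using gen[OF X] by simp
        then have "(X \<triangle> ?O) \<triangle> ?O \<in> (\<lambda>X. X \<triangle> ?O) ` ?I" by (rule imageI)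
        then show ?thesis using * by simp
      qed simp
    qed
  qed
  also have "\<dots> \<le> card ?I + card ((\<lambda>X. X \<triangle> ?O) ` ?I)" by (rule card_Un_le)
  also have "\<dots> \<le> card ?I + card ?I"
    by (intro add_mono card_image_le order_refl finite_subset[OF Isub fin])
  finally show ?thesis by (simp add: f.card_invariant_sets faces_def)
qed

text \<open>By connectedness each coboundary map has a large image. The number of 1-cocycles is then at
  most 2 to the E - F + 1, the number of 1-coboundaries at least 2 to the V - 1, and the two bounds
  agree by Euler's formula.\<close>
lemma cocycle_is_coboundary:
  assumes "planar_map M" "Y \<in> invariant_sets D \<alpha>" "cobdry1 Y = {}"
  obtains X where "X \<in> invariant_sets D \<sigma>" "Y = cobdry0 X"
proof -
  have conn: "connected_map M" and ne: "D \<noteq> {}"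
    and euler: "int (card (vertices M)) - int (card (edges M)) + int (card (faces M)) = 2"
    using assms(1) by (auto simp: planar_map_def)
  let ?A = "invariant_sets D \<alpha>" and ?B = "cobdry0 ` invariant_sets D \<sigma>"
  let ?I = "cobdry1 ` ?A" and ?Z = "{Y \<in> ?A. cobdry1 Y = {}}"
  have fin: "finite ?A" by (rule a.finite_invariant_sets)
  have "card ?Z * card ?I = card ?A"
  proof -
    \<comment> \<open>The fibres of the coboundary are the translates of its kernel
      \<open>?Z\<close>.\<close>
    have "card ?Z * card ((\<lambda>b. {a \<in> ?A. cobdry1 a = b}) ` ?I) = card (\<Union> ((\<lambda>b. {a \<in> ?A. cobdry1 a = b}) ` ?I))"
    proof (rule card_partition)
      fix c assume "c \<in> (\<lambda>b. {a \<in> ?A. cobdry1 a = b}) ` ?I"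
      then obtain X where X: "X \<in> ?A" "c = {a \<in> ?A. cobdry1 a = cobdry1 X}" by auto
      have "bij_betw (\<lambda>Y. Y \<triangle> X) ?Z c"
      proof (rule bij_betw_byWitness[where f' = "\<lambda>Y. Y \<triangle> X"])
        have invol: "Y \<triangle> X \<triangle> X = Y" for Y by blast
        show "\<forall>Y\<in>?Z. Y \<triangle> X \<triangle> X = Y" "\<forall>Y\<in>c. Y \<triangle> X \<triangle> X = Y"
          by (simp_all add: invol)
        have sd: "Y \<triangle> X \<in> ?A" if "Y \<in> ?A" for Y
          using that X(1) unfolding invariant_sets_def by blast
        show "(\<lambda>Y. Y \<triangle> X) ` ?Z \<subseteq> c" using X sd cobdry1_symdiff by auto
        show "(\<lambda>Y. Y \<triangle> X) ` c \<subseteq> ?Z" using X sd cobdry1_symdiff by auto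
      qed
      then show "card c = card ?Z" by (rule bij_betw_same_card[symmetric])
    qed (use fin in auto)
    moreover have "\<Union> ((\<lambda>b. {a \<in> ?A. cobdry1 a = b}) ` ?I) = ?A" by auto
    moreover have "inj_on (\<lambda>b. {a \<in> ?A. cobdry1 a = b}) ?I" by (auto simp: inj_on_def)
    ultimately show ?thesis by (simp add: card_image)
  qed
  then have ZI: "card ?Z * card ?I = 2 ^ card (edges M)"
    by (simp add: a.card_invariant_sets edges_def)
  have "2 ^ card (faces M) \<le> 2 * card ?I" by (rule card_cobdry1_image[OF conn ne])
  then have "card ?Z * 2 ^ card (faces M) \<le> card ?Z * (2 * card ?I)" by (rule mult_le_mono2)
  also have "\<dots> = 2 * 2 ^ card (edges M)" using ZI by (simp only: mult.left_commute)
  finally have *: "card ?Z * 2 ^ card (faces M) \<le> 2 * 2 ^ card (edges M)" .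
  have "2 ^ card (vertices M) \<le> 2 * card ?B" by (rule card_cobdry0_image[OF conn ne])
  moreover have "2 ^ card (vertices M) * 2 ^ card (faces M) = 4 * (2::nat) ^ card (edges M)"
  proof -
    have "card (vertices M) + card (faces M) = 2 + card (edges M)" using euler by linarith
    then have "(2::nat) ^ (card (vertices M) + card (faces M)) = 2 ^ (2 + card (edges M))" by simp
    then show ?thesis by (simp add: power_add)
  qed
  moreover from calculation(1)
  have "2 ^ card (vertices M) * 2 ^ card (faces M) \<le> 2 * card ?B * 2 ^ card (faces M)"
    by (rule mult_le_mono1)
  ultimately have "4 * 2 ^ card (edges M) \<le> 2 * card ?B * 2 ^ card (faces M)" by simp
  then have "card ?Z * 2 ^ card (faces M) \<le> card ?B * 2 ^ card (faces M)" using * by linarith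
  then have le: "card ?Z \<le> card ?B" by simp
  have "?B \<subseteq> ?Z" using cobdry0_inv cobdry1_cobdry0 by auto
  then have "?B = ?Z" using le fin by (intro card_seteq) auto
  then have "Y \<in> ?B" using assms by simp
  then show ?thesis using that by auto
qed

text \<open>When all faces are even, the set of all edges is a cocycle; a vertex set with this
  coboundary is a proper two-colouring.\<close>

lemma bipartite:
  assumes "planar_map M" "\<And>x. x \<in> D \<Longrightarrow> even (card (orb \<phi> x))"
  shows "\<exists>c :: nat \<Rightarrow> bool. (\<forall>x\<in>D. c (\<sigma> x) = c x) \<and> (\<forall>x\<in>D. c (\<alpha> x) \<noteq> c x)"
proof -
  have "D \<in> invariant_sets D \<alpha>" by (auto simp: invariant_sets_def)
  moreover have "cobdry1 D = {}"
    using assms(2) f.orb_sub by (auto simp: cobdry1_def Int_absorb1)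
  ultimately obtain X where X: "X \<in> invariant_sets D \<sigma>" "D = cobdry0 X"
    using cocycle_is_coboundary[OF assms(1)] by metis
  show ?thesis
  proof (intro exI[of _ "\<lambda>x. x \<in> X"] conjI ballI)
    fix x assume "x \<in> D"
    then show "(\<sigma> x \<in> X) = (x \<in> X)" using X(1) by (auto simp: invariant_sets_def)
  next
    fix x assume "x \<in> D"
    then show "(\<alpha> x \<in> X) \<noteq> (x \<in> X)" using X(2) unfolding cobdry0_def by blast
  qed
qed

end

section \<open>Schaeffer's prescription on bipartite quadrangulations\<close>

text \<open>Turns the cardinality form of the face degrees into equations for iterates of the face
  permutation.\<close>

lemma (in finite_perm) card_orb_period:
  assumes "x \<in> D"
  shows "(f ^^ card (orb f x)) x = x" "\<And>i. 0 < i \<Longrightarrow> i < card (orb f x) \<Longrightarrow> (f ^^ i) x \<noteq> x"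
proof -
  define p where "p = (LEAST n. 0 < n \<and> (f ^^ n) x = x)"
  obtain n where "0 < n \<and> (f ^^ n) x = x"
    using bij_betw_funpow_period[OF bij fin assms] by blast
  then have p: "0 < p \<and> (f ^^ p) x = x" unfolding p_def by (rule LeastI)
  have min: "(f ^^ i) x \<noteq> x" if "0 < i" "i < p" for i
    using not_less_Least[of i "\<lambda>n. 0 < n \<and> (f ^^ n) x = x"] that by (auto simp: p_def)
  have "orb f x = (\<lambda>i. (f ^^ i) x) ` {..<p}"
  proof
    show "orb f x \<subseteq> (\<lambda>i. (f ^^ i) x) ` {..<p}"
    proof
      fix y assume "y \<in> orb f x"
      then show "y \<in> (\<lambda>i. (f ^^ i) x) ` {..<p}"
      proof (induction rule: orb_induct)
        case self
        then show ?case using p by (intro image_eqI[of _ _ 0]) auto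
      next
        case (step y)
        then obtain i where i: "i < p" "y = (f ^^ i) x" by auto
        show ?case
        proof (cases "Suc i = p")
          case True
          then have "f y = (f ^^ 0) x" using i p by auto
          then show ?thesis using p by blast
        next
          case False
          then show ?thesis using i by (intro image_eqI[of _ _ "Suc i"]) auto
        qed
      qed
    qed
  qed (auto intro: orb_funpow)
  moreover have "inj_on (\<lambda>i. (f ^^ i) x) {..<p}"
  proof (rule linorder_inj_onI)
    fix i j :: nat assume ij: "i < j" "i \<in> {..<p}" "j \<in> {..<p}"
    show "(f ^^ i) x \<noteq> (f ^^ j) x"
    proof
      assume "(f ^^ i) x = (f ^^ j) x"
      then have "(f ^^ i) ((f ^^ (j - i)) x) = (f ^^ i) x"
        using ij by (metis add_diff_cancel_left' comp_apply funpow_add less_imp_add_positive)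
      then have "(f ^^ (j - i)) x = x"
        using bij_betw_funpow_inj[OF bij pow_mem[OF assms] assms] by metis
      moreover have "0 < j - i" "j - i < p" using ij by auto
      ultimately show False using min by blast
    qed
  qed auto
  ultimately have "card (orb f x) = p" by (simp add: card_image)
  then show "(f ^^ card (orb f x)) x = x" "\<And>i. 0 < i \<Longrightarrow> i < card (orb f x) \<Longrightarrow> (f ^^ i) x \<noteq> x"
    using p min by auto
qed

text \<open>Planarity is not assumed: for the quadrangulation built from a given map it is only deduced
  afterwards, from the planarity of the image under Schaeffer's prescription.\<close>
locale bipartite_quad = combinatorial_map Q for Q :: rp_quad +
  assumes ne: "darts Q \<noteq> {}"
    and conn: "connected_map Q"
    and org: "qorg Q \<in> vertices Q"
    and quad: "\<And>x. x \<in> darts Q \<Longrightarrow> card (orb (faceperm Q) x) = 4"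
    and step: "\<And>x. x \<in> darts Q \<Longrightarrow>
      qd Q (edge_inv Q x) = Suc (qd Q x) \<or> qd Q x = Suc (qd Q (edge_inv Q x))"
begin

abbreviation "d \<equiv> qd Q"

definition outward :: "nat set" where "outward = {x \<in> D. d (\<alpha> x) = Suc (d x)}"

text \<open>\<open>partner\<close> restricted to corners that have one. The tests recognise in turn
  the upper end of the new edge in a simple face, a confluent face, and the lower end in a simple
  face; their order matters because the second test also succeeds in the first situation.\<close>

definition mate :: "nat \<Rightarrow> nat" where
  "mate x = (if d (\<phi> (\<phi> (\<phi> x))) < d x then \<phi> (\<phi> (\<phi> x)) else if d (\<phi> (\<phi> x)) = d x then \<phi> (\<phi> x) else \<phi> x)"

abbreviation next_out :: "nat \<Rightarrow> nat" where "next_out \<equiv> next_in \<sigma> outward"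

lemma geo: "geodesic Q (qorg Q) d"
  using geodesic_vdist[OF conn org] by (simp add: qd_def[abs_def])

lemma d_s [simp]: "x \<in> D \<Longrightarrow> d (\<sigma> x) = d x"
  using geo by (simp add: geodesic_def)

lemma d_orb: "x \<in> D \<Longrightarrow> y \<in> orb \<sigma> x \<Longrightarrow> d y = d x"
  using geodesic_vof[OF geo] by (simp add: vertex_of_def)

lemma d_zero: "x \<in> D \<Longrightarrow> d x = 0 \<longleftrightarrow> vertex_of Q x = qorg Q"
  using geo by (simp add: geodesic_def)

lemma d_f: "x \<in> D \<Longrightarrow> d (\<phi> x) = d (\<alpha> x)"
  by (simp add: f_def)

lemma outward_dart: "x \<in> outward \<Longrightarrow> x \<in> D" by (simp add: outward_def)

lemma outward_subset: "outward \<subseteq> D" by (auto simp: outward_def)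

lemma outward_iff: "x \<in> D \<Longrightarrow> x \<in> outward \<longleftrightarrow> d (\<phi> x) = Suc (d x)"
  by (simp add: outward_def d_f)

lemma inward_iff: "x \<in> D \<Longrightarrow> x \<notin> outward \<longleftrightarrow> d x = Suc (d (\<alpha> x))"
proof -
  assume x: "x \<in> D"
  then have "x \<in> outward \<longleftrightarrow> d (\<alpha> x) = Suc (d x)" by (simp add: outward_def)
  then show ?thesis using step[OF x] by linarith
qed

lemma flip_outward_iff: "x \<in> D \<Longrightarrow> \<alpha> x \<in> outward \<longleftrightarrow> x \<notin> outward"
  by (simp add: inward_iff) (simp add: outward_def)

lemma f4 [simp]: "x \<in> D \<Longrightarrow> \<phi> (\<phi> (\<phi> (\<phi> x))) = x"
proof -
  assume x: "x \<in> D"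
  have "(\<phi> ^^ 4) x = x" using f.card_orb_period(1)[OF x] unfolding quad[OF x] .
  moreover have "4 = Suc (Suc (Suc (Suc 0)))" by simp
  ultimately show ?thesis by (metis comp_apply funpow.simps id_apply)
qed

lemma f2: "x \<in> D \<Longrightarrow> \<phi> (\<phi> x) \<noteq> x"
proof -
  assume x: "x \<in> D"
  have "(\<phi> ^^ 2) x \<noteq> x" using f.card_orb_period(2)[OF x, of 2] unfolding quad[OF x] by simp
  moreover have "2 = Suc (Suc 0)" by simp
  ultimately show ?thesis by (metis comp_apply funpow.simps id_apply)
qed

lemma f_neq: "x \<in> D \<Longrightarrow> \<phi> x \<noteq> x"
  using f2 by metis

lemma fff_s: "x \<in> D \<Longrightarrow> \<phi> (\<phi> (\<phi> (\<sigma> x))) = \<alpha> x"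
  using f4[of "\<alpha> x"] by (simp add: f_def)

text \<open>With h the height of \<open>x\<close>, the heights around the face starting at
  \<open>x\<close> are h, h+1, h, h+1 in \<open>conf\<close>, h, h+1, h+2, h+1 in \<open>low\<close>
  and h, h+1, h, h-1 in \<open>up\<close>. The last two are the two ends of the new edge of a simple
  face.\<close>

lemma mate_cases:
  assumes "x \<in> outward"
  obtains
    (conf) "d (\<phi> x) = Suc (d x)" "d (\<phi> (\<phi> x)) = d x" "d (\<phi> (\<phi> (\<phi> x))) = Suc (d x)" "mate x = \<phi> (\<phi> x)"
  | (low) "d (\<phi> x) = Suc (d x)" "d (\<phi> (\<phi> x)) = Suc (Suc (d x))" "d (\<phi> (\<phi> (\<phi> x))) = Suc (d x)" "mate x = \<phi> x"
  | (up) "d (\<phi> x) = Suc (d x)" "d (\<phi> (\<phi> x)) = d x" "d x = Suc (d (\<phi> (\<phi> (\<phi> x))))" "mate x = \<phi> (\<phi> (\<phi> x))"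
proof -
  have x: "x \<in> D" using assms outward_dart by simp
  have s: "d (\<phi> y) = Suc (d y) \<or> d y = Suc (d (\<phi> y))" if "y \<in> D" for y
    using step[OF that] d_f[OF that] by auto
  have 1: "d (\<phi> x) = Suc (d x)" using assms x outward_iff by simp
  moreover have "d (\<phi> (\<phi> x)) = Suc (d (\<phi> x)) \<or> d (\<phi> x) = Suc (d (\<phi> (\<phi> x)))" using s x by auto
  moreover have "d (\<phi> (\<phi> (\<phi> x))) = Suc (d (\<phi> (\<phi> x))) \<or> d (\<phi> (\<phi> x)) = Suc (d (\<phi> (\<phi> (\<phi> x))))" using s x by auto
  moreover have "d x = Suc (d (\<phi> (\<phi> (\<phi> x)))) \<or> d (\<phi> (\<phi> (\<phi> x))) = Suc (d x)" using s[of "\<phi> (\<phi> (\<phi> x))"] x by auto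
  ultimately have
    "d (\<phi> (\<phi> x)) = d x \<and> d (\<phi> (\<phi> (\<phi> x))) = Suc (d x) \<or>
     d (\<phi> (\<phi> x)) = Suc (Suc (d x)) \<and> d (\<phi> (\<phi> (\<phi> x))) = Suc (d x) \<or>
     d (\<phi> (\<phi> x)) = d x \<and> d x = Suc (d (\<phi> (\<phi> (\<phi> x))))" by arith
  then show ?thesis
  proof (elim disjE conjE)
    assume "d (\<phi> (\<phi> x)) = d x" "d (\<phi> (\<phi> (\<phi> x))) = Suc (d x)"
    then show ?thesis using 1 by (intro conf) (simp_all add: mate_def)
  next
    assume "d (\<phi> (\<phi> x)) = Suc (Suc (d x))" "d (\<phi> (\<phi> (\<phi> x))) = Suc (d x)"
    then show ?thesis using 1 by (intro low) (simp_all add: mate_def)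
  next
    assume "d (\<phi> (\<phi> x)) = d x" "d x = Suc (d (\<phi> (\<phi> (\<phi> x))))"
    then show ?thesis using 1 by (intro up) (simp_all add: mate_def)
  qed
qed

lemma mate_props: assumes "x \<in> outward" shows "mate x \<in> outward" "mate (mate x) = x" "mate x \<noteq> x"
proof -
  have x: "x \<in> D" using assms outward_dart by simp
  from assms have "mate x \<in> outward \<and> mate (mate x) = x \<and> mate x \<noteq> x"
  proof (cases rule: mate_cases)
    case conf
    then show ?thesis using x f2 by (auto simp: outward_iff mate_def[of "\<phi> (\<phi> x)"])
  next
    case low
    then show ?thesis using x f_neq by (auto simp: outward_iff mate_def[of "\<phi> x"])
  next
    case up
    then show ?thesis using x f_neq[of "\<phi> (\<phi> (\<phi> x))"] by (auto simp: outward_iff mate_def[of "\<phi> (\<phi> (\<phi> x))"])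
  qed
  then show "mate x \<in> outward" "mate (mate x) = x" "mate x \<noteq> x" by auto
qed

lemma d_mate: "x \<in> outward \<Longrightarrow> d (mate x) \<le> Suc (d x)"
  by (erule mate_cases) auto

lemma mate_bij: "bij_betw mate outward outward"
  by (rule bij_betw_byWitness[where f' = mate]) (auto simp: mate_props)

text \<open>The face through \<open>\<alpha> e\<close> and \<open>\<sigma> e\<close> rises twice
  from \<open>\<alpha> e\<close>, so it is simple and its new edge runs parallel to the edge of
  \<open>e\<close>. This is how descending edges survive in the image.\<close>

lemma mate_after: "e \<in> D \<Longrightarrow> e \<notin> outward \<Longrightarrow> \<sigma> e \<in> outward \<Longrightarrow> mate (\<sigma> e) = \<alpha> e"
  using inward_iff[of e] by (simp add: mate_def fff_s)

lemma partner_eq: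
  assumes "x \<in> D"
  shows "partner Q x = (if x \<in> outward then Some (mate x) else None)"
proof (cases "x \<in> outward")
  case True
  then show ?thesis
    by (cases rule: mate_cases) (use True in \<open>auto simp: partner_def lab_def Let_def\<close>)
next
  case False
  then have "d x = Suc (d (\<phi> x))" using inward_iff assms d_f by simp
  then show ?thesis using False by (auto simp: partner_def lab_def Let_def)
qed

lemma marked_eq: "marked Q = outward"
  using partner_eq outward_subset by (auto simp: marked_def split: if_splits)

lemma Phi_darts [simp]: "darts (Phi Q) = outward"
  by (simp add: Phi_def marked_eq)

lemma Phi_edge_inv [simp]: "x \<in> outward \<Longrightarrow> edge_inv (Phi Q) x = mate x"
  by (simp add: Phi_def partner_eq outward_dart)

lemma Phi_vert_rot [simp]: "vert_rot (Phi Q) = next_out"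
  by (simp add: Phi_def marked_eq)

lemma Phi_org: "org (Phi Q) = qorg Q \<inter> outward"
  by (simp add: Phi_def marked_eq)

lemma Phi_rootd: "rootd (Phi Q) = next_out (qroot_dart Q)"
  by (simp add: Phi_def marked_eq)

lemma next_out_bij: "bij_betw next_out outward outward"
  by (rule s.next_in_bij[OF outward_subset])

lemma Phi_cmap: "is_cmap (Phi Q)"
proof -
  have "bij_betw (edge_inv (Phi Q)) outward outward"
    using mate_bij by (simp cong: bij_betw_cong)
  then show ?thesis
    using next_out_bij finite_subset[OF outward_subset s.fin] by (simp add: is_cmap_def mate_props)
qed

sublocale Phi: combinatorial_map "Phi Q"
  by unfold_locales (rule Phi_cmap)

lemma orb_next_out: "x \<in> outward \<Longrightarrow> orb next_out x = orb \<sigma> x \<inter> outward"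
  by (rule s.orb_next_in[OF outward_subset])

lemma Phi_vof: "x \<in> outward \<Longrightarrow> vertex_of (Phi Q) x = vertex_of Q x \<inter> outward"
  by (simp add: vertex_of_def orb_next_out)

text \<open>The last inward dart before an outward one is where \<open>mate_after\<close>
  applies.\<close>

lemma before_next_out:
  assumes "e \<in> D" "e \<notin> outward" "y \<in> orb \<sigma> e" "y \<in> outward"
  shows "\<exists>e'\<in>orb \<sigma> e. e' \<in> D \<and> e' \<notin> outward \<and> \<sigma> e' = next_out e"
  using assms(1,3,4,2)
proof (induction rule: s.next_in_induct)
  case (hit x)
  then show ?case using orb_self[of x \<sigma>] by auto
next
  case (miss x)
  then show ?case using s.orb_apply_eq[of x] by auto
qed

lemma org_sub: "qorg Q \<subseteq> D"
  using org vof_sub by (auto simp: vertices_alt)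

lemma org_iff: "x \<in> D \<Longrightarrow> x \<in> qorg Q \<longleftrightarrow> d x = 0"
proof -
  assume x: "x \<in> D"
  obtain z where z: "z \<in> D" "qorg Q = vertex_of Q z" using org by (auto simp: vertices_alt)
  show ?thesis
    unfolding d_zero[OF x] z(2) using vof_eq[OF z(1), of x] vof_self[of x] by metis
qed

text \<open>A new edge changes the height by at most one. A surviving vertex other than the origin
  has inward and outward darts; where an outward dart follows an inward one,
  \<open>mate_after\<close> gives a new edge to a closer neighbour.\<close>

lemma Phi_geodesic: "geodesic (Phi Q) (org (Phi Q)) d"
  unfolding geodesic_def
proof (intro conjI ballI impI)
  fix x assume "x \<in> darts (Phi Q)"
  then have x: "x \<in> outward" "x \<in> D" using outward_dart by auto
  have "next_out x \<in> orb \<sigma> x" using s.next_in_mem(2)[OF x(2) orb_self x(1)] .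
  then show "d (vert_rot (Phi Q) x) = d x" using d_orb x by simp
  show "d (edge_inv (Phi Q) x) \<le> Suc (d x)" using x d_mate by simp
  show "d x = 0 \<longleftrightarrow> vertex_of (Phi Q) x = org (Phi Q)"
  proof
    assume "d x = 0"
    then show "vertex_of (Phi Q) x = org (Phi Q)" using x d_zero by (simp add: Phi_vof Phi_org)
  next
    assume "vertex_of (Phi Q) x = org (Phi Q)"
    then have "vertex_of Q x \<inter> outward = qorg Q \<inter> outward" using x by (simp add: Phi_vof Phi_org)
    moreover have "x \<in> vertex_of Q x \<inter> outward" using x by simp
    ultimately have "x \<in> qorg Q" by simp
    then show "d x = 0" using org_iff x by simp
  qed
  assume "0 < d x"
  then obtain e where e: "e \<in> vertex_of Q x" "Suc (d (\<alpha> e)) = d x"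
    using geo x unfolding geodesic_def by blast
  have eD: "e \<in> D" using e x vof_sub by auto
  have de: "d e = d x" using e d_orb x by (simp add: vertex_of_def)
  have eP: "e \<notin> outward" using inward_iff[OF eD] e de by simp
  have xe: "x \<in> orb \<sigma> e" using e x s.orb_sym by (simp add: vertex_of_def)
  obtain e' where e': "e' \<in> orb \<sigma> e" "e' \<in> D" "e' \<notin> outward" "\<sigma> e' = next_out e"
    using before_next_out[OF eD eP xe x(1)] by blast
  have n: "next_out e \<in> outward" "next_out e \<in> orb \<sigma> e" using s.next_in_mem[OF eD xe x(1)] by auto
  have "mate (next_out e) = \<alpha> e'" using mate_after e' n by metis
  moreover have "d e' = d x" using d_orb[OF eD e'(1)] de by simp
  ultimately have "Suc (d (mate (next_out e))) = d x" using inward_iff[of e'] e' by simp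
  moreover have "next_out e \<in> orb \<sigma> x" using n s.orb_eq[OF eD xe] by simp
  ultimately show "\<exists>y\<in>vertex_of (Phi Q) x. Suc (d (edge_inv (Phi Q) y)) = d x"
    using n x by (intro bexI[of _ "next_out e"]) (simp_all add: Phi_vof[OF x(1)], simp add: vertex_of_def)
qed

lemma org_outward: "x \<in> qorg Q \<Longrightarrow> x \<in> outward"
  using org_iff[of x] org_sub inward_iff[of x] by auto

lemma Phi_org_vertex: "org (Phi Q) \<in> vertices (Phi Q)"
proof -
  obtain x where x: "x \<in> D" "qorg Q = vertex_of Q x" using org by (auto simp: vertices_alt)
  then have "x \<in> outward" using org_outward by simp
  then show ?thesis using x Phi_vof by (auto simp: Phi.vertices_alt Phi_org)
qed

lemma Phi_connected: "connected_map (Phi Q)"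
  by (rule Phi.geodesic_connected[OF Phi_geodesic])

lemma Phi_dist: "x \<in> outward \<Longrightarrow> vdist (Phi Q) (org (Phi Q)) (vertex_of (Phi Q) x) = d x"
  using Phi.geodesic_unique[OF Phi_geodesic] by simp

text \<open>Reversal exchanges outward and inward darts.\<close>

lemma card_outward: "card D = 2 * card outward"
proof -
  have "bij_betw \<alpha> outward (D - outward)"
    by (rule bij_betw_byWitness[where f' = \<alpha>]) (auto simp: outward_dart flip_outward_iff)
  then have "card (D - outward) = card outward" by (metis bij_betw_same_card)
  moreover have "card D = card outward + card (D - outward)"
    using outward_subset s.fin by (metis card_Diff_subset card_mono finite_subset le_add_diff_inverse)
  ultimately show ?thesis by simp
qed

lemma Phi_nedges: "nedges (Phi Q) = nfaces Q"
proof -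
  have "4 * card (faces Q) = card D" unfolding faces_def by (rule f.card_orbs_const[OF quad])
  then show ?thesis using card_outward Phi.card_edges by (simp add: nedges_def nfaces_def)
qed

section \<open>Local maxima and the vertex count\<close>

definition locmax :: "nat set set" where
  "locmax = {v \<in> vertices Q. v \<inter> outward = {}}"

lemma nlocmax_eq: "nlocmax Q = card locmax"
proof -
  have "{v \<in> vertices Q. \<forall>x\<in>darts Q. vertex_of Q x = v \<longrightarrow> d (\<alpha> x) < d x} = locmax"
  proof -
    have "(\<forall>x\<in>D. vertex_of Q x = vertex_of Q z \<longrightarrow> d (\<alpha> x) < d x) \<longleftrightarrow> vertex_of Q z \<inter> outward = {}"
      if z: "z \<in> D" for z
    proof -
      have "vertex_of Q x = vertex_of Q z \<longleftrightarrow> x \<in> vertex_of Q z" if "x \<in> D" for x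
        using vof_eq[OF z, of x] vof_self[of x] by metis
      moreover have "d (\<alpha> x) < d x \<longleftrightarrow> x \<notin> outward" if "x \<in> D" for x
        using inward_iff[OF that] step[OF that] by linarith
      moreover have "vertex_of Q z \<subseteq> D" using vof_sub z by simp
      ultimately show ?thesis by blast
    qed
    then show ?thesis by (auto simp: locmax_def vertices_alt)
  qed
  then show ?thesis by (simp add: nlocmax_def)
qed

lemma card_vertices: "card (vertices Q) = card (vertices (Phi Q)) + card locmax"
proof -
  let ?W = "{v \<in> vertices Q. v \<inter> outward \<noteq> {}}"
  have fin: "finite (vertices Q)" by (simp add: vertices_alt s.fin)
  have "vertices (Phi Q) = (\<lambda>v. v \<inter> outward) ` ?W"
  proof
    show "vertices (Phi Q) \<subseteq> (\<lambda>v. v \<inter> outward) ` ?W"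
    proof
      fix v assume "v \<in> vertices (Phi Q)"
      then obtain x where x: "x \<in> outward" "v = vertex_of Q x \<inter> outward" using Phi_vof by (auto simp: Phi.vertices_alt)
      moreover have "vertex_of Q x \<inter> outward \<noteq> {}" using x(1) vof_self[of x] by blast
      then have "vertex_of Q x \<in> ?W" using outward_dart[OF x(1)] by (simp add: vertices_alt)
      ultimately show "v \<in> (\<lambda>v. v \<inter> outward) ` ?W" by (intro image_eqI)
    qed
    show "(\<lambda>v. v \<inter> outward) ` ?W \<subseteq> vertices (Phi Q)"
    proof
      fix v assume "v \<in> (\<lambda>v. v \<inter> outward) ` ?W"
      then obtain z x where z: "z \<in> D" "v = vertex_of Q z \<inter> outward" "x \<in> vertex_of Q z" "x \<in> outward"
        by (auto simp: vertices_alt)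
      then have "v = vertex_of (Phi Q) x" using vof_eq[OF z(1,3)] Phi_vof[OF z(4)] by simp
      then show "v \<in> vertices (Phi Q)" using z by (simp add: Phi.vertices_alt)
    qed
  qed
  moreover have "inj_on (\<lambda>v. v \<inter> outward) ?W"
  proof (rule inj_onI)
    fix v w assume *: "v \<in> ?W" "w \<in> ?W" "v \<inter> outward = w \<inter> outward"
    then obtain x where x: "x \<in> v" "x \<in> w" by auto
    obtain y z where "y \<in> D" "z \<in> D" "v = vertex_of Q y" "w = vertex_of Q z"
      using * by (auto simp: vertices_alt)
    then show "v = w" using x vof_eq by metis
  qed
  ultimately have "card (vertices (Phi Q)) = card ?W" by (simp add: card_image)
  moreover have "vertices Q = ?W \<union> locmax" "?W \<inter> locmax = {}" by (auto simp: locmax_def)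
  ultimately show ?thesis using fin card_Un_disjoint[of ?W locmax] by (metis finite_Un)
qed

end

section \<open>Faces of the image and local maxima\<close>

text \<open>Used for summits against contour orbits, and for classes of quadrangulations against
  classes of their images.\<close>

lemma card_image_eq_iff:
  assumes "\<And>x y. x \<in> A \<Longrightarrow> y \<in> A \<Longrightarrow> f x = f y \<longleftrightarrow> g x = g y"
  shows "card (f ` A) = card (g ` A)"
proof -
  let ?h = "\<lambda>v. g (inv_into A f v)"
  have h: "?h (f x) = g x" if "x \<in> A" for x
    using that assms[of "inv_into A f (f x)" x] f_inv_into_f[of "f x" f A] inv_into_into[of "f x" f A]
    by auto
  have "inj_on ?h (f ` A)"
  proof (rule inj_onI)
    fix u v assume "u \<in> f ` A" "v \<in> f ` A" and eq: "?h u = ?h v"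
    then obtain x y where "x \<in> A" "u = f x" "y \<in> A" "v = f y" by auto
    then show "u = v" using eq assms[of x y] by (simp add: h)
  qed
  moreover have "?h ` f ` A = g ` A" unfolding image_image by (rule image_cong) (simp_all add: h)
  ultimately show ?thesis using card_image by fastforce
qed

context bipartite_quad
begin

text \<open>The face permutation of the image conjugated by \<open>mate\<close>. It turns first and
  crosses the edge afterwards, so a step can be followed through the darts of Q at a single
  vertex.\<close>

definition contour :: "nat \<Rightarrow> nat" where "contour x = mate (next_out x)"

lemma contour_bij: "bij_betw contour outward outward"
  using bij_betw_trans[OF next_out_bij mate_bij] by (simp add: contour_def[abs_def] comp_def)

sublocale p: finite_perm outward contour
  using finite_subset[OF outward_subset s.fin] contour_bij by unfold_locales

text \<open>Chains the hypothesis over the inward darts between \<open>e\<close> and the next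
  outward dart. The hypothesis is limited to one height because the lemma is applied inside the
  induction on heights that establishes it.\<close>

lemma contour_chain_aux:
  assumes H: "\<And>e. e \<in> D \<Longrightarrow> e \<notin> outward \<Longrightarrow> \<sigma> e \<notin> outward \<Longrightarrow> d e = k \<Longrightarrow> \<alpha> e \<in> orb contour (\<alpha> (\<sigma> e))"
    and "e \<in> D" "y \<in> orb \<sigma> e" "y \<in> outward" "e \<notin> outward" "d e = k"
  shows "\<alpha> e \<in> orb contour (mate (next_out e))"
  using assms(2-6)
proof (induction rule: s.next_in_induct)
  case (hit e)
  then show ?case using mate_after[of e] orb_self[of "\<alpha> e" contour] by simp
next
  case (miss e)
  then have "\<alpha> (\<sigma> e) \<in> orb contour (mate (next_out e))" by simp
  moreover have "\<alpha> e \<in> orb contour (\<alpha> (\<sigma> e))" using H miss by simp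
  ultimately show ?case by (rule orb_trans)
qed

text \<open>Look at the quadrangle between \<open>e\<close> and \<open>\<sigma> e\<close>. If it is
  confluent, one contour step leads from \<open>u\<close> to \<open>x\<close>. If it is simple, the
  corner between the two darts is its top; the contour from \<open>u\<close> first runs through the
  inward darts at the start of \<open>u\<close>, which is the claim one level lower, and then steps
  to \<open>x\<close>.\<close>

lemma contour_chain:
  assumes "e \<in> D" "e \<notin> outward" "\<sigma> e \<notin> outward"
  shows "\<alpha> e \<in> orb contour (\<alpha> (\<sigma> e))"
  using assms
proof (induction "d e" arbitrary: e rule: less_induct)
  case less
  define u where "u = \<alpha> (\<sigma> e)"
  define x where "x = \<alpha> e"
  have x: "x \<in> outward" "x \<in> D" and u: "u \<in> outward" "u \<in> D" using less.prems by (auto simp: x_def u_def flip_outward_iff)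
  have "d e = Suc (d x)" using less.prems inward_iff by (simp add: x_def)
  moreover have "d e = Suc (d u)" using less.prems inward_iff[of "\<sigma> e"] by (simp add: u_def)
  ultimately have du: "d u = d x" "d u < d e" by auto
  have f: "\<phi> x = \<sigma> e" "\<phi> (\<phi> x) = \<sigma> u" "\<phi> (\<phi> (\<phi> x)) = \<phi> (\<sigma> u)"
    using less.prems by (simp_all add: x_def u_def f_def)
  show ?case
  proof (cases "\<sigma> u \<in> outward")
    case True
    have "d (\<phi> (\<sigma> u)) = Suc (d x)" using True outward_iff[of "\<sigma> u"] u du by simp
    then have "mate x = \<sigma> u" using f du u by (simp add: mate_def)
    then have "mate (\<sigma> u) = x" using mate_props(2)[OF x(1)] by simp
    then have "contour u = x" using True by (simp add: contour_def next_in_hit)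
    then show ?thesis using orb_apply[of contour u] by (simp add: x_def u_def)
  next
    case False
    let ?w = "\<sigma> u"
    have w: "?w \<in> D" "d ?w = d u" using u by auto
    have uw: "u \<in> orb \<sigma> ?w" using s.orb_sym[OF u(2) orb_apply] .
    have "\<alpha> ?w \<in> orb contour (mate (next_out ?w))"
    proof (rule contour_chain_aux[OF _ w(1) uw u(1) False w(2)])
      fix e' assume "e' \<in> D" "e' \<notin> outward" "\<sigma> e' \<notin> outward" "d e' = d u"
      then show "\<alpha> e' \<in> orb contour (\<alpha> (\<sigma> e'))" using less.hyps du by simp
    qed
    moreover have "next_out u = next_out ?w" using s.next_in_miss[OF u(2) orb_self u(1) False] .
    ultimately have 1: "\<alpha> ?w \<in> orb contour (contour u)" by (simp add: contour_def)
    let ?z = "\<alpha> ?w"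
    have z: "?z \<in> outward" "?z \<in> D" using w False by (auto simp: flip_outward_iff)
    have "d (\<phi> ?w) < d x" using inward_iff[OF w(1)] False w du d_f[OF w(1)] by simp
    then have m: "mate x = \<sigma> ?z" using f by (simp add: mate_def f_def)
    then have "mate (\<sigma> ?z) = x" "\<sigma> ?z \<in> outward" using mate_props[OF x(1)] by auto
    then have "contour ?z = x" by (simp add: contour_def next_in_hit)
    then have "x \<in> orb contour (contour u)" using orb_step[OF 1] by simp
    then show ?thesis using orb_trans[OF orb_apply] by (simp add: x_def u_def)
  qed
qed

lemma contour_chain_next:
  assumes "e \<in> D" "y \<in> orb \<sigma> e" "y \<in> outward" "e \<notin> outward"
  shows "\<alpha> e \<in> orb contour (mate (next_out e))"
  using contour_chain_aux[OF contour_chain assms refl] .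

text \<open>The last outward dart at or before \<open>e\<close> in the rotation. It is meaningful
  only if the vertex of \<open>e\<close> has an outward dart.\<close>

definition pre :: "nat \<Rightarrow> nat" where "pre e = inv_into outward next_out (next_out e)"

lemma pre_props:
  assumes "e \<in> D" "y \<in> orb \<sigma> e" "y \<in> outward"
  shows "pre e \<in> outward" "next_out (pre e) = next_out e" "pre e \<in> orb \<sigma> e"
proof -
  have n: "next_out e \<in> outward" "next_out e \<in> orb \<sigma> e" using s.next_in_mem[OF assms] .
  then have im: "next_out e \<in> next_out ` outward" using next_out_bij by (simp add: bij_betw_def)
  show p: "pre e \<in> outward" unfolding pre_def by (rule inv_into_into[OF im])
  show e: "next_out (pre e) = next_out e" unfolding pre_def by (rule f_inv_into_f[OF im])
  have "next_out (pre e) \<in> orb \<sigma> (pre e)" using s.next_in_mem(2)[OF outward_dart[OF p] orb_self p] .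
  then have "pre e \<in> orb \<sigma> (next_out e)" using s.orb_sym[OF outward_dart[OF p]] e by simp
  then show "pre e \<in> orb \<sigma> e" using orb_trans n(2) by metis
qed

lemma pre_eqI: "x \<in> outward \<Longrightarrow> next_out e = next_out x \<Longrightarrow> pre e = x"
  using next_out_bij by (simp add: pre_def bij_betw_def inv_into_f_f)

text \<open>Climbing along outward darts, each time turning to the last outward dart before the
  arrival dart, ends at a local maximum. The face of the image map determines that local maximum
  and is determined by it.\<close>
function summit :: "nat \<Rightarrow> nat set" where
  "summit x = (if x \<in> outward \<and> (\<exists>y\<in>outward. y \<in> orb \<sigma> (\<alpha> x)) then summit (pre (\<alpha> x)) else orb \<sigma> (\<alpha> x))"
  by pat_completeness auto
termination
\<comment> \<open>Each climb starts one level higher, and the heights on a finite map are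
  bounded.\<close>
proof (relation "measure (\<lambda>x. Suc (Max (d ` D)) - d x)")
  fix x assume x: "x \<in> outward \<and> (\<exists>y\<in>outward. y \<in> orb \<sigma> (\<alpha> x))"
  then have xD: "x \<in> D" using outward_dart by simp
  obtain y where y: "y \<in> orb \<sigma> (\<alpha> x)" "y \<in> outward" using x by auto
  have "pre (\<alpha> x) \<in> orb \<sigma> (\<alpha> x)" using pre_props[OF a_mem[OF xD] y] by simp
  then have "d (pre (\<alpha> x)) = d (\<alpha> x)" using d_orb[OF a_mem[OF xD]] by simp
  moreover have "d (\<alpha> x) = Suc (d x)" using x by (simp add: outward_def)
  moreover have "d x \<le> Max (d ` D)" using xD s.fin by simp
  ultimately show "(pre (\<alpha> x), x) \<in> measure (\<lambda>x. Suc (Max (d ` D)) - d x)" by simp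
qed simp

declare summit.simps [simp del]

lemma summit_cong:
  assumes "x \<in> outward" "z \<in> outward" "orb \<sigma> (\<alpha> x) = orb \<sigma> (\<alpha> z)"
    "\<And>y. y \<in> orb \<sigma> (\<alpha> x) \<Longrightarrow> y \<in> outward \<Longrightarrow> next_out (\<alpha> x) = next_out (\<alpha> z)"
  shows "summit x = summit z"
proof (cases "\<exists>y\<in>outward. y \<in> orb \<sigma> (\<alpha> x)")
  case True
  then have "pre (\<alpha> x) = pre (\<alpha> z)" using assms(4) unfolding pre_def by metis
  then show ?thesis using assms True by (simp add: summit.simps[of x] summit.simps[of z])
next
  case False
  then show ?thesis using assms by (simp add: summit.simps[of x] summit.simps[of z])
qed

text \<open>No outward dart separates two consecutive inward ones, so both climbs turn to the same
  dart.\<close>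

lemma summit_step:
  assumes "x \<in> outward" "z \<in> outward" "\<sigma> (\<alpha> x) = \<alpha> z"
  shows "summit x = summit z"
proof (rule summit_cong[OF assms(1,2)])
  have x: "\<alpha> x \<in> D" using assms outward_dart by simp
  have n: "\<alpha> z \<notin> outward" using assms flip_outward_iff outward_dart by simp
  show "orb \<sigma> (\<alpha> x) = orb \<sigma> (\<alpha> z)" using s.orb_apply_eq[OF x] assms by simp
  fix y assume "y \<in> orb \<sigma> (\<alpha> x)" "y \<in> outward"
  then show "next_out (\<alpha> x) = next_out (\<alpha> z)" using s.next_in_miss[OF x, of y outward] assms n by simp
qed

lemma summit_climb:
  assumes "x \<in> outward" "z \<in> outward" "\<alpha> x \<in> orb \<sigma> z" "next_out (\<alpha> x) = next_out z"
  shows "summit x = summit z"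
proof -
  have "z \<in> orb \<sigma> (\<alpha> x)" using s.orb_sym[of z] assms outward_dart by simp
  then show ?thesis using assms pre_eqI by (auto simp: summit.simps[of x])
qed

text \<open>If an inward dart lies between \<open>x\<close> and the next outward dart
  \<open>y\<close>, the climb from \<open>z\<close> turns to \<open>x\<close>. Otherwise
  \<open>\<alpha> x\<close> precedes \<open>y\<close> on the face of \<open>y\<close>; as it is
  higher than \<open>y\<close>, the case \<open>up\<close> is impossible, and in the case
  \<open>conf\<close> the darts \<open>z\<close> and \<open>x\<close> arrive next to each other at
  one vertex.\<close>

lemma summit_contour:
  assumes x: "x \<in> outward"
  shows "summit (contour x) = summit x"
proof -
  have xD: "x \<in> D" using x outward_dart by simp
  define y where "y = next_out x"
  have y: "y \<in> outward" "y \<in> orb \<sigma> x" using s.next_in_mem[OF xD orb_self x] by (auto simp: y_def)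
  have yD: "y \<in> D" using y outward_dart by simp
  define z where "z = mate y"
  have z: "z \<in> outward" "z \<in> D" using mate_props(1)[OF y(1)] outward_dart by (auto simp: z_def)
  have contour: "contour x = z" by (simp add: contour_def y_def z_def)
  show ?thesis
  proof (cases "\<sigma> x \<in> outward")
    case False
    have xs: "x \<in> orb \<sigma> (\<sigma> x)" using s.orb_sym[OF xD orb_apply] .
    obtain e where e: "e \<in> orb \<sigma> (\<sigma> x)" "e \<in> D" "e \<notin> outward" "\<sigma> e = next_out (\<sigma> x)"
      using before_next_out[OF s_mem[OF xD] False xs x] by blast
    have ey: "\<sigma> e = y" using e s.next_in_miss[OF xD orb_self x False] by (simp add: y_def)
    have "z = \<alpha> e" using mate_after[of e] e ey y by (simp add: z_def)
    then have "\<alpha> z = e" using e by simp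
    moreover have "e \<in> orb \<sigma> x" using e s.orb_apply_eq[OF xD] by simp
    moreover have "next_out e = next_out x" using next_in_hit[of \<sigma> e outward] ey y by (simp add: y_def)
    ultimately show ?thesis using summit_climb[OF z(1) x] contour by simp
  next
    case True
    then have ys: "\<sigma> x = y" by (simp add: y_def next_in_hit)
    have f3: "\<phi> (\<phi> (\<phi> y)) = \<alpha> x" using fff_s[OF xD] ys by simp
    have axP: "\<alpha> x \<notin> outward" using x flip_outward_iff xD by simp
    have dx: "d (\<alpha> x) = Suc (d y)" using x ys[symmetric] xD by (simp add: outward_def)
    from y(1) show ?thesis
    proof (cases rule: mate_cases)
      case conf
      then have "\<sigma> (\<alpha> z) = \<alpha> x" using f3 by (simp add: z_def f_def)
      then show ?thesis using summit_step[OF z(1) x] contour by simp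
    next
      case low
      \<comment> \<open>\<open>y2\<close> starts at the top corner of the face. Its reverse
        \<open>q\<close> arrives there next to \<open>z\<close>, and it is also the dart to which
        the climb from \<open>x\<close> turns.\<close>
      define y2 where "y2 = \<phi> (\<phi> y)"
      have y2: "y2 \<in> D" using yD by (simp add: y2_def)
      have y2P: "y2 \<notin> outward" using outward_iff[OF y2] low by (simp add: y2_def)
      define q where "q = \<alpha> y2"
      have q: "q \<in> outward" "q \<in> D" "\<alpha> q = y2" using y2 y2P by (auto simp: q_def flip_outward_iff)
      have "\<sigma> (\<alpha> z) = \<alpha> q" using low q by (simp add: z_def y2_def f_def)
      then have 1: "summit z = summit q" using summit_step[OF z(1) q(1)] by simp
      have sq: "\<sigma> q = \<alpha> x" using f3 by (simp add: y2_def q_def f_def)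
      then have "next_out q = next_out (\<alpha> x)" using s.next_in_miss[OF q(2) orb_self q(1)] axP by simp
      moreover have "\<alpha> x \<in> orb \<sigma> q" using sq orb_apply[of \<sigma> q] by simp
      ultimately have "summit x = summit q" using summit_climb[OF x q(1)] by simp
      then show ?thesis using 1 contour by simp
    next
      case up
      then have "d y = Suc (d (\<alpha> x))" using f3 by simp
      then show ?thesis using dx by linarith
    qed
  qed
qed

text \<open>A climb never leaves the contour orbit, by \<open>contour_chain_next\<close>; so the
  orbit of \<open>x\<close> can be read off at the darts around its summit.\<close>

lemma summit_props:
  "x \<in> outward \<Longrightarrow> summit x \<in> locmax \<and> (\<exists>e\<in>summit x. x \<in> orb contour (\<alpha> e))"
proof (induction x rule: summit.induct)
  case (1 x)
  then have xD: "x \<in> D" "\<alpha> x \<in> D" "\<alpha> x \<notin> outward" using outward_dart flip_outward_iff by auto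
  show ?case
  proof (cases "\<exists>y\<in>outward. y \<in> orb \<sigma> (\<alpha> x)")
    case True
    then obtain y where y: "y \<in> orb \<sigma> (\<alpha> x)" "y \<in> outward" by auto
    let ?p = "pre (\<alpha> x)"
    have p: "?p \<in> outward" "next_out ?p = next_out (\<alpha> x)" using pre_props[OF xD(2) y] by auto
    have IH: "summit ?p \<in> locmax \<and> (\<exists>e\<in>summit ?p. ?p \<in> orb contour (\<alpha> e))" using 1 True p by blast
    have s: "summit x = summit ?p" using 1 True by (simp add: summit.simps[of x])
    have "x \<in> orb contour (contour ?p)"
      using contour_chain_next[OF xD(2) y xD(3)] xD p by (simp add: contour_def)
    then have "x \<in> orb contour ?p" by (rule orb_trans[OF orb_apply])
    then show ?thesis using IH s orb_trans by metis
  next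
    case False
    then have "summit x = orb \<sigma> (\<alpha> x)" by (simp add: summit.simps[of x])
    moreover have "orb \<sigma> (\<alpha> x) \<in> locmax"
      using False xD by (auto simp: locmax_def vertices_def)
    moreover have "x \<in> orb contour (\<alpha> (\<alpha> x))" using xD orb_self by simp
    ultimately show ?thesis using orb_self by metis
  qed
qed

text \<open>All darts around a local maximum are inward, so \<open>contour_chain\<close> applies to
  every consecutive pair.\<close>

lemma locmax_orb:
  assumes "v \<in> locmax" "e \<in> v" "e' \<in> v"
  shows "orb contour (\<alpha> e) = orb contour (\<alpha> e')" "\<alpha> e \<in> outward" "summit (\<alpha> e) = v"
proof -
  obtain z where z: "z \<in> D" "v = orb \<sigma> z" using assms by (auto simp: locmax_def vertices_def)
  have vP: "v \<inter> outward = {}" using assms by (simp add: locmax_def)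
  have vD: "v \<subseteq> D" using s.orb_sub z by simp
  have *: "orb contour (\<alpha> e) = orb contour (\<alpha> z)" if "e \<in> v" for e
    using that unfolding z
  proof (induction rule: orb_induct)
    case (step y)
    then have y: "y \<in> D" "y \<notin> outward" "\<sigma> y \<notin> outward" using vD vP z orb_step[of y \<sigma> z] by auto
    then have "orb contour (\<alpha> y) = orb contour (\<alpha> (\<sigma> y))"
      using p.orb_eq[OF _ contour_chain[OF y]] flip_outward_iff[of "\<sigma> y"] by simp
    then show ?case using step by simp
  qed simp
  show "orb contour (\<alpha> e) = orb contour (\<alpha> e')" using * assms by simp
  have e: "e \<in> D" "e \<notin> outward" using vD vP assms by auto
  then show "\<alpha> e \<in> outward" using flip_outward_iff by simp
  have "orb \<sigma> e = v" using s.orb_eq z assms by simp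
  then show "summit (\<alpha> e) = v" using e vP by (auto simp: summit.simps[of "\<alpha> e"])
qed

lemma card_contour_orbs: "card (orb contour ` outward) = card locmax"
proof -
  have "summit x = summit y \<longleftrightarrow> orb contour x = orb contour y" if xy: "x \<in> outward" "y \<in> outward" for x y
  proof
    assume eq: "summit x = summit y"
    obtain e where e: "e \<in> summit x" "x \<in> orb contour (\<alpha> e)" using summit_props xy by blast
    obtain e' where e': "e' \<in> summit x" "y \<in> orb contour (\<alpha> e')" using summit_props xy eq by metis
    have l: "summit x \<in> locmax" using summit_props xy by blast
    have "orb contour x = orb contour (\<alpha> e)" "orb contour y = orb contour (\<alpha> e')"
      using p.orb_eq locmax_orb(2)[OF l] e e' by blast+
    then show "orb contour x = orb contour y" using locmax_orb(1)[OF l e(1) e'(1)] by simp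
  next
    assume "orb contour x = orb contour y"
    then have "y \<in> orb contour x" using orb_self by metis
    then show "summit x = summit y" using p.orb_inv[of x summit y] summit_contour xy by simp
  qed
  then have "card (summit ` outward) = card (orb contour ` outward)" by (rule card_image_eq_iff)
  moreover have "summit ` outward = locmax"
  proof
    show "summit ` outward \<subseteq> locmax" using summit_props by auto
    show "locmax \<subseteq> summit ` outward"
    proof
      fix v assume v: "v \<in> locmax"
      then obtain z where "v = orb \<sigma> z" by (auto simp: locmax_def vertices_def)
      then have "z \<in> v" using orb_self by metis
      then show "v \<in> summit ` outward" using locmax_orb[OF v] by (metis image_eqI)
    qed
  qed
  ultimately show ?thesis by simp
qed

lemma card_faces_Phi: "card (faces (Phi Q)) = card locmax"
proof -
  have "orb (faceperm (Phi Q)) x = orb (next_out \<circ> mate) x" if "x \<in> outward" for x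
    by (rule orb_cong[of outward]) (use that Phi.f_mem in \<open>auto simp: faceperm_def\<close>)
  then have "faces (Phi Q) = orb (next_out \<circ> mate) ` outward" by (simp add: faces_def)
  then have "card (faces (Phi Q)) = card (orb (mate \<circ> next_out) ` outward)"
    using card_orbs_comp[OF mate_bij next_out_bij p.fin] by simp
  moreover have "mate \<circ> next_out = contour" by (auto simp: contour_def)
  ultimately show ?thesis using card_contour_orbs by simp
qed

lemma Phi_nfaces: "nfaces (Phi Q) = nlocmax Q"
  by (simp add: nfaces_def nlocmax_eq card_faces_Phi)

lemma Phi_euler:
  "int (card (vertices (Phi Q))) - int (card (edges (Phi Q))) + int (card (faces (Phi Q))) =
   int (card (vertices Q)) - int (card (edges Q)) + int (card (faces Q))"
proof -
  have "card (edges Q) = 2 * card (faces Q)"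
    using card_edges card_outward Phi.card_edges Phi_nedges by (simp add: nedges_def nfaces_def)
  then show ?thesis
    using card_vertices card_faces_Phi Phi_nedges by (simp add: nedges_def nfaces_def)
qed

lemma outward_nonempty: "outward \<noteq> {}"
  using ne card_outward s.fin by (auto simp: card_eq_0_iff)

text \<open>Left to right it shows that the prescription preserves planarity backwards, which makes
  the rebuilt quadrangulation planar; right to left it puts the image of a quadrangulation into
  \<open>MSet\<close>.\<close>

lemma Phi_planar: "planar_map (Phi Q) \<longleftrightarrow> planar_map Q"
  using Phi_cmap cmap outward_nonempty ne Phi_connected conn Phi_euler by (simp add: planar_map_def)

end

section \<open>Injectivity\<close>

locale cmap_iso = M: combinatorial_map M + M': combinatorial_map M' for M :: "'a cmap_scheme" and M' :: "'b cmap_scheme" +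
  fixes h :: "nat \<Rightarrow> nat"
  assumes h_bij: "bij_betw h (darts M) (darts M')"
    and h_a: "\<And>x. x \<in> darts M \<Longrightarrow> h (edge_inv M x) = edge_inv M' (h x)"
    and h_s: "\<And>x. x \<in> darts M \<Longrightarrow> h (vert_rot M x) = vert_rot M' (h x)"
begin

lemma h_mem: "x \<in> darts M \<Longrightarrow> h x \<in> darts M'"
  using h_bij by (auto dest: bij_betwE)

lemma h_inj: "x \<in> darts M \<Longrightarrow> y \<in> darts M \<Longrightarrow> h x = h y \<longleftrightarrow> x = y"
  using h_bij by (auto simp: bij_betw_def dest: inj_onD)

lemma h_f: "x \<in> darts M \<Longrightarrow> h (faceperm M x) = faceperm M' (h x)"
  by (simp add: faceperm_def h_a h_s)

lemma h_vof: "x \<in> darts M \<Longrightarrow> vertex_of M' (h x) = h ` vertex_of M x"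
  unfolding vertex_of_def by (rule orb_hom[of "darts M"]) (simp_all add: h_s)

lemma card_vertices_iso: "card (vertices M') = card (vertices M)"
  unfolding vertices_def by (rule card_orbs_iso[OF h_bij]) (simp_all add: h_s)

lemma card_edges_iso: "card (edges M') = card (edges M)"
  unfolding edges_def by (rule card_orbs_iso[OF h_bij]) (simp_all add: h_a)

lemma card_faces_iso: "card (faces M') = card (faces M)"
  unfolding faces_def by (rule card_orbs_iso[OF h_bij]) (simp_all add: h_f)

text \<open>Certificates pull back along an isomorphism; with \<open>geodesic_unique\<close> this
  preserves distances without transporting any path.\<close>

lemma geodesic_iso:
  assumes g: "geodesic M' (h ` u) d" and u: "u \<in> vertices M"
  shows "geodesic M u (d \<circ> h)"
  unfolding geodesic_def
proof (intro conjI ballI impI)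
  fix x assume x: "x \<in> darts M"
  note hx = h_mem[OF x]
  show "(d \<circ> h) (vert_rot M x) = (d \<circ> h) x" using g x hx by (simp add: h_s geodesic_def)
  show "(d \<circ> h) (edge_inv M x) \<le> Suc ((d \<circ> h) x)" using g x hx by (simp add: h_a geodesic_def)
  obtain z where z: "z \<in> darts M" "u = vertex_of M z" using u by (auto simp: M.vertices_alt)
  have "h ` vertex_of M x = h ` u \<longleftrightarrow> vertex_of M x = u"
    using inj_on_image_eq_iff[of h "darts M"] h_bij M.vof_sub[OF x] M.vof_sub[OF z(1)] z
    by (simp add: bij_betw_def)
  then show "((d \<circ> h) x = 0) = (vertex_of M x = u)"
    using g hx h_vof[OF x] by (simp add: geodesic_def)
  assume "0 < (d \<circ> h) x"
  then obtain y' where y': "y' \<in> vertex_of M' (h x)" "Suc (d (edge_inv M' y')) = d (h x)"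
    using g hx unfolding geodesic_def by fastforce
  then obtain y where y: "y \<in> vertex_of M x" "y' = h y" using h_vof[OF x] by auto
  then have "y \<in> darts M" using M.vof_sub[OF x] by auto
  then show "\<exists>y\<in>vertex_of M x. Suc ((d \<circ> h) (edge_inv M y)) = (d \<circ> h) x"
    using y y' by (intro bexI[of _ y]) (simp_all add: h_a)
qed

lemma vdist_iso:
  assumes "connected_map M'" "u \<in> vertices M" "x \<in> darts M"
  shows "vdist M' (h ` u) (vertex_of M' (h x)) = vdist M u (vertex_of M x)"
proof -
  obtain z where "z \<in> darts M" "u = vertex_of M z" using assms(2) by (auto simp: M.vertices_alt)
  then have "h ` u = vertex_of M' (h z)" "h z \<in> darts M'" using h_vof h_mem by simp_all
  then have "h ` u \<in> vertices M'" by (simp add: M'.vertices_alt)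
  then have "geodesic M' (h ` u) (\<lambda>x. vdist M' (h ` u) (vertex_of M' x))"
    by (rule M'.geodesic_vdist[OF assms(1)])
  from M.geodesic_unique[OF geodesic_iso[OF this assms(2)] assms(3)] show ?thesis by simp
qed

end

section \<open>The root edge and the root corner\<close>

locale rooted_bipartite_quad = bipartite_quad +
  assumes root: "qroot Q \<in> edges Q"
begin

abbreviation "rt \<equiv> qroot_dart Q"

lemma rt_props: "rt \<in> outward" "qroot Q = {rt, \<alpha> rt}"
  and rt_unique: "r \<in> outward \<Longrightarrow> r \<in> qroot Q \<Longrightarrow> r = rt"
proof -
  have up: "d x < d (\<alpha> x) \<longleftrightarrow> x \<in> outward" if "x \<in> D" for x
    using step[OF that] inward_iff[OF that] by linarith
  obtain r0 where r0: "r0 \<in> D" "qroot Q = {r0, \<alpha> r0}"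
    using root by (auto simp: edges_def orb_a)
  define r where "r = (if r0 \<in> outward then r0 else \<alpha> r0)"
  have r: "r \<in> outward" "qroot Q = {r, \<alpha> r}" using r0 flip_outward_iff[OF r0(1)] by (auto simp: r_def)
  then have rD: "r \<in> D" "\<alpha> r \<notin> outward" using outward_dart flip_outward_iff by auto
  \<comment> \<open>Exactly one dart of the root edge is outward, so the choice in
    \<open>qroot_dart\<close> has a single candidate.\<close>
  have "r' \<in> qroot Q \<and> d r' < d (\<alpha> r') \<longleftrightarrow> r' = r" for r'
    using r rD up[of r] up[of "\<alpha> r"] by auto
  then have "rt = r" unfolding qroot_dart_def by simp
  then show "rt \<in> outward" "qroot Q = {rt, \<alpha> rt}" "r \<in> outward \<Longrightarrow> r \<in> qroot Q \<Longrightarrow> r = rt" for r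
    using r rD by auto
qed

lemma rootd_outward: "rootd (Phi Q) \<in> outward"
  using next_out_bij rt_props(1) by (auto simp: Phi_rootd dest: bij_betwE)

lemma Phi_root_dist: "mroot_dist (Phi Q) = qroot_dist Q"
proof -
  have rD: "rt \<in> D" using rt_props outward_dart by simp
  have "next_out rt \<in> orb \<sigma> rt" using s.next_in_mem(2)[OF rD orb_self rt_props(1)] .
  then have "d (next_out rt) = d rt" using d_orb[OF rD] by simp
  then show ?thesis using Phi_dist[OF rootd_outward] by (simp add: mroot_dist_def qroot_dist_def Phi_rootd)
qed

end

lemma QSet_rooted_bipartite_quad:
  assumes "Q \<in> QSet"
  shows "rooted_bipartite_quad Q"
proof -
  have pl: "planar_map Q" and quad: "\<And>x. x \<in> darts Q \<Longrightarrow> card (orb (faceperm Q) x) = 4"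
    and org: "qorg Q \<in> vertices Q" and root: "qroot Q \<in> edges Q"
    using assms by (auto simp: QSet_def is_quadrangulation_def)
  interpret combinatorial_map Q using pl by unfold_locales (simp add: planar_map_def)
  have conn: "connected_map Q" using pl by (simp add: planar_map_def)
  have ev: "even (card (orb \<phi> x))" if "x \<in> D" for x using quad[OF that] by simp
  obtain c :: "nat \<Rightarrow> bool" where "(\<forall>x\<in>D. c (\<sigma> x) = c x) \<and> (\<forall>x\<in>D. c (\<alpha> x) \<noteq> c x)"
    using bipartite[OF pl ev] ..
  then have c: "\<And>x. x \<in> D \<Longrightarrow> c (\<sigma> x) = c x" "\<And>x. x \<in> D \<Longrightarrow> c (\<alpha> x) \<noteq> c x" by auto
  have geo: "geodesic Q (qorg Q) (qd Q)"
    using geodesic_vdist[OF conn org] by (simp add: qd_def[abs_def])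
  obtain z where z: "z \<in> D" "qorg Q = vertex_of Q z" using org by (auto simp: vertices_alt)
  have cv: "c y = c x" if "x \<in> D" "y \<in> vertex_of Q x" for x y
    using s.orb_inv[of x c y] that c by (simp add: vertex_of_def)
  \<comment> \<open>Along a descent to the origin the colour and the parity of the distance change
    together. Neighbours have different colours, hence different distances.\<close>
  have par: "even (qd Q x) \<longleftrightarrow> c x = c z" if "x \<in> D" for x using that
  proof (induction "qd Q x" arbitrary: x)
    case 0
    then have "vertex_of Q x = vertex_of Q z" using geo z by (simp add: geodesic_def)
    then have "x \<in> vertex_of Q z" using vof_self[of x] by simp
    then have "c x = c z" by (rule cv[OF z(1)])
    then show ?case using 0 by simp
  next
    case (Suc n)
    then obtain y where y: "y \<in> vertex_of Q x" "Suc (qd Q (\<alpha> y)) = qd Q x"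
      using geo unfolding geodesic_def by (metis zero_less_Suc)
    have yD: "y \<in> D" using y vof_sub[OF Suc(3)] by auto
    have n: "n = qd Q (\<alpha> y)" using Suc(2) y(2) by simp
    have "even (qd Q (\<alpha> y)) \<longleftrightarrow> c (\<alpha> y) = c z" using Suc(1)[OF n] yD by simp
    moreover have "c y = c x" using cv[OF Suc(3) y(1)] .
    moreover have "even (qd Q x) \<longleftrightarrow> odd (qd Q (\<alpha> y))" using y(2) by (metis even_Suc)
    ultimately show ?case using c(2)[OF yD] by auto
  qed
  have "qd Q (\<alpha> x) = Suc (qd Q x) \<or> qd Q x = Suc (qd Q (\<alpha> x))" if x: "x \<in> D" for x
  proof -
    have "qd Q (\<alpha> x) \<le> Suc (qd Q x)" using geo x by (simp add: geodesic_def)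
    moreover have "qd Q (\<alpha> (\<alpha> x)) \<le> Suc (qd Q (\<alpha> x))" using geo a_mem[OF x] unfolding geodesic_def by blast
    moreover have "even (qd Q (\<alpha> x)) \<noteq> even (qd Q x)" using par[OF x] par[OF a_mem[OF x]] c(2)[OF x] by auto
    then have "qd Q (\<alpha> x) \<noteq> qd Q x" by auto
    ultimately show ?thesis using x by (simp, linarith)
  qed
  then show ?thesis
    using pl conn org quad root by unfold_locales (auto simp: planar_map_def)
qed

lemma MSet_combinatorial_map: "M \<in> MSet \<Longrightarrow> combinatorial_map M"
  by (simp add: MSet_def planar_map_def combinatorial_map_def)

lemma Phi_MSet: assumes "Q \<in> QSet" shows "Phi Q \<in> MSet"
proof -
  interpret rooted_bipartite_quad Q by (rule QSet_rooted_bipartite_quad[OF assms])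
  have "planar_map Q" using assms by (simp add: QSet_def is_quadrangulation_def)
  then show ?thesis using Phi_planar Phi_org_vertex rootd_outward by (simp add: MSet_def)
qed

context bipartite_quad
begin

section \<open>Recovering the rotation from the image\<close>

lemma rot_mate_low:
  assumes "x \<in> outward" "d (mate x) = Suc (d x)" shows "\<sigma> (\<alpha> x) = mate x"
  using assms(1) by (cases rule: mate_cases) (use assms(2) in \<open>simp_all add: f_def\<close>)

text \<open>In a confluent face the dart after \<open>\<alpha> x\<close> is inward, and its reverse
  is immediately followed by \<open>mate x\<close>; so that reverse is the predecessor of
  \<open>mate x\<close> in the image.\<close>

lemma rot_mate_conf:
  assumes "x \<in> outward" "d (mate x) = d x"
  obtains q where "q \<in> outward" "next_out q = mate x" "\<sigma> (\<alpha> x) = \<alpha> q"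
  using assms(1)
proof (cases rule: mate_cases)
  case conf
  have x: "x \<in> D" using assms outward_dart by simp
  have "\<phi> x \<notin> outward" using outward_iff[of "\<phi> x"] x conf by simp
  then have "\<alpha> (\<phi> x) \<in> outward" using flip_outward_iff x by simp
  moreover have "\<sigma> (\<alpha> (\<phi> x)) = mate x" using conf by (simp add: f_def)
  then have "next_out (\<alpha> (\<phi> x)) = mate x" using next_in_hit mate_props(1)[OF assms(1)] by metis
  moreover have "\<sigma> (\<alpha> x) = \<alpha> (\<alpha> (\<phi> x))" using x by (simp add: f_def)
  ultimately show ?thesis by (rule that)
next
  case low
  then have "d (mate x) = Suc (d x)" by simp
  then show ?thesis using assms(2) by linarith
next
  case up
  then have "d x = Suc (d (mate x))" by simp
  then show ?thesis using assms(2) by linarith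
qed

text \<open>Two inward darts separate \<open>x\<close> from \<open>mate x\<close> on the face. The
  image identifies the second as the reverse of the predecessor \<open>q\<close> of
  \<open>mate x\<close>; the first is the reverse of \<open>u\<close>, which is found only by
  undoing the rotation at \<open>\<alpha> q\<close>. As \<open>u\<close> is lower than
  \<open>\<alpha> x\<close>, an induction on heights can supply this.\<close>

lemma rot_mate_up:
  assumes "x \<in> outward" "d x = Suc (d (mate x))"
  obtains q u where "q \<in> outward" "next_out q = mate x" "u \<in> outward" "\<sigma> (\<alpha> x) = \<alpha> u" "\<sigma> u = \<alpha> q" "d u = d x"
  using assms(1)
proof (cases rule: mate_cases)
  case up
  have x: "x \<in> D" using assms outward_dart by simp
  have n: "\<phi> x \<notin> outward" "\<phi> (\<phi> x) \<notin> outward" using outward_iff[of "\<phi> x"] outward_iff[of "\<phi> (\<phi> x)"] x up by auto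
  then have "\<alpha> (\<phi> x) \<in> outward" "\<alpha> (\<phi> (\<phi> x)) \<in> outward" using flip_outward_iff x by simp_all
  moreover have "\<sigma> (\<alpha> (\<phi> (\<phi> x))) = mate x" using up by (simp add: f_def)
  then have "next_out (\<alpha> (\<phi> (\<phi> x))) = mate x" using next_in_hit mate_props(1)[OF assms(1)] by metis
  moreover have "\<sigma> (\<alpha> x) = \<alpha> (\<alpha> (\<phi> x))" "\<sigma> (\<alpha> (\<phi> x)) = \<alpha> (\<alpha> (\<phi> (\<phi> x)))" using x by (simp_all add: f_def)
  moreover have "d (\<alpha> (\<phi> x)) = d x" using inward_iff[of "\<phi> x"] n x up(1) by simp
  ultimately show ?thesis by (intro that[of "\<alpha> (\<phi> (\<phi> x))" "\<alpha> (\<phi> x)"])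
next
  case conf
  then have "d (mate x) = d x" by simp
  then show ?thesis using assms(2) by linarith
next
  case low
  then have "d (mate x) = Suc (d x)" by simp
  then show ?thesis using assms(2) by linarith
qed

lemma next_out_inj: "x \<in> outward \<Longrightarrow> y \<in> outward \<Longrightarrow> next_out x = next_out y \<longleftrightarrow> x = y"
  using next_out_bij by (auto simp: bij_betw_def dest: inj_onD)

lemma next_out_outward: "x \<in> outward \<Longrightarrow> next_out x \<in> outward"
  using next_out_bij by (auto dest: bij_betwE)

end

section \<open>Isomorphic quadrangulations and isomorphic images\<close>

locale two_quads = A: rooted_bipartite_quad Q + B: rooted_bipartite_quad Q' for Q Q'
begin

lemma Phi_respects_iso:
  assumes "iso_quad Q Q'"
  shows "iso_map (Phi Q) (Phi Q')"
proof -
  obtain f where "bij_betw f (darts Q) (darts Q')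
     \<and> (\<forall>x\<in>darts Q. f (edge_inv Q x) = edge_inv Q' (f x) \<and> f (vert_rot Q x) = vert_rot Q' (f x))
     \<and> f ` qorg Q = qorg Q' \<and> f ` qroot Q = qroot Q'"
    using assms unfolding iso_quad_def ..
  then have f: "bij_betw f (darts Q) (darts Q')"
    "\<And>x. x \<in> darts Q \<Longrightarrow> f (edge_inv Q x) = edge_inv Q' (f x)"
    "\<And>x. x \<in> darts Q \<Longrightarrow> f (vert_rot Q x) = vert_rot Q' (f x)"
    "f ` qorg Q = qorg Q'" "f ` qroot Q = qroot Q'"
    by auto
  interpret cmap_iso Q Q' f using f by unfold_locales
  have d: "qd Q' (f x) = qd Q x" if "x \<in> darts Q" for x
    using vdist_iso[OF B.conn A.org that] f(4) by (simp add: qd_def)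
  have outward: "f x \<in> B.outward \<longleftrightarrow> x \<in> A.outward" if "x \<in> darts Q" for x
    using that h_mem[OF that] d f(2)[symmetric] by (simp add: A.outward_def B.outward_def)
  have "bij_betw f A.outward B.outward"
    unfolding bij_betw_def
  proof
    show "inj_on f A.outward" using f(1) A.outward_subset by (auto simp: bij_betw_def intro: inj_on_subset)
    show "f ` A.outward = B.outward"
    proof
      show "f ` A.outward \<subseteq> B.outward" using outward A.outward_dart by auto
      show "B.outward \<subseteq> f ` A.outward"
      proof
        fix y assume y: "y \<in> B.outward"
        then have "y \<in> f ` darts Q" using f(1) B.outward_dart by (simp add: bij_betw_def)
        then show "y \<in> f ` A.outward" using outward y by auto
      qed
    qed
  qed
  moreover have mate: "f (A.mate x) = B.mate (f x)" if "x \<in> A.outward" for x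
    using A.outward_dart[OF that] by (simp add: A.mate_def B.mate_def h_f[symmetric] d)
  moreover have next_out: "f (A.next_out x) = B.next_out (f x)" if "x \<in> A.outward" for x
    by (rule next_in_hom[of "darts Q", symmetric]) (use A.outward_dart[OF that] outward f in auto)
  moreover have "f ` org (Phi Q) = org (Phi Q')"
  proof -
    have "qorg Q \<inter> A.outward = qorg Q" "qorg Q' \<inter> B.outward = qorg Q'" using A.org_outward B.org_outward by auto
    then show ?thesis using f(4) by (simp add: A.Phi_org B.Phi_org)
  qed
  moreover have "f A.rt = B.rt"
  proof (rule B.rt_unique)
    show "f A.rt \<in> B.outward" using outward A.rt_props A.outward_dart by simp
    show "f A.rt \<in> qroot Q'" using f(5) A.rt_props(2) by auto
  qed
  then have "f (rootd (Phi Q)) = rootd (Phi Q')"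
    using next_out[OF A.rt_props(1)] by (simp add: A.Phi_rootd B.Phi_rootd)
  moreover have "f x \<in> B.outward" if "x \<in> A.outward" for x using outward that A.outward_dart by simp
  ultimately show ?thesis unfolding iso_map_def by (intro exI[of _ f]) simp
qed

text \<open>The given isomorphism acts on outward darts, and compatibility with reversal forces its
  extension \<open>F\<close>. That \<open>F\<close> respects the rotation is shown height by height,
  for inward darts before outward ones.\<close>

lemma Phi_reflects_iso:
  assumes "iso_map (Phi Q) (Phi Q')"
  shows "iso_quad Q Q'"
proof -
  obtain f where "bij_betw f (darts (Phi Q)) (darts (Phi Q'))
     \<and> (\<forall>x\<in>darts (Phi Q). f (edge_inv (Phi Q) x) = edge_inv (Phi Q') (f x)
          \<and> f (vert_rot (Phi Q) x) = vert_rot (Phi Q') (f x))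
     \<and> f ` org (Phi Q) = org (Phi Q') \<and> f (rootd (Phi Q)) = rootd (Phi Q')"
    using assms unfolding iso_map_def ..
  then have f0: "bij_betw f (darts (Phi Q)) (darts (Phi Q'))"
    "\<And>x. x \<in> darts (Phi Q) \<Longrightarrow> f (edge_inv (Phi Q) x) = edge_inv (Phi Q') (f x)"
    "\<And>x. x \<in> darts (Phi Q) \<Longrightarrow> f (vert_rot (Phi Q) x) = vert_rot (Phi Q') (f x)"
    "f ` org (Phi Q) = org (Phi Q')" "f (rootd (Phi Q)) = rootd (Phi Q')"
    by auto
  interpret h: cmap_iso "Phi Q" "Phi Q'" f using f0 by unfold_locales
  have f_outward: "f x \<in> B.outward" if "x \<in> A.outward" for x using h.h_mem that by simp
  have f_inj: "f x = f y \<longleftrightarrow> x = y" if "x \<in> A.outward" "y \<in> A.outward" for x y using h.h_inj that by simp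
  have f_mate: "f (A.mate x) = B.mate (f x)" if "x \<in> A.outward" for x using f0(2)[of x] that f_outward by simp
  have f_next_out: "f (A.next_out x) = B.next_out (f x)" if "x \<in> A.outward" for x using f0(3)[of x] that by simp
  have f_d: "qd Q' (f x) = qd Q x" if "x \<in> A.outward" for x
    using h.vdist_iso[OF B.Phi_connected A.Phi_org_vertex, of x] that f_outward f0(4)
    by (simp add: A.Phi_dist B.Phi_dist)
  have f_surj: "\<exists>x\<in>A.outward. y = f x" if "y \<in> B.outward" for y
    using f0(1) that by (auto simp: bij_betw_def)
  define F where "F x = (if x \<in> A.outward then f x else edge_inv Q' (f (edge_inv Q x)))" for x
  have F_outward: "F x = f x" if "x \<in> A.outward" for x using that by (simp add: F_def)
  have F_a: "F (edge_inv Q x) = edge_inv Q' (f x)" if "x \<in> A.outward" for x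
    using that A.flip_outward_iff A.outward_dart by (simp add: F_def)
  have F_mem: "F x \<in> darts Q' \<and> (F x \<in> B.outward \<longleftrightarrow> x \<in> A.outward) \<and> F (edge_inv Q x) = edge_inv Q' (F x)
    \<and> qd Q' (F x) = qd Q x" if x: "x \<in> darts Q" for x
  proof (cases "x \<in> A.outward")
    case True
    then show ?thesis using f_outward[OF True] B.outward_dart F_a f_d by (simp add: F_outward)
  next
    case False
    then have ax: "edge_inv Q x \<in> A.outward" using A.flip_outward_iff x by simp
    then have fa: "f (edge_inv Q x) \<in> B.outward" "f (edge_inv Q x) \<in> darts Q'" using f_outward B.outward_dart by auto
    have "qd Q x = Suc (qd Q (edge_inv Q x))" using A.inward_iff[OF x] False by simp
    moreover have "qd Q' (edge_inv Q' (f (edge_inv Q x))) = Suc (qd Q' (f (edge_inv Q x)))"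
      using fa(1) by (simp add: B.outward_def)
    ultimately show ?thesis using False ax fa f_d[OF ax] B.flip_outward_iff[OF fa(2)] by (simp add: F_def)
  qed
  have F_bij: "bij_betw F (darts Q) (darts Q')"
    unfolding bij_betw_def
  proof
    show "inj_on F (darts Q)"
    proof (rule inj_onI)
      fix x y assume xy: "x \<in> darts Q" "y \<in> darts Q" "F x = F y"
      show "x = y"
      proof (cases "x \<in> A.outward")
        case True
        then have "y \<in> A.outward" using F_mem xy by metis
        then show ?thesis using True xy f_inj F_outward by simp
      next
        case False
        then have "y \<notin> A.outward" using F_mem xy by metis
        then have outward: "edge_inv Q x \<in> A.outward" "edge_inv Q y \<in> A.outward" using False xy A.flip_outward_iff by auto
        have "f (edge_inv Q x) = f (edge_inv Q y)"
          using F_mem[OF xy(1)] F_mem[OF xy(2)] xy(3) outward F_outward by metis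
        then have "edge_inv Q x = edge_inv Q y" using f_inj outward by simp
        then show ?thesis using xy A.a_a by metis
      qed
    qed
    show "F ` darts Q = darts Q'"
    proof
      show "F ` darts Q \<subseteq> darts Q'" using F_mem by auto
      show "darts Q' \<subseteq> F ` darts Q"
      proof
        fix y assume y: "y \<in> darts Q'"
        show "y \<in> F ` darts Q"
        proof (cases "y \<in> B.outward")
          case True
          then obtain x where "x \<in> A.outward" "y = f x" using f_surj by auto
          then have "y = F x" "x \<in> darts Q" using F_outward A.outward_dart by auto
          then show ?thesis by (rule image_eqI)
        next
          case False
          then obtain x where x: "x \<in> A.outward" "edge_inv Q' y = f x" using f_surj B.flip_outward_iff y by metis
          then have "F (edge_inv Q x) = y" using F_a[OF x(1)] y by (metis B.a_a)
          then show ?thesis using x A.outward_dart A.a_mem by (metis image_eqI)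
        qed
      qed
    qed
  qed
  have F_inj: "F x = F y \<longleftrightarrow> x = y" if "x \<in> darts Q" "y \<in> darts Q" for x y
    using F_bij that by (auto simp: bij_betw_def dest: inj_onD)
  have F_surj: "\<exists>x\<in>darts Q. F x = y" if "y \<in> darts Q'" for y
    using F_bij that unfolding bij_betw_def by (metis imageE)
  have main: "F (vert_rot Q x) = vert_rot Q' (F x)" if "x \<in> darts Q" for x
    using that
  proof (induction "qd Q x" arbitrary: x rule: less_induct)
    case (less x0)
    let ?m = "qd Q x0"
    \<comment> \<open>Only the third case, where the new edge descends from \<open>x\<close>, uses
      the induction hypothesis.\<close>
    have s1: "F (vert_rot Q e) = vert_rot Q' (F e)"
      if e: "e \<in> darts Q" "e \<notin> A.outward" "qd Q e = ?m" for e
    proof -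
      define x where "x = edge_inv Q e"
      have x: "x \<in> A.outward" "x \<in> darts Q" "e = edge_inv Q x" using e A.flip_outward_iff by (auto simp: x_def)
      have dx: "?m = Suc (qd Q x)" using A.inward_iff[OF e(1)] e by (simp add: x_def)
      have fx: "f x \<in> B.outward" using f_outward x by simp
      have mx: "A.mate x \<in> A.outward" using A.mate_props x by simp
      have dm: "qd Q' (B.mate (f x)) = qd Q (A.mate x)" "qd Q' (f x) = qd Q x"
        using f_mate[OF x(1)] f_d mx x by metis+
      have Fe: "F e = edge_inv Q' (f x)" using F_a x by simp
      have qq: "q' = f q" if "q \<in> A.outward" "A.next_out q = A.mate x" "q' \<in> B.outward" "B.next_out q' = B.mate (f x)" for q q'
      proof -
        have "B.next_out (f q) = B.next_out q'" using f_next_out f_mate that x by metis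
        then show ?thesis using B.next_out_inj f_outward that by metis
      qed
      consider "qd Q (A.mate x) = Suc (qd Q x)" | "qd Q (A.mate x) = qd Q x"
        | "qd Q x = Suc (qd Q (A.mate x))"
        using x(1) by (cases rule: A.mate_cases) auto
      then show ?thesis
      proof cases
        case 1
        have "vert_rot Q e = A.mate x" using A.rot_mate_low[OF x(1) 1] x by simp
        moreover have "vert_rot Q' (F e) = B.mate (f x)"
          using B.rot_mate_low[OF fx] 1 dm Fe by simp
        ultimately show ?thesis using F_outward mx f_mate x by simp
      next
        case 2
        obtain q where q: "q \<in> A.outward" "A.next_out q = A.mate x" "vert_rot Q (edge_inv Q x) = edge_inv Q q"
          using A.rot_mate_conf[OF x(1) 2] by metis
        obtain q' where q': "q' \<in> B.outward" "B.next_out q' = B.mate (f x)"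
            "vert_rot Q' (edge_inv Q' (f x)) = edge_inv Q' q'"
          using B.rot_mate_conf[OF fx] 2 dm by metis
        show ?thesis using qq[OF q(1,2) q'(1,2)] q q' F_a x Fe by simp
      next
        case 3
        obtain q u where q: "q \<in> A.outward" "A.next_out q = A.mate x" "u \<in> A.outward"
            "vert_rot Q (edge_inv Q x) = edge_inv Q u" "vert_rot Q u = edge_inv Q q" "qd Q u = qd Q x"
          using A.rot_mate_up[OF x(1) 3] by metis
        have 3: "qd Q' (f x) = Suc (qd Q' (B.mate (f x)))" using 3 dm by simp
        obtain q' u' where q': "q' \<in> B.outward" "B.next_out q' = B.mate (f x)" "u' \<in> B.outward"
            "vert_rot Q' (edge_inv Q' (f x)) = edge_inv Q' u'" "vert_rot Q' u' = edge_inv Q' q'"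
          using B.rot_mate_up[OF fx 3] by metis
        have uD: "u \<in> darts Q" using q A.outward_dart by simp
        have "F (vert_rot Q u) = vert_rot Q' (F u)" using less.hyps[of u] q(6) dx uD by simp
        then have "vert_rot Q' (f u) = edge_inv Q' (f q)" using q F_a F_outward by simp
        then have "vert_rot Q' (f u) = vert_rot Q' u'" using qq[OF q(1,2) q'(1,2)] q' by simp
        then have "f u = u'" using B.s.inj[of "f u" u'] f_outward[OF q(3)] q'(3) B.outward_dart by simp
        then show ?thesis using q q' F_a x Fe by simp
      qed
    qed
    \<comment> \<open>The second conjunct supplies the outward dart that \<open>next_in_miss\<close>
      requires on the side of Q'.\<close>
    have s2: "F (A.next_out e) = B.next_out (F e) \<and> (\<exists>y\<in>B.outward. y \<in> orb (vert_rot Q') (F e))"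
      if "e \<in> darts Q" "y \<in> orb (vert_rot Q) e" "y \<in> A.outward" "e \<notin> A.outward" "qd Q e = ?m" for e y
      using that
    proof (induction rule: A.s.next_in_induct)
      case (hit e)
      have "F (vert_rot Q e) = vert_rot Q' (F e)" using s1 hit by simp
      moreover have "F (vert_rot Q e) \<in> B.outward" using F_mem[of "vert_rot Q e"] hit by simp
      ultimately show ?case using hit next_in_hit[of "vert_rot Q'" "F e" B.outward] orb_apply[of "vert_rot Q'" "F e"]
        by auto
    next
      case (miss e)
      have e: "F (vert_rot Q e) = vert_rot Q' (F e)" using s1 miss by simp
      have IH: "F (A.next_out (vert_rot Q e)) = B.next_out (F (vert_rot Q e))"
        "\<exists>y\<in>B.outward. y \<in> orb (vert_rot Q') (F (vert_rot Q e))" using miss by auto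
      then obtain y where y: "y \<in> B.outward" "y \<in> orb (vert_rot Q') (vert_rot Q' (F e))" using e by auto
      have y2: "y \<in> orb (vert_rot Q') (F e)" using orb_trans[OF orb_apply y(2)] .
      have "vert_rot Q' (F e) \<notin> B.outward" using F_mem[of "vert_rot Q e"] miss e by simp
      then have "B.next_out (F e) = B.next_out (vert_rot Q' (F e))"
        using B.s.next_in_miss[OF _ y2 y(1)] F_mem[of e] miss by simp
      then show ?case using IH(1) e miss y(1) y2 by auto
    qed
    show ?case
    proof (cases "x0 \<in> A.outward")
      case False
      then show ?thesis using s1 less.prems by simp
    next
      case True
      note xD = less.prems
      have sx: "vert_rot Q x0 \<in> darts Q" using xD by simp
      \<comment> \<open>Elimination: the dart \<open>w'\<close> before
        \<open>F (vert_rot Q x0)\<close> cannot come from an inward dart, whose successor is known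
        by \<open>s1\<close>; and among outward darts the image rotation singles out
        \<open>f x0\<close>.\<close>
      obtain w' where w': "w' \<in> darts Q'" "vert_rot Q' w' = F (vert_rot Q x0)"
        using B.s.surj F_mem[OF sx] by metis
      then obtain w where w: "w \<in> darts Q" "F w = w'" using F_surj by metis
      have "qd Q w = qd Q' w'" using F_mem[OF w(1)] w by simp
      also have "\<dots> = qd Q' (F (vert_rot Q x0))" using w' B.d_s by metis
      also have "\<dots> = ?m" using F_mem[OF sx] xD by simp
      finally have dw: "qd Q w = ?m" .
      have wP: "w \<in> A.outward"
      proof (rule ccontr)
        assume n: "w \<notin> A.outward"
        then have "F (vert_rot Q w) = F (vert_rot Q x0)" using s1[OF w(1) n dw] w w' by simp
        then have "w = x0" using F_inj A.s.inj w(1) xD A.s_mem by metis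
        then show False using n True by simp
      qed
      have wP': "w' \<in> B.outward" using F_mem[OF w(1)] w wP by simp
      have "B.next_out w' = F (A.next_out x0)"
      proof (cases "vert_rot Q x0 \<in> A.outward")
        case T: True
        then have "F (vert_rot Q x0) \<in> B.outward" using F_mem[OF sx] by simp
        then have "B.next_out w' = F (vert_rot Q x0)" using next_in_hit[of "vert_rot Q'" w' B.outward] w' by simp
        then show ?thesis using next_in_hit[of "vert_rot Q" x0 A.outward] T by simp
      next
        case Fa: False
        have "vert_rot Q' w' \<notin> B.outward" using F_mem[OF sx] Fa w' by simp
        then have "B.next_out w' = B.next_out (F (vert_rot Q x0))"
          using B.s.next_in_miss[OF w'(1) orb_self wP'] w' by simp
        also have "\<dots> = F (A.next_out (vert_rot Q x0))"
          using s2[OF sx A.s.orb_sym[OF xD orb_apply] True Fa] xD by simp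
        also have "A.next_out (vert_rot Q x0) = A.next_out x0"
          using A.s.next_in_miss[OF xD orb_self True Fa] by simp
        finally show ?thesis .
      qed
      also have "\<dots> = B.next_out (f x0)" using f_next_out[OF True] F_outward[OF A.next_out_outward[OF True]] by simp
      finally have "w' = f x0" using B.next_out_inj wP' f_outward[OF True] by simp
      then show ?thesis using w' F_outward[OF True] by simp
    qed
  qed
  have Forg: "F ` qorg Q = qorg Q'"
  proof
    show "F ` qorg Q \<subseteq> qorg Q'"
    proof
      fix y assume "y \<in> F ` qorg Q"
      then obtain x where x: "x \<in> qorg Q" "y = F x" by auto
      then have "x \<in> darts Q" using A.org_sub by auto
      then show "y \<in> qorg Q'" using x F_mem[of x] A.org_iff[of x] B.org_iff[of y] by simp
    qed
    show "qorg Q' \<subseteq> F ` qorg Q"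
    proof
      fix y assume y: "y \<in> qorg Q'"
      then have "y \<in> darts Q'" using B.org_sub by auto
      then obtain x where x: "x \<in> darts Q" "F x = y" using F_surj by auto
      then have "x \<in> qorg Q" using y F_mem[OF x(1)] A.org_iff[OF x(1)] B.org_iff[of y] by simp
      then show "y \<in> F ` qorg Q" using x by auto
    qed
  qed
  have "B.next_out (f A.rt) = B.next_out B.rt"
    using f0(5) f_next_out[OF A.rt_props(1)] by (simp add: A.Phi_rootd B.Phi_rootd)
  then have "f A.rt = B.rt" using B.next_out_inj f_outward[OF A.rt_props(1)] B.rt_props(1) by simp
  then have "F ` qroot Q = qroot Q'"
    using A.rt_props B.rt_props F_outward F_a by simp
  then show ?thesis unfolding iso_quad_def using F_bij F_mem main Forg by blast
qed

end

section \<open>The inverse construction\<close>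

text \<open>The face contours of a map, with heights changing by at most one per step. The inverse
  \<open>q\<close> is a parameter so that the reversed walk is again an instance and each fact on
  \<open>N\<close> yields one on \<open>B\<close>.\<close>

locale walk =
  fixes D :: "nat set" and p q :: "nat \<Rightarrow> nat" and d :: "nat \<Rightarrow> nat"
  assumes fin: "finite D" and p_bij: "bij_betw p D D"
    and q_mem: "\<And>x. x \<in> D \<Longrightarrow> q x \<in> D"
    and qp: "\<And>x. x \<in> D \<Longrightarrow> q (p x) = x" and pq: "\<And>x. x \<in> D \<Longrightarrow> p (q x) = x"
    and d_up: "\<And>x. x \<in> D \<Longrightarrow> d (p x) \<le> Suc (d x)"
    and d_down: "\<And>x. x \<in> D \<Longrightarrow> d x \<le> Suc (d (p x))"
begin

lemma p_mem: "x \<in> D \<Longrightarrow> p x \<in> D"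
  using p_bij by (auto dest: bij_betwE)

lemma walk_rev: "walk D q p d"
proof
  show "bij_betw q D D"
    by (rule bij_betw_byWitness[where f' = p]) (auto simp: qp pq p_mem q_mem)
  show "d (q x) \<le> Suc (d x)" if "x \<in> D" for x using d_down[OF q_mem[OF that]] pq[OF that] by simp
  show "d x \<le> Suc (d (q x))" if "x \<in> D" for x using d_up[OF q_mem[OF that]] pq[OF that] by simp
qed (auto simp: fin p_mem qp pq)

sublocale pp: finite_perm D p
  using fin p_bij by unfold_locales

sublocale qq: finite_perm D q
  using walk_rev fin by unfold_locales (auto simp: walk_def)

abbreviation "N x \<equiv> next_in p {y \<in> D. d x \<le> d y} x"
abbreviation "B x \<equiv> next_in q {y \<in> D. d x \<le> d y} x"

lemma N_props:
  assumes "x \<in> D"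
  obtains n where "0 < n" "N x = (p ^^ n) x" "N x \<in> D" "d x \<le> d (N x)"
    "\<forall>i. 0 < i \<and> i < n \<longrightarrow> d ((p ^^ i) x) < d x"
proof -
  obtain n where "0 < n" "N x = (p ^^ n) x" "(p ^^ n) x \<in> {y \<in> D. d x \<le> d y}"
    "\<forall>i. 0 < i \<and> i < n \<longrightarrow> (p ^^ i) x \<notin> {y \<in> D. d x \<le> d y}"
    using pp.next_in_props'[of x x "{y \<in> D. d x \<le> d y}"] assms orb_self[of x p] by blast
  then show ?thesis using that pp.pow_mem[OF assms] by (simp add: not_le)
qed

lemma B_props:
  assumes "x \<in> D"
  obtains n where "0 < n" "B x = (q ^^ n) x" "B x \<in> D" "d x \<le> d (B x)"
    "\<forall>i. 0 < i \<and> i < n \<longrightarrow> d ((q ^^ i) x) < d x"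
  by (rule walk.N_props[OF walk_rev assms]) (rule that)

lemma pow_cancel: "x \<in> D \<Longrightarrow> i \<le> n \<Longrightarrow> (p ^^ i) ((q ^^ n) x) = (q ^^ (n - i)) x"
proof (induction i)
  case (Suc i)
  then have "n - i = Suc (n - Suc i)" by simp
  then have "(p ^^ i) ((q ^^ n) x) = q ((q ^^ (n - Suc i)) x)" using Suc by simp
  then show ?case using pq qq.pow_mem[OF Suc.prems(1)] by simp
qed simp

text \<open>A walk whose first step does not rise comes back at exactly its old height, because it
  gains at most one per step. Retraced from \<open>B x\<close>, the same excursion first regains
  that height at \<open>x\<close>.\<close>

lemma NB:
  assumes "x \<in> D" "d (q x) \<le> d x"
  shows "B x \<in> D" "d (B x) = d x" "N (B x) = x"
proof -
  obtain n where n: "0 < n" "B x = (q ^^ n) x" "B x \<in> D" "d x \<le> d (B x)"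
    "\<forall>i. 0 < i \<and> i < n \<longrightarrow> d ((q ^^ i) x) < d x"
    by (rule B_props[OF assms(1)]) (rule that)
  show "B x \<in> D" using n by simp
  have "d (B x) \<le> d x"
  proof (cases "n = 1")
    case True
    then show ?thesis using n assms by simp
  next
    case False
    then obtain m where m: "n = Suc m" "0 < m" using n by (cases n) auto
    let ?y = "(q ^^ m) x"
    have y: "?y \<in> D" using qq.pow_mem assms by simp
    have "d ?y < d x" using n m by simp
    moreover have "B x = q ?y" using n m by simp
    ultimately show ?thesis using d_down[OF q_mem[OF y]] pq[OF y] by simp
  qed
  then show e: "d (B x) = d x" using n by simp
  have "next_in p {y \<in> D. d (B x) \<le> d y} (B x) = (p ^^ n) (B x)"
  proof (rule next_in_eqI)
    show "0 < n" by (rule n)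
    show "(p ^^ n) (B x) \<in> {y \<in> D. d (B x) \<le> d y}"
      using n e assms pow_cancel[of x n n] by simp
    fix i assume i: "0 < i" "i < n"
    then have "(p ^^ i) (B x) = (q ^^ (n - i)) x" using n pow_cancel[of x i n] assms by simp
    moreover have "d ((q ^^ (n - i)) x) < d x" using n i by simp
    ultimately show "(p ^^ i) (B x) \<notin> {y \<in> D. d (B x) \<le> d y}" using e by simp
  qed
  then show "N (B x) = x" using n pow_cancel[of x n n] assms by simp
qed

lemma BN:
  assumes "x \<in> D" "d (p x) \<le> d x"
  shows "N x \<in> D" "d (N x) = d x" "B (N x) = x"
  using walk.NB[OF walk_rev assms] .

text \<open>The last corner of an excursion below \<open>z\<close> is one level lower. It will be
  the corner whose arrow is met first when turning from the outward dart of
  \<open>z\<close>.\<close>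

lemma N_pred:
  assumes "z \<in> D" "d (p z) < d z"
  obtains n where "0 < n" "q (N z) = (p ^^ n) z" "d z = Suc (d (q (N z)))"
    "\<forall>i. 0 < i \<and> i \<le> n \<longrightarrow> d ((p ^^ i) z) < d z"
proof -
  obtain n where n: "0 < n" "N z = (p ^^ n) z" "N z \<in> D" "d z \<le> d (N z)"
    "\<forall>i. 0 < i \<and> i < n \<longrightarrow> d ((p ^^ i) z) < d z"
    by (rule N_props[OF assms(1)]) (rule that)
  have "n \<noteq> 1" using n assms by auto
  then obtain m where m: "n = Suc m" "0 < m" using n by (cases n) auto
  have zD: "(p ^^ m) z \<in> D" using pp.pow_mem assms by simp
  have q: "q (N z) = (p ^^ m) z" using n m qp[OF zD] by simp
  have lt: "d (q (N z)) < d z" using n m q by simp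
  have "d (N z) = d z" using BN assms by simp
  moreover have "d (N z) \<le> Suc (d (q (N z)))" using d_up[OF q_mem[OF n(3)]] pq[OF n(3)] by simp
  ultimately have "d z = Suc (d (q (N z)))" using lt by simp
  then show ?thesis using that[OF m(2) q] n m by simp
qed

end

section \<open>The quadrangulation built from a pointed map\<close>

locale pointed_map = combinatorial_map M for M :: rp_map +
  fixes o' :: nat
  assumes conn: "connected_map M" and o_D: "o' \<in> darts M" and org_M: "org M = vertex_of M o'"
    and rootd_D: "rootd M \<in> darts M"
begin

definition d :: "nat \<Rightarrow> nat" where "d x = vdist M (org M) (vertex_of M x)"
definition p :: "nat \<Rightarrow> nat" where "p x = \<alpha> (\<sigma> x)"
definition q :: "nat \<Rightarrow> nat" where "q = inv_into D p"

lemma org_vertex: "org M \<in> vertices M"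
  using o_D org_M by (auto simp: vertices_alt)

lemma geo: "geodesic M (org M) d"
  using geodesic_vdist[OF conn org_vertex] by (simp add: d_def[abs_def])

lemma d_s [simp]: "x \<in> D \<Longrightarrow> d (\<sigma> x) = d x"
  using geo by (simp add: geodesic_def)

lemma d_a: "x \<in> D \<Longrightarrow> d (\<alpha> x) \<le> Suc (d x)" "x \<in> D \<Longrightarrow> d x \<le> Suc (d (\<alpha> x))"
proof -
  have *: "d (\<alpha> x) \<le> Suc (d x)" if "x \<in> D" for x using geo that by (simp add: geodesic_def)
  show "x \<in> D \<Longrightarrow> d (\<alpha> x) \<le> Suc (d x)" by (rule *)
  show "x \<in> D \<Longrightarrow> d x \<le> Suc (d (\<alpha> x))" using *[of "\<alpha> x"] by simp
qed

lemma p_bij: "bij_betw p D D"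
  using bij_betw_trans[OF s.bij a_bij] by (simp add: p_def[abs_def] comp_def)

sublocale w: walk D p q d
proof
  show "p (q x) = x" if "x \<in> D" for x
    using p_bij that by (simp add: q_def bij_betw_inv_into_right)
  show "q (p x) = x" if "x \<in> D" for x
    using p_bij that by (simp add: q_def bij_betw_inv_into_left)
  show "q x \<in> D" if "x \<in> D" for x
    using p_bij that by (auto simp: q_def bij_betw_def intro: inv_into_into)
  show "d (p x) \<le> Suc (d x)" "d x \<le> Suc (d (p x))" if "x \<in> D" for x
    using d_a[of "\<sigma> x"] that by (simp_all add: p_def)
qed (use s.fin p_bij in auto)

lemma s_q: "x \<in> D \<Longrightarrow> \<sigma> (q x) = \<alpha> x"
proof -
  assume x: "x \<in> D"
  have "\<alpha> (\<alpha> (\<sigma> (q x))) = \<alpha> x" using w.pq[OF x] by (simp add: p_def)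
  then show ?thesis using w.q_mem[OF x] by simp
qed

lemma d_q: "x \<in> D \<Longrightarrow> d (q x) = d (\<alpha> x)"
  using d_s[OF w.q_mem] s_q by metis

text \<open>Each corner x of M yields two darts of the quadrangulation: the outward dart 2 * x starting in
  this corner and its reverse 2 * x + 1. Outward darts point to the next corner of the face
  contour at larger distance, or to a new vertex inside the face when there is none.\<close>
definition rot :: "nat \<Rightarrow> nat" where
  "rot n = (let x = n div 2 in
     if even n then (if d x \<le> d (p x) then 2 * \<sigma> x else Suc (2 * q (w.N x)))
     else (if d (\<alpha> x) = Suc (d x) then 2 * \<alpha> x else Suc (2 * w.B x)))"

definition flip :: "nat \<Rightarrow> nat" where "flip n = (if even n then Suc n else n - 1)"

definition lbl :: "nat \<Rightarrow> nat" where "lbl n = (if even n then d (n div 2) else Suc (d (n div 2)))"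

text \<open>The prescription roots the image at the outward dart following the root dart, hence the
  step back.\<close>

definition rt0 :: nat where "rt0 = inv_into D \<sigma> (rootd M)"

definition Qm :: rp_quad where
  "Qm = \<lparr> darts = {n. n div 2 \<in> D}, edge_inv = flip, vert_rot = rot,
          qorg = orb rot (2 * o'), qroot = {2 * rt0, Suc (2 * rt0)} \<rparr>"

lemma Qm_simps [simp]: "darts Qm = {n. n div 2 \<in> D}" "edge_inv Qm = flip" "vert_rot Qm = rot"
  "qorg Qm = orb rot (2 * o')" "qroot Qm = {2 * rt0, Suc (2 * rt0)}"
  by (simp_all add: Qm_def)

lemma flip_simps [simp]: "flip (2 * x) = Suc (2 * x)" "flip (Suc (2 * x)) = 2 * x"
  by (simp_all add: flip_def)

lemma lbl_simps [simp]: "lbl (2 * x) = d x" "lbl (Suc (2 * x)) = Suc (d x)"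
  by (simp_all add: lbl_def)

text \<open>The arrow of a corner ends at the first corner along \<open>q\<close> that is one level
  higher. The arrows ending in the corner \<open>x\<close> come from the corners one level lower on
  the excursion between \<open>x\<close> and \<open>w.N x\<close>, and the last of these,
  \<open>q (w.N x)\<close>, is met first.\<close>

lemma rot_even: "rot (2 * x) = (if d x \<le> d (p x) then 2 * \<sigma> x else Suc (2 * q (w.N x)))"
  by (simp add: rot_def)

text \<open>If \<open>q x\<close> is higher than \<open>x\<close>, the arrow of \<open>x\<close>
  ends there and is followed by the outward dart of \<open>\<sigma> (q x) = \<alpha> x\<close>.
  Otherwise \<open>w.B x\<close> has the same height as \<open>x\<close> and its arrow the same end.
  On the highest corners of a face this closes up to a cycle, which is the new vertex.\<close>

lemma rot_odd: "rot (Suc (2 * x)) = (if d (\<alpha> x) = Suc (d x) then 2 * \<alpha> x else Suc (2 * w.B x))"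
  by (simp add: rot_def)

lemma dart_cases:
  obtains x where "n = 2 * x" | x where "n = Suc (2 * x)"
proof (cases "even n")
  case True then show ?thesis using that(1) by (auto elim: evenE)
next
  case False then show ?thesis using that(2) by (auto elim: oddE)
qed

abbreviation "QD \<equiv> {n. n div 2 \<in> D}"

lemma fin_QD: "finite QD"
proof (rule finite_subset)
  show "QD \<subseteq> (*) 2 ` D \<union> (\<lambda>x. Suc (2 * x)) ` D"
  proof
    fix n assume n: "n \<in> QD"
    show "n \<in> (*) 2 ` D \<union> (\<lambda>x. Suc (2 * x)) ` D"
      by (rule dart_cases[of n]) (use n in auto)
  qed
qed (use s.fin in auto)

definition face :: "nat \<Rightarrow> nat" where "face n = rot (flip n)"

text \<open>An edge of M with both ends at one height gives a confluent face; \<open>face_up\<close>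
  treats the other edges, which give simple ones.\<close>

lemma face_conf:
  assumes "x \<in> D" "d (\<alpha> x) = d x"
  shows "face (2 * x) = Suc (2 * q x)" "face (Suc (2 * q x)) = 2 * \<alpha> x"
proof -
  have "w.B x = q x"
    by (rule next_in_hit) (use assms d_q w.q_mem in simp)
  then show "face (2 * x) = Suc (2 * q x)" using assms by (simp add: face_def rot_odd)
  show "face (Suc (2 * q x)) = 2 * \<alpha> x"
    using assms d_q w.pq s_q by (simp add: face_def rot_even)
qed

lemma face_up:
  assumes x: "x \<in> D" and lt: "d (\<alpha> x) < d x"
  shows "face (2 * x) = Suc (2 * w.B x)" "face (Suc (2 * w.B x)) = Suc (2 * q x)"
    "face (Suc (2 * q x)) = 2 * \<alpha> x" "face (2 * \<alpha> x) = 2 * x" "w.B x \<in> D" "d (w.B x) = d x"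
proof -
  show "face (2 * x) = Suc (2 * w.B x)" using lt by (simp add: face_def rot_odd)
  have dq: "d (q x) < d x" using lt d_q x by simp
  have B: "w.B x \<in> D" "d (w.B x) = d x" "w.N (w.B x) = x" using w.NB[OF x] dq by auto
  then show "w.B x \<in> D" "d (w.B x) = d x" by auto
  have "\<not> d (w.B x) \<le> d (p (w.B x))"
  proof
    assume "d (w.B x) \<le> d (p (w.B x))"
    then have "w.N (w.B x) = p (w.B x)" by (intro next_in_hit) (use B w.p_mem in simp)
    then have "x = p (w.B x)" using B(3) by simp
    then have "q x = w.B x" using w.qp[OF B(1)] by simp
    then show False using dq B(2) by simp
  qed
  then show "face (Suc (2 * w.B x)) = Suc (2 * q x)" using B by (simp add: face_def rot_even)
  show "face (Suc (2 * q x)) = 2 * \<alpha> x"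
    using dq w.pq[OF x] s_q[OF x] by (simp add: face_def rot_even)
  show "face (2 * \<alpha> x) = 2 * x"
    using d_a(2)[OF x] lt x by (simp add: face_def rot_odd)
qed

text \<open>Each quadrangle surrounds an edge of M, taken from an end \<open>x\<close> that is not
  the lower one. The dart \<open>2 * y\<close> belongs to the edge of \<open>y\<close>. The dart
  \<open>Suc (2 * z)\<close> belongs to that of \<open>p z\<close>, as \<open>z = q (p z)\<close>,
  or, if the contour drops after \<open>z\<close>, to that of \<open>w.N z\<close>, as
  \<open>z = w.B (w.N z)\<close>.\<close>

lemma face_cycle:
  assumes "n \<in> QD"
  obtains a b c e where "n \<in> {a, b, c, e}" "face a = b" "face b = c" "face c = e" "face e = a"
    "distinct [a, b, c, e]" "{a, b, c, e} \<subseteq> QD"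
proof -
  \<comment> \<open>An inclusion only: in the confluent case \<open>w.B x = q x\<close>, and the
    fourth corner is missing from the list.\<close>
  have cyc: "\<exists>a b c e. {2 * x, Suc (2 * w.B x), Suc (2 * q x), 2 * \<alpha> x} \<subseteq> {a, b, c, e} \<and>
      face a = b \<and> face b = c \<and> face c = e \<and> face e = a \<and> distinct [a, b, c, e] \<and> {a, b, c, e} \<subseteq> QD"
    if x: "x \<in> D" "d (\<alpha> x) \<le> d x" for x
  proof (cases "d (\<alpha> x) = d x")
    case True
    have B: "w.B x = q x"
      by (rule next_in_hit) (use x True d_q w.q_mem in simp)
    have ne: "q x \<noteq> q (\<alpha> x)" using w.qq.inj x by (metis a_mem a_neq)
    have o1: "Suc (2 * u) \<noteq> 2 * v" "2 * v \<noteq> Suc (2 * u)" for u v :: nat by presburger+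
    note f1 = face_conf[OF x(1) True]
    have f2: "face (2 * \<alpha> x) = Suc (2 * q (\<alpha> x))" "face (Suc (2 * q (\<alpha> x))) = 2 * x"
      using face_conf[of "\<alpha> x"] x True by simp_all
    show ?thesis
      by (intro exI[of _ "2 * x"] exI[of _ "Suc (2 * q x)"] exI[of _ "2 * \<alpha> x"] exI[of _ "Suc (2 * q (\<alpha> x))"])
        (use B f1 f2 ne o1 x w.q_mem in \<open>simp add: a_neq[symmetric]\<close>)
  next
    case False
    then have lt: "d (\<alpha> x) < d x" using x by simp
    note f = face_up[OF x(1) lt]
    have ne: "w.B x \<noteq> q x"
    proof
      assume "w.B x = q x"
      then have "d (q x) = d x" using f(6) by simp
      then show False using lt d_q[OF x(1)] by simp
    qed
    have o1: "Suc (2 * u) \<noteq> 2 * v" "2 * v \<noteq> Suc (2 * u)" for u v :: nat by presburger+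
    show ?thesis
      by (intro exI[of _ "2 * x"] exI[of _ "Suc (2 * w.B x)"] exI[of _ "Suc (2 * q x)"] exI[of _ "2 * \<alpha> x"])
        (use f ne o1 x w.q_mem in \<open>simp add: a_neq[symmetric]\<close>)
  qed
  have "\<exists>x. x \<in> D \<and> d (\<alpha> x) \<le> d x \<and> n \<in> {2 * x, Suc (2 * w.B x), Suc (2 * q x), 2 * \<alpha> x}"
  proof (cases n rule: dart_cases)
    case (1 y)
    then have y: "y \<in> D" using assms by simp
    show ?thesis
    proof (cases "d (\<alpha> y) \<le> d y")
      case True then show ?thesis using y 1 by auto
    next
      case False then show ?thesis using y 1 by (intro exI[of _ "\<alpha> y"]) auto
    qed
  next
    case (2 z)
    then have z: "z \<in> D" using assms by simp
    show ?thesis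
    proof (cases "d z \<le> d (p z)")
      case True
      have pz: "p z \<in> D" "q (p z) = z" using z w.p_mem w.qp by auto
      then have "d (\<alpha> (p z)) \<le> d (p z)" using True d_q[OF pz(1)] by simp
      then show ?thesis using pz 2 by (intro exI[of _ "p z"]) auto
    next
      case False
      then have lt: "d (p z) < d z" by simp
      have N: "w.N z \<in> D" "d (w.N z) = d z" "w.B (w.N z) = z" using w.BN[OF z] lt by auto
      have "d z = Suc (d (q (w.N z)))" using w.N_pred[OF z lt] by metis
      then have "d (\<alpha> (w.N z)) \<le> d (w.N z)" using d_q[OF N(1)] N(2) by simp
      then show ?thesis using N 2 by (intro exI[of _ "w.N z"]) auto
    qed
  qed
  then obtain x where x: "x \<in> D" "d (\<alpha> x) \<le> d x"
      "n \<in> {2 * x, Suc (2 * w.B x), Suc (2 * q x), 2 * \<alpha> x}" by blast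
  obtain a b c e where *: "{2 * x, Suc (2 * w.B x), Suc (2 * q x), 2 * \<alpha> x} \<subseteq> {a, b, c, e}"
      "face a = b" "face b = c" "face c = e" "face e = a" "distinct [a, b, c, e]" "{a, b, c, e} \<subseteq> QD"
    using cyc[OF x(1,2)] by (elim exE conjE)
  show ?thesis by (rule that[OF subsetD[OF *(1) x(3)] *(2-7)])
qed

lemma face4: "n \<in> QD \<Longrightarrow> face (face (face (face n))) = n"
  by (erule face_cycle) auto

lemma face_mem: "n \<in> QD \<Longrightarrow> face n \<in> QD"
  by (erule face_cycle) auto

lemma face_bij: "bij_betw face QD QD"
  by (rule bij_betw_byWitness[where f' = "\<lambda>n. face (face (face n))"])
    (use face4 face_mem in \<open>simp_all add: image_subset_iff\<close>)

lemma card_orb_face: "n \<in> QD \<Longrightarrow> card (orb face n) = 4"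
proof (erule face_cycle)
  fix a b c e assume *: "n \<in> {a, b, c, e}" "face a = b" "face b = c" "face c = e" "face e = a"
    "distinct [a, b, c, e]"
  have "orb face n = {a, b, c, e}"
  proof
    show "orb face n \<subseteq> {a, b, c, e}"
    proof
      fix y assume "y \<in> orb face n"
      then show "y \<in> {a, b, c, e}" by (induction rule: orb_induct) (use * in auto)
    qed
    have "n \<in> orb face n" by (rule orb_self)
    moreover have "face n \<in> orb face n" by (rule orb_apply)
    moreover from this have "face (face n) \<in> orb face n" by (rule orb_step)
    moreover from this have "face (face (face n)) \<in> orb face n" by (rule orb_step)
    ultimately show "{a, b, c, e} \<subseteq> orb face n" using * by auto
  qed
  then show ?thesis using *(6) by simp
qed

lemma flip_mem: "n \<in> QD \<Longrightarrow> flip n \<in> QD"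
  by (cases n rule: dart_cases) auto

lemma flip_flip: "flip (flip n) = n"
  by (cases n rule: dart_cases) auto

lemma flip_bij: "bij_betw flip QD QD"
  by (rule bij_betw_byWitness[where f' = flip]) (use flip_mem flip_flip in auto)

text \<open>Deduced from \<open>face\<close>, which has its own cube as inverse, instead of from the
  case distinctions in \<open>rot\<close>.\<close>

lemma rot_bij: "bij_betw rot QD QD"
proof -
  have "face \<circ> flip = rot" by (auto simp: face_def flip_flip)
  then show ?thesis using bij_betw_trans[OF flip_bij face_bij] by simp
qed

lemma Qm_cmap: "is_cmap Qm"
proof -
  have "flip n \<noteq> n" for n by (cases n rule: dart_cases) auto
  then show ?thesis using fin_QD flip_bij rot_bij flip_flip by (simp add: is_cmap_def)
qed

sublocale Qm: combinatorial_map Qm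
  by unfold_locales (rule Qm_cmap)

lemma lbl_rot: "n \<in> QD \<Longrightarrow> lbl (rot n) = lbl n"
proof (cases n rule: dart_cases)
  case (1 x)
  assume "n \<in> QD"
  then have x: "x \<in> D" using 1 by simp
  show ?thesis
  proof (cases "d x \<le> d (p x)")
    case True then show ?thesis using 1 x by (simp add: rot_even)
  next
    case False
    then have "d x = Suc (d (q (w.N x)))" using w.N_pred[OF x] by (metis not_le)
    then show ?thesis using 1 False by (simp add: rot_even)
  qed
next
  case (2 x)
  assume "n \<in> QD"
  then have x: "x \<in> D" using 2 by simp
  show ?thesis
  proof (cases "d (\<alpha> x) = Suc (d x)")
    case True then show ?thesis using 2 by (simp add: rot_odd)
  next
    case False
    then have "d (q x) \<le> d x" using d_a(1)[OF x] d_q[OF x] by simp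
    then have "d (w.B x) = d x" using w.NB[OF x] by simp
    then show ?thesis using 2 False by (simp add: rot_odd)
  qed
qed

abbreviation "QP \<equiv> {n \<in> QD. even n}"

text \<open>Turning from the outward dart of a corner, one meets the inward darts coming from the
  corners z of the same face that follow x before the contour returns to the height of x, last
  one first.\<close>
lemma next_rot_aux:
  assumes x: "x \<in> D"
  shows "\<lbrakk>0 < i; z = (p ^^ i) x; d x = Suc (d z); \<forall>j. 0 < j \<and> j \<le> i \<longrightarrow> d ((p ^^ j) x) < d x\<rbrakk> \<Longrightarrow>
    next_in rot QP (Suc (2 * z)) = 2 * \<sigma> x \<and> 2 * \<sigma> x \<in> orb rot (Suc (2 * z))"
proof (induction i arbitrary: z rule: less_induct)
  case (less i)
  have z: "z \<in> D" using less.prems w.pp.pow_mem x by simp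
  obtain j where j: "i = Suc j" using less.prems by (cases i) auto
  have jD: "(p ^^ j) x \<in> D" using w.pp.pow_mem x by simp
  have qz: "q z = (p ^^ j) x" using less.prems j w.qp[OF jD] by simp
  show ?case
  proof (cases "d (\<alpha> z) = Suc (d z)")
    case True
    \<comment> \<open>Here \<open>q z\<close> has the height of \<open>x\<close>, but the corners
      strictly inside the excursion are lower than \<open>x\<close>.\<close>
    have "j = 0"
    proof (rule ccontr)
      assume "j \<noteq> 0"
      then have "d ((p ^^ j) x) < d x" using less.prems(4) j by simp
      then show False using True d_q[OF z] qz less.prems(3) by simp
    qed
    then have "q z = x" using qz by simp
    then have "\<alpha> z = \<sigma> x" using s_q[OF z] by simp
    then have r: "rot (Suc (2 * z)) = 2 * \<sigma> x" using True by (simp add: rot_odd)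
    then have "next_in rot QP (Suc (2 * z)) = 2 * \<sigma> x"
      using next_in_hit[of rot "Suc (2 * z)" QP] x by simp
    then show ?thesis using orb_apply[of rot "Suc (2 * z)"] r by simp
  next
    case False
    then have le: "d (q z) \<le> d z" using d_a(1)[OF z] d_q[OF z] by simp
    obtain k where k: "0 < k" "w.B z = (q ^^ k) z" "w.B z \<in> D" "d z \<le> d (w.B z)"
      "\<forall>i. 0 < i \<and> i < k \<longrightarrow> d ((q ^^ i) z) < d z"
      by (rule w.B_props[OF z]) (rule that)
    have dB: "d (w.B z) = d z" using w.NB[OF z le] by simp
    have retrace: "(q ^^ l) z = (p ^^ (i - l)) x" if "l \<le> i" for l
      using walk.pow_cancel[OF w.walk_rev x that] less.prems by simp
    \<comment> \<open>On the way back from \<open>z\<close> its height must recur before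
      \<open>x\<close>, which is higher than \<open>z\<close>.\<close>
    have "k < i"
    proof (rule ccontr)
      assume "\<not> k < i"
      then consider "k = i" | "i < k" by linarith
      then show False
      proof cases
        case 1
        then have "w.B z = x" using k retrace[of i] by simp
        then show False using dB less.prems(3) by simp
      next
        case 2
        then have "d ((q ^^ i) z) < d z" using k less.prems by simp
        then show False using retrace[of i] less.prems(3) by simp
      qed
    qed
    have IH: "next_in rot QP (Suc (2 * w.B z)) = 2 * \<sigma> x \<and> 2 * \<sigma> x \<in> orb rot (Suc (2 * w.B z))"
    proof (rule less.IH)
      show "i - k < i" "0 < i - k" using k \<open>k < i\<close> by auto
      show "w.B z = (p ^^ (i - k)) x" using k retrace \<open>k < i\<close> by simp
      show "d x = Suc (d (w.B z))" using dB less.prems by simp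
      show "\<forall>j. 0 < j \<and> j \<le> i - k \<longrightarrow> d ((p ^^ j) x) < d x"
        using less.prems(4) diff_le_self[of i k] by (meson le_trans)
    qed
    have r: "rot (Suc (2 * z)) = Suc (2 * w.B z)" using False by (simp add: rot_odd)
    have o: "2 * \<sigma> x \<in> orb rot (Suc (2 * z))"
      using IH r orb_trans[OF orb_apply[of rot "Suc (2 * z)"]] by simp
    have "next_in rot QP (Suc (2 * z)) = next_in rot QP (rot (Suc (2 * z)))"
      by (rule Qm.s.next_in_miss[of _ "2 * \<sigma> x", unfolded Qm_simps]) (use z x o r in auto)
    then show ?thesis using IH o r by simp
  qed
qed

lemma next_rot:
  assumes x: "x \<in> D"
  shows "next_in rot QP (2 * x) = 2 * \<sigma> x" "2 * \<sigma> x \<in> orb rot (2 * x)"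
proof -
  have "next_in rot QP (2 * x) = 2 * \<sigma> x \<and> 2 * \<sigma> x \<in> orb rot (2 * x)"
  proof (cases "d x \<le> d (p x)")
    case True
    then have r: "rot (2 * x) = 2 * \<sigma> x" by (simp add: rot_even)
    then have "next_in rot QP (2 * x) = 2 * \<sigma> x"
      using next_in_hit[of rot "2 * x" QP] x by simp
    then show ?thesis using orb_apply[of rot "2 * x"] r by simp
  next
    case False
    then have lt: "d (p x) < d x" by simp
    obtain n where n: "0 < n" "q (w.N x) = (p ^^ n) x" "d x = Suc (d (q (w.N x)))"
      "\<forall>i. 0 < i \<and> i \<le> n \<longrightarrow> d ((p ^^ i) x) < d x"
      by (rule w.N_pred[OF x lt]) (rule that)
    have IH: "next_in rot QP (Suc (2 * q (w.N x))) = 2 * \<sigma> x \<and> 2 * \<sigma> x \<in> orb rot (Suc (2 * q (w.N x)))"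
      using next_rot_aux[OF x n] .
    have r: "rot (2 * x) = Suc (2 * q (w.N x))" using False by (simp add: rot_even)
    have o: "2 * \<sigma> x \<in> orb rot (2 * x)"
      using IH r orb_trans[OF orb_apply[of rot "2 * x"]] by simp
    have "next_in rot QP (2 * x) = next_in rot QP (rot (2 * x))"
      by (rule Qm.s.next_in_miss[of _ "2 * \<sigma> x", unfolded Qm_simps]) (use x o r in auto)
    then show ?thesis using IH o r by simp
  qed
  then show "next_in rot QP (2 * x) = 2 * \<sigma> x" "2 * \<sigma> x \<in> orb rot (2 * x)" by auto
qed

lemma orb_rot_even: "x \<in> D \<Longrightarrow> y \<in> orb \<sigma> x \<Longrightarrow> 2 * y \<in> orb rot (2 * x)"
proof -
  assume x: "x \<in> D" and "y \<in> orb \<sigma> x"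
  from this(2) show ?thesis
  proof (induction rule: orb_induct)
    case self show ?case by (rule orb_self)
  next
    case (step y)
    then have "y \<in> D" using s.orb_sub[OF x] by auto
    then show ?case using orb_trans[OF step(2) next_rot(2)] by simp
  qed
qed

text \<open>An inward dart descends by construction, so one is needed at every vertex of positive
  height. At an old vertex take a descending edge of M: the contour drops after the corner preceding
  it, so an arrow arrives in that corner.\<close>

lemma geo_Qm: "geodesic Qm (qorg Qm) lbl"
  unfolding geodesic_def
proof (intro conjI ballI impI)
  fix n assume "n \<in> darts Qm"
  then have n: "n \<in> QD" "n \<in> darts Qm" by simp_all
  show "lbl (vert_rot Qm n) = lbl n" using lbl_rot n by simp
  show "lbl (edge_inv Qm n) \<le> Suc (lbl n)" by (cases n rule: dart_cases) auto
  have inv: "lbl y = lbl x" if "x \<in> QD" "y \<in> orb rot x" for x y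
    using Qm.s.orb_inv[of x lbl y] that lbl_rot by simp
  show "lbl n = 0 \<longleftrightarrow> vertex_of Qm n = qorg Qm"
  proof
    assume z: "lbl n = 0"
    then obtain x where x: "n = 2 * x" by (cases n rule: dart_cases) auto
    then have xD: "x \<in> D" "d x = 0" using n z by auto
    then have "vertex_of M x = vertex_of M o'" using geo org_M by (simp add: geodesic_def)
    then have "x \<in> orb \<sigma> o'" using orb_self[of x \<sigma>] by (simp add: vertex_of_def)
    then have "n \<in> orb rot (2 * o')" using orb_rot_even[OF o_D] x by simp
    then show "vertex_of Qm n = qorg Qm" using Qm.s.orb_eq[of "2 * o'" n] o_D by (simp add: vertex_of_def)
  next
    assume "vertex_of Qm n = qorg Qm"
    then have "n \<in> orb rot (2 * o')" using Qm.vof_self[of n] by simp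
    then have "lbl n = d o'" using inv[of "2 * o'" n] o_D by simp
    moreover have "d o' = 0" using geo o_D org_M by (simp add: geodesic_def)
    ultimately show "lbl n = 0" by simp
  qed
  assume pos: "0 < lbl n"
  have "\<exists>z. Suc (2 * z) \<in> orb rot n \<and> z \<in> D"
  proof (cases n rule: dart_cases)
    case (2 z)
    then show ?thesis using orb_self[of n rot] n by auto
  next
    case (1 x)
    then have x: "x \<in> D" "0 < d x" using n pos by auto
    then obtain y where y: "y \<in> vertex_of M x" "Suc (d (\<alpha> y)) = d x"
      using geo unfolding geodesic_def by blast
    have y1: "y \<in> orb \<sigma> x" "y \<in> D" using y(1) s.orb_sub[OF x(1)] by (auto simp: vertex_of_def)
    obtain z where z: "z \<in> D" "\<sigma> z = y" using s.surj[OF y1(2)] by auto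
    have zx: "z \<in> orb \<sigma> x" using orb_trans[OF y1(1)] s.orb_sym[OF z(1) orb_apply] z by simp
    have "d z = d x" using s.orb_inv[of x d z] x zx by simp
    then have lt: "d (p z) < d z" using y z by (simp add: p_def)
    then have "rot (2 * z) = Suc (2 * q (w.N z))" by (simp add: rot_even)
    moreover have "rot (2 * z) \<in> orb rot n" using orb_step orb_rot_even[OF x(1) zx] 1 by simp
    moreover have "q (w.N z) \<in> D" using w.BN(1)[OF z(1)] w.q_mem lt by simp
    ultimately show ?thesis by auto
  qed
  then obtain z where z: "Suc (2 * z) \<in> orb rot n" by auto
  then have "lbl (Suc (2 * z)) = lbl n" using inv[OF n(1)] by blast
  then show "\<exists>y\<in>vertex_of Qm n. Suc (lbl (edge_inv Qm y)) = lbl n"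
    using z by (intro bexI[of _ "Suc (2 * z)"]) (auto simp: vertex_of_def)
qed

lemma qorg_vertex: "qorg Qm \<in> vertices Qm"
  using o_D by (auto simp: Qm.vertices_alt vertex_of_def intro!: image_eqI[of _ _ "2 * o'"])

lemma qd_Qm: "n \<in> QD \<Longrightarrow> qd Qm n = lbl n"
  using Qm.geodesic_unique[OF geo_Qm, of n] by (simp add: qd_def)

lemma rt0_props: "rt0 \<in> D" "\<sigma> rt0 = rootd M"
  using s.bij rootd_D by (auto simp: rt0_def bij_betw_def intro: inv_into_into f_inv_into_f)

lemma faceperm_Qm: "faceperm Qm = face"
  by (auto simp: faceperm_def face_def)

sublocale Qm: rooted_bipartite_quad Qm
proof
  show "darts Qm \<noteq> {}" using o_D by (auto intro!: exI[of _ "2 * o'"])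
  show "connected_map Qm" by (rule Qm.geodesic_connected[OF geo_Qm])
  show "qorg Qm \<in> vertices Qm" by (rule qorg_vertex)
  show "card (orb (faceperm Qm) n) = 4" if "n \<in> darts Qm" for n
    using card_orb_face that by (simp add: faceperm_Qm)
  show "qd Qm (edge_inv Qm n) = Suc (qd Qm n) \<or> qd Qm n = Suc (qd Qm (edge_inv Qm n))"
    if "n \<in> darts Qm" for n
    using that qd_Qm[of n] qd_Qm[of "flip n"] flip_mem[of n] by (cases n rule: dart_cases) auto
  have "orb flip (2 * rt0) = {2 * rt0, Suc (2 * rt0)}"
    using orb_involution[of flip "2 * rt0"] by simp
  then show "qroot Qm \<in> edges Qm"
    using rt0_props by (auto simp: edges_def intro!: image_eqI[of _ _ "2 * rt0"])
qed

section \<open>The image of the rebuilt quadrangulation\<close>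

lemma Qm_outward: "Qm.outward = QP"
proof -
  have "qd Qm (flip n) = Suc (qd Qm n) \<longleftrightarrow> even n" if "n \<in> QD" for n
    using that qd_Qm[of n] qd_Qm[of "flip n"] flip_mem[of n] by (cases n rule: dart_cases) auto
  then show ?thesis by (auto simp: Qm.outward_def)
qed

lemma Qm_mate: assumes x: "x \<in> D" shows "Qm.mate (2 * x) = 2 * \<alpha> x"
proof -
  consider "d (\<alpha> x) = d x" | "d (\<alpha> x) < d x" | "d x < d (\<alpha> x)" by linarith
  then show ?thesis
  proof cases
    case 1
    have "face (2 * \<alpha> x) = Suc (2 * q (\<alpha> x))" using face_conf[of "\<alpha> x"] x 1 by simp
    then show ?thesis
      using face_conf[OF x 1] x w.q_mem[of "\<alpha> x"] d_q[of "\<alpha> x"] 1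
      by (simp add: Qm.mate_def faceperm_Qm qd_Qm)
  next
    case 2
    then show ?thesis using face_up[OF x 2] x w.q_mem
      by (simp add: Qm.mate_def faceperm_Qm qd_Qm)
  next
    case 3
    have "d (\<alpha> (\<alpha> x)) < d (\<alpha> x)" using x 3 by simp
    note f = face_up[OF a_mem[OF x] this]
    show ?thesis using f x 3 w.q_mem[of "\<alpha> x"] d_q[of "\<alpha> x"]
      by (simp add: Qm.mate_def faceperm_Qm qd_Qm)
  qed
qed

lemma Qm_next_out: "x \<in> D \<Longrightarrow> Qm.next_out (2 * x) = 2 * \<sigma> x"
  using next_rot(1) by (simp add: Qm_outward)

lemma iso_Phi_Qm: "iso_map (Phi Qm) M"
  unfolding iso_map_def
proof (intro exI[of _ "\<lambda>n. n div 2"] conjI ballI)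
  show "bij_betw (\<lambda>n. n div 2) (darts (Phi Qm)) D"
    by (rule bij_betw_byWitness[where f' = "\<lambda>x. 2 * x"]) (auto simp: Qm_outward)
  fix n assume "n \<in> darts (Phi Qm)"
  then obtain x where x: "n = 2 * x" "x \<in> D" "n \<in> Qm.outward" by (auto simp: Qm_outward elim!: evenE)
  show "edge_inv (Phi Qm) n div 2 = \<alpha> (n div 2)" using x Qm_mate by simp
  show "vert_rot (Phi Qm) n div 2 = \<sigma> (n div 2)" using x Qm_next_out by simp
next
  show "(\<lambda>n. n div 2) ` org (Phi Qm) = org M"
  proof -
    have Morg: "x \<in> org M \<longleftrightarrow> x \<in> D \<and> d x = 0" for x
    proof
      assume "x \<in> org M"
      then have "x \<in> D" "vertex_of M x = org M" using org_M vof_sub[OF o_D] vof_eq[OF o_D, of x] by auto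
      then show "x \<in> D \<and> d x = 0" using geo by (simp add: geodesic_def)
    next
      assume x: "x \<in> D \<and> d x = 0"
      then have "d x = 0 \<longleftrightarrow> vertex_of M x = org M" using geo unfolding geodesic_def by blast
      then have "vertex_of M x = org M" using x by simp
      then show "x \<in> org M" using vof_self[of x] by simp
    qed
    have "n \<in> org (Phi Qm) \<longleftrightarrow> even n \<and> n div 2 \<in> org M" for n
    proof -
      have "n \<in> org (Phi Qm) \<longleftrightarrow> n \<in> QP \<and> qd Qm n = 0"
        using Qm.org_iff[of n] by (auto simp: Qm.Phi_org Qm_outward)
      then show ?thesis using qd_Qm[of n] Morg[of "n div 2"] by (auto simp: lbl_def)
    qed
    then show ?thesis by (force intro: image_eqI[of _ _ "2 * _"])
  qed
  have "Qm.rt = 2 * rt0"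
    using Qm.rt_unique[of "2 * rt0"] rt0_props by (simp add: Qm_outward)
  then show "rootd (Phi Qm) div 2 = rootd M"
    using Qm_next_out rt0_props by (simp add: Qm.Phi_rootd)
qed

end

section \<open>The bijection on isomorphism classes\<close>

lemma iso_map_refl: "iso_map M M"
  unfolding iso_map_def by (intro exI[of _ id]) auto

lemma iso_map_trans:
  assumes "iso_map M M'" "iso_map M' M''"
  shows "iso_map M M''"
proof -
  obtain f where f: "bij_betw f (darts M) (darts M')
     \<and> (\<forall>x\<in>darts M. f (edge_inv M x) = edge_inv M' (f x) \<and> f (vert_rot M x) = vert_rot M' (f x))
     \<and> f ` org M = org M' \<and> f (rootd M) = rootd M'"
    using assms(1) unfolding iso_map_def ..
  obtain g where g: "bij_betw g (darts M') (darts M'')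
     \<and> (\<forall>x\<in>darts M'. g (edge_inv M' x) = edge_inv M'' (g x) \<and> g (vert_rot M' x) = vert_rot M'' (g x))
     \<and> g ` org M' = org M'' \<and> g (rootd M') = rootd M''"
    using assms(2) unfolding iso_map_def ..
  have mem: "f x \<in> darts M'" if "x \<in> darts M" for x using f that by (auto dest: bij_betwE)
  show ?thesis
    unfolding iso_map_def
  proof (intro exI[of _ "g \<circ> f"] conjI ballI)
    show "bij_betw (g \<circ> f) (darts M) (darts M'')"
      using conjunct1[OF f] conjunct1[OF g] by (rule bij_betw_trans)
    have "g ` f ` org M = org M''" using f g by simp
    then show "(g \<circ> f) ` org M = org M''" by (simp only: image_comp)
  qed (use f g mem in simp_all)
qed

lemma iso_map_sym:
  assumes "M \<in> MSet" "M' \<in> MSet" "iso_map M M'"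
  shows "iso_map M' M"
proof -
  interpret M: combinatorial_map M by (rule MSet_combinatorial_map[OF assms(1)])
  obtain f where f: "bij_betw f (darts M) (darts M')
     \<and> (\<forall>x\<in>darts M. f (edge_inv M x) = edge_inv M' (f x) \<and> f (vert_rot M x) = vert_rot M' (f x))
     \<and> f ` org M = org M' \<and> f (rootd M) = rootd M'"
    using assms(3) unfolding iso_map_def ..
  let ?g = "inv_into (darts M) f"
  have g: "bij_betw ?g (darts M') (darts M)" using f bij_betw_inv_into by blast
  have gf: "?g (f x) = x" if "x \<in> darts M" for x using bij_betw_inv_into_left[OF conjunct1[OF f] that] .
  have "org M \<subseteq> darts M" "rootd M \<in> darts M"
    using assms(1) M.vof_sub by (auto simp: MSet_def M.vertices_alt)
  then have "?g ` f ` org M = org M" "?g (f (rootd M)) = rootd M"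
    using gf by (auto simp: image_image subset_iff)
  then have "?g ` org M' = org M" "?g (rootd M') = rootd M" using f by simp_all
  moreover have "?g (edge_inv M' y) = edge_inv M (?g y) \<and> ?g (vert_rot M' y) = vert_rot M (?g y)"
    if y: "y \<in> darts M'" for y
  proof -
    have "y \<in> f ` darts M" using f y by (simp add: bij_betw_def)
    then obtain x where x: "x \<in> darts M" "y = f x" by auto
    have "edge_inv M' y = f (edge_inv M x)" "vert_rot M' y = f (vert_rot M x)" using f x by simp_all
    then show ?thesis using gf x by simp
  qed
  ultimately show ?thesis unfolding iso_map_def using g by (intro exI[of _ ?g]) simp
qed

lemma iso_map_stats:
  assumes "M \<in> MSet" "M' \<in> MSet" "iso_map M M'"
  shows "nedges M' = nedges M" "nfaces M' = nfaces M" "mroot_dist M' = mroot_dist M"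
proof -
  obtain f where f: "bij_betw f (darts M) (darts M')
     \<and> (\<forall>x\<in>darts M. f (edge_inv M x) = edge_inv M' (f x) \<and> f (vert_rot M x) = vert_rot M' (f x))
     \<and> f ` org M = org M' \<and> f (rootd M) = rootd M'"
    using assms(3) unfolding iso_map_def ..
  interpret M: combinatorial_map M by (rule MSet_combinatorial_map[OF assms(1)])
  interpret M': combinatorial_map M' by (rule MSet_combinatorial_map[OF assms(2)])
  interpret cmap_iso M M' f using f by unfold_locales auto
  show "nedges M' = nedges M" "nfaces M' = nfaces M"
    by (simp_all add: nedges_def nfaces_def card_edges_iso card_faces_iso)
  show "mroot_dist M' = mroot_dist M"
    using vdist_iso[of "org M" "rootd M"] f assms
    by (simp add: mroot_dist_def MSet_def planar_map_def)
qed

lemma Phi_surj: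
  assumes "M \<in> MSet"
  obtains Q where "Q \<in> QSet" "iso_map (Phi Q) M"
proof -
  interpret M: combinatorial_map M by (rule MSet_combinatorial_map[OF assms])
  have pl: "planar_map M" and conn: "connected_map M" and org: "org M \<in> vertices M"
    and root: "rootd M \<in> darts M"
    using assms by (auto simp: MSet_def planar_map_def)
  obtain z where z: "z \<in> darts M" "org M = vertex_of M z" using org by (auto simp: M.vertices_alt)
  interpret pointed_map M z using conn z root by unfold_locales
  obtain f where f: "bij_betw f (darts (Phi Qm)) (darts M)
     \<and> (\<forall>x\<in>darts (Phi Qm). f (edge_inv (Phi Qm) x) = edge_inv M (f x)
          \<and> f (vert_rot (Phi Qm) x) = vert_rot M (f x))
     \<and> f ` org (Phi Qm) = org M \<and> f (rootd (Phi Qm)) = rootd M"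
    using iso_Phi_Qm unfolding iso_map_def ..
  interpret I: cmap_iso "Phi Qm" M f using f by unfold_locales auto
  \<comment> \<open>The isomorphism with M preserves the numbers of vertices, edges and faces;
    \<open>Phi_planar\<close> then carries planarity back to \<open>Qm\<close>.\<close>
  have "planar_map (Phi Qm)"
    using pl Qm.Phi_cmap Qm.outward_nonempty Qm.Phi_connected
    by (simp add: planar_map_def I.card_vertices_iso I.card_edges_iso I.card_faces_iso)
  then have "planar_map Qm" by (simp only: Qm.Phi_planar)
  then have "Qm \<in> QSet"
    using Qm.org Qm.root Qm.quad by (simp only: QSet_def is_quadrangulation_def mem_Collect_eq) blast
  then show ?thesis using iso_Phi_Qm that by blast
qed

lemma iso_quad_iff:
  assumes "Q \<in> QSet" "Q' \<in> QSet"
  shows "iso_quad Q Q' \<longleftrightarrow> iso_map (Phi Q) (Phi Q')"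
proof -
  interpret two_quads Q Q'
    using assms QSet_rooted_bipartite_quad by (simp add: two_quads_def)
  show ?thesis using Phi_respects_iso Phi_reflects_iso by blast
qed

section \<open>Counting isomorphism classes\<close>

lemma equiv_isoM: "equiv MSet isoM_rel"
proof (rule equivI)
  show "isoM_rel \<subseteq> MSet \<times> MSet" by (auto simp: isoM_rel_def)
  show "refl_on MSet isoM_rel" by (auto simp: refl_on_def isoM_rel_def iso_map_refl)
  show "sym isoM_rel" by (auto simp: sym_def isoM_rel_def intro: iso_map_sym)
  show "trans isoM_rel" by (auto simp: trans_def isoM_rel_def intro: iso_map_trans)
qed

text \<open>As a pullback along \<open>Phi\<close>, the relation inherits symmetry and transitivity
  from the relation on maps.\<close>

lemma isoQ_rel_alt: "isoQ_rel = {(Q, Q'). Q \<in> QSet \<and> Q' \<in> QSet \<and> (Phi Q, Phi Q') \<in> isoM_rel}"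
  using iso_quad_iff Phi_MSet by (auto simp: isoQ_rel_def isoM_rel_def)

lemma equiv_isoQ: "equiv QSet isoQ_rel"
proof (rule equivI)
  show "isoQ_rel \<subseteq> QSet \<times> QSet" by (auto simp: isoQ_rel_def)
  show "refl_on QSet isoQ_rel"
    using Phi_MSet by (auto simp: refl_on_def isoQ_rel_alt isoM_rel_def iso_map_refl)
  show "sym isoQ_rel"
    using equiv_isoM by (auto simp: equiv_def sym_def isoQ_rel_alt)
  show "trans isoQ_rel"
    using equiv_isoM unfolding equiv_def trans_def isoQ_rel_alt by blast
qed

lemma Phi_stats:
  assumes "Q \<in> QSet"
  shows "nedges (Phi Q) = nfaces Q" "nfaces (Phi Q) = nlocmax Q" "mroot_dist (Phi Q) = qroot_dist Q"
proof -
  interpret rooted_bipartite_quad Q by (rule QSet_rooted_bipartite_quad[OF assms])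
  show "nedges (Phi Q) = nfaces Q" "nfaces (Phi Q) = nlocmax Q" "mroot_dist (Phi Q) = qroot_dist Q"
    by (rule Phi_nedges Phi_nfaces Phi_root_dist)+
qed

text \<open>\<open>Phi\<close> is bijective only up to isomorphism, so both quotients are written as
  images of one set of quadrangulations under class maps with the same fibres.\<close>

lemma card_classes:
  "card ({M \<in> MSet. nedges M = N \<and> nfaces M = n \<and> mroot_dist M = t} // isoM_rel)
     = card ({Q \<in> QSet. nfaces Q = N \<and> nlocmax Q = n \<and> qroot_dist Q = t} // isoQ_rel)"
    (is "card (?SM // _) = card (?SQ // _)")
proof -
  let ?G = "\<lambda>Q. isoM_rel `` {Phi Q}" and ?H = "\<lambda>Q. isoQ_rel `` {Q}"
  have "?SM // isoM_rel = ?G ` ?SQ"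
  proof
    show "?SM // isoM_rel \<subseteq> ?G ` ?SQ"
    proof
      fix C assume "C \<in> ?SM // isoM_rel"
      then obtain M where M: "M \<in> ?SM" "C = isoM_rel `` {M}" by (auto simp: quotient_def)
      then obtain Q where Q: "Q \<in> QSet" "iso_map (Phi Q) M" using Phi_surj by blast
      have "(Phi Q, M) \<in> isoM_rel" using Q M Phi_MSet by (simp add: isoM_rel_def)
      then have "isoM_rel `` {Phi Q} = isoM_rel `` {M}" by (rule equiv_class_eq[OF equiv_isoM])
      moreover have "Q \<in> ?SQ"
        using iso_map_stats[OF Phi_MSet[OF Q(1)] _ Q(2)] Phi_stats[OF Q(1)] M Q(1) by simp
      ultimately show "C \<in> ?G ` ?SQ" using M by (intro image_eqI[of _ _ Q]) auto
    qed
    show "?G ` ?SQ \<subseteq> ?SM // isoM_rel"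
    proof
      fix C assume "C \<in> ?G ` ?SQ"
      then obtain Q where Q: "Q \<in> ?SQ" "C = isoM_rel `` {Phi Q}" by auto
      then have "Phi Q \<in> ?SM" using Phi_MSet Phi_stats by simp
      then show "C \<in> ?SM // isoM_rel" unfolding Q(2) by (rule quotientI)
    qed
  qed
  moreover have "?SQ // isoQ_rel = ?H ` ?SQ" by (auto simp: quotient_def)
  moreover have "card (?G ` ?SQ) = card (?H ` ?SQ)"
  proof (rule card_image_eq_iff)
    fix Q Q' assume "Q \<in> ?SQ" "Q' \<in> ?SQ"
    then have Q: "Q \<in> QSet" "Q' \<in> QSet" by auto
    have "?G Q = ?G Q' \<longleftrightarrow> (Phi Q, Phi Q') \<in> isoM_rel"
      using eq_equiv_class_iff[OF equiv_isoM] Phi_MSet Q by simp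
    moreover have "?H Q = ?H Q' \<longleftrightarrow> (Q, Q') \<in> isoQ_rel"
      using eq_equiv_class_iff[OF equiv_isoQ] Q by simp
    ultimately show "?G Q = ?G Q' \<longleftrightarrow> ?H Q = ?H Q'" using Q by (simp add: isoQ_rel_alt)
  qed
  ultimately show ?thesis by simp
qed

theorem theorem2:
  shows "(\<forall>Q\<in>QSet. Phi Q \<in> MSet)
    \<and> (\<forall>Q\<in>QSet. \<forall>Q'\<in>QSet. iso_quad Q Q' \<longrightarrow> iso_map (Phi Q) (Phi Q'))
    \<and> (\<forall>Q\<in>QSet. \<forall>Q'\<in>QSet. iso_map (Phi Q) (Phi Q') \<longrightarrow> iso_quad Q Q')
    \<and> (\<forall>M\<in>MSet. \<exists>Q\<in>QSet. iso_map (Phi Q) M)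
    \<and> (\<forall>Q\<in>QSet. nedges (Phi Q) = nfaces Q
                 \<and> nfaces (Phi Q) = nlocmax Q
                 \<and> mroot_dist (Phi Q) = qroot_dist Q)
    \<and> (\<forall>N n t. card ({M \<in> MSet. nedges M = N \<and> nfaces M = n \<and> mroot_dist M = t} // isoM_rel)
             = card ({Q \<in> QSet. nfaces Q = N \<and> nlocmax Q = n \<and> qroot_dist Q = t} // isoQ_rel))"
proof (intro conjI ballI allI)
  show "\<exists>Q\<in>QSet. iso_map (Phi Q) M" if "M \<in> MSet" for M
    using Phi_surj[OF that] by blast
qed (simp_all add: Phi_MSet iso_quad_iff Phi_stats card_classes)

end
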